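(* Let $m>1$ be real and let $\psi$ be a real analytic function near $0\in\mathbb{R}$ with $\psi(0)=0$ and $\psi'(0)\neq0$. Consider the vector field near the origin of $\mathbb{R}^2$ $$\dot x=\Phi(x,y):=\tfrac{1-m}{2}x^2+\psi(y),\qquad \dot y=-xy .$$ Then $(x,y)\mapsto(\xi,\eta):=(x,\Phi(x,y))$ has Jacobian determinant $\Phi_y(0,0)=\psi'(0)\neq0$ at the origin and is a local diffeomorphism there, and in these coordinates the germ takes the form $$\dot\xi=\eta,\qquad \dot\eta=a_3\,\xi^3+b_1\,\xi\eta+(\text{terms of quasi-homogeneous weight}\ge5),\qquad a_3=\tfrac{1-m}{2},\quad b_1=-m,$$ with weights $\operatorname{wt}(\xi)=1$, $\operatorname{wt}(\eta)=2$. The sign of $b_1^2+8a_3$ is invariant under the scalings preserving this form, and $$b_1^2+8a_3=m^2+4(1-m)=(m-2)^2\ge0 .$$ Consequently, since $a_3<0$ for $m>1$, the local phase portrait at the origin consists of one hyperbolic and one elliptic sector, for every $m>1$ without exception. This conclusion does not depend on $\psi$ beyond $\psi'(0)\neq0$ (given $\psi(0)=0$).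
   Context: The quasi-homogeneous weight of the monomial $\xi^i\eta^j$ is $i+2j$. The scalings preserving the form are $\xi\mapsto\alpha\xi$, $\eta\mapsto\beta\eta$, $t\mapsto\gamma t$ with nonzero real $\alpha,\beta,\gamma$ satisfying $\beta\gamma=\alpha$ (so that $\dot\xi=\eta$ is preserved). The description of the phase portrait is in terms of the standard sectorial decomposition of an isolated singular point into hyperbolic, elliptic and parabolic sectors, as in the classification of nilpotent singular points (Andreev; Dumortier--Llibre--Artés): "one hyperbolic and one elliptic sector" means exactly one hyperbolic sector and exactly one elliptic sector, parabolic sectors not being counted. *)

theory Defs
  imports "HOL-Analysis.Analysis"
begin

section \<open>Real analytic germs in one and two variables\<close>

definition real_analytic_at :: "(real \<Rightarrow> real) \<Rightarrow> real \<Rightarrow> bool" where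
  "real_analytic_at f a \<longleftrightarrow>
     (\<exists>c. \<exists>r>0. \<forall>h. \<bar>h\<bar> < r \<longrightarrow> (\<lambda>n. c n * h ^ n) sums f (a + h))"

text \<open>The germ of \<open>f\<close> at the origin is the sum of the (unconditionally) convergent
  double power series with coefficients \<open>c i j\<close>.\<close>

definition has_power_series2 :: "(real \<times> real \<Rightarrow> real) \<Rightarrow> (nat \<Rightarrow> nat \<Rightarrow> real) \<Rightarrow> bool" where
  "has_power_series2 f c \<longleftrightarrow>
     (\<exists>r>0. \<forall>u v. \<bar>u\<bar> < r \<longrightarrow> \<bar>v\<bar> < r \<longrightarrow>
        ((\<lambda>(i, j). c i j * u ^ i * v ^ j) has_sum f (u, v)) UNIV)"

definition real_analytic2_at :: "(real \<times> real \<Rightarrow> real) \<Rightarrow> real \<times> real \<Rightarrow> bool" where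
  "real_analytic2_at f p \<longleftrightarrow> (\<exists>c. has_power_series2 (\<lambda>q. f (p + q)) c)"

definition analytic_diffeo ::
    "(real \<times> real \<Rightarrow> real \<times> real) \<Rightarrow> (real \<times> real) set \<Rightarrow> (real \<times> real) set
      \<Rightarrow> (real \<times> real \<Rightarrow> real \<times> real) \<Rightarrow> bool" where
  "analytic_diffeo F U W G \<longleftrightarrow>
     open U \<and> open W \<and> homeomorphism U W F G \<and>
     (\<forall>p\<in>U. real_analytic2_at (fst \<circ> F) p \<and> real_analytic2_at (snd \<circ> F) p) \<and>
     (\<forall>q\<in>W. real_analytic2_at (fst \<circ> G) q \<and> real_analytic2_at (snd \<circ> G) q)"

definition jacobian_matrix ::
    "(real \<times> real \<Rightarrow> real \<times> real) \<Rightarrow> real \<times> real \<Rightarrow> real^2^2" where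
  "jacobian_matrix F p = (let D = frechet_derivative F (at p) in
     vector [vector [fst (D (1, 0)), fst (D (0, 1))],
             vector [snd (D (1, 0)), snd (D (0, 1))]])"


section \<open>The vector field, coordinate changes and the quasi-homogeneous form\<close>

definition Phi :: "real \<Rightarrow> (real \<Rightarrow> real) \<Rightarrow> real \<times> real \<Rightarrow> real" where
  "Phi m \<psi> = (\<lambda>(x, y). (1 - m) / 2 * x\<^sup>2 + \<psi> y)"

definition vfield :: "real \<Rightarrow> (real \<Rightarrow> real) \<Rightarrow> real \<times> real \<Rightarrow> real \<times> real" where
  "vfield m \<psi> = (\<lambda>(x, y). (Phi m \<psi> (x, y), - x * y))"

definition coords :: "real \<Rightarrow> (real \<Rightarrow> real) \<Rightarrow> real \<times> real \<Rightarrow> real \<times> real" where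
  "coords m \<psi> = (\<lambda>(x, y). (x, Phi m \<psi> (x, y)))"

text \<open>The vector field \<open>X\<close> written in the coordinates \<open>F\<close>, where \<open>G\<close> is the inverse of \<open>F\<close>.\<close>

definition push_field ::
    "(real \<times> real \<Rightarrow> real \<times> real) \<Rightarrow> (real \<times> real \<Rightarrow> real \<times> real)
      \<Rightarrow> (real \<times> real \<Rightarrow> real \<times> real) \<Rightarrow> real \<times> real \<Rightarrow> real \<times> real" where
  "push_field F G X q = frechet_derivative F (at (G q)) (X (G q))"

definition qh_weight :: "nat \<Rightarrow> nat \<Rightarrow> nat" where
  "qh_weight i j = i + 2 * j"

text \<open>The germ of \<open>V\<close> at the origin is \<open>(\<eta>, a \<xi>\<^sup>3 + b \<xi> \<eta> + R(\<xi>, \<eta>))\<close>, with \<open>R\<close> analytic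
  and containing only monomials of weight at least 5.\<close>

definition qh_form :: "real \<Rightarrow> real \<Rightarrow> (real \<times> real \<Rightarrow> real \<times> real) \<Rightarrow> bool" where
  "qh_form a b V \<longleftrightarrow>
     (\<forall>\<^sub>F q in nhds (0, 0). fst (V q) = snd q) \<and>
     (\<exists>c. has_power_series2 (\<lambda>(\<xi>, \<eta>). snd (V (\<xi>, \<eta>)) - (a * \<xi> ^ 3 + b * \<xi> * \<eta>)) c \<and>
          (\<forall>i j. qh_weight i j < 5 \<longrightarrow> c i j = 0))"

text \<open>The field \<open>V\<close> in the variables \<open>\<xi>' = \<alpha> \<xi>\<close>, \<open>\<eta>' = \<beta> \<eta>\<close> and the time \<open>t' = \<gamma> t\<close>.\<close>

definition rescale ::
    "real \<Rightarrow> real \<Rightarrow> real \<Rightarrow> (real \<times> real \<Rightarrow> real \<times> real) \<Rightarrow> real \<times> real \<Rightarrow> real \<times> real" where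
  "rescale \<alpha> \<beta> \<gamma> V = (\<lambda>(\<xi>', \<eta>').
     (\<alpha> / \<gamma> * fst (V (\<xi>' / \<alpha>, \<eta>' / \<beta>)), \<beta> / \<gamma> * snd (V (\<xi>' / \<alpha>, \<eta>' / \<beta>))))"


section \<open>Sectorial decomposition of an isolated singular point\<close>

text \<open>\<open>q\<close> is reached from \<open>p\<close> in forward time along a solution of \<open>z' = X z\<close> staying in \<open>S\<close>.
  This relation records the orbits of \<open>X\<close> in \<open>S\<close> together with their orientation.\<close>

definition flows_to ::
    "('a::real_normed_vector \<Rightarrow> 'a) \<Rightarrow> 'a set \<Rightarrow> 'a \<Rightarrow> 'a \<Rightarrow> bool" where
  "flows_to X S p q \<longleftrightarrow>
     (\<exists>T\<ge>0. \<exists>\<gamma>. \<gamma> 0 = p \<and> \<gamma> T = q \<and>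
        (\<forall>t\<in>{0..T}. \<gamma> t \<in> S \<and> (\<gamma> has_vector_derivative X (\<gamma> t)) (at t within {0..T})))"

text \<open>All model sectors live on the closed quarter disc, with the singular point at the corner
  and the two straight edges as bounding orbits.  The fields are the saddle \<open>(u, -v)\<close>, the node
  \<open>(u, v)\<close>, and \<open>w' = w\<^sup>3\<close>; the last one becomes, under \<open>z = w\<^sup>2\<close>, the dipole \<open>z' = 2 z\<^sup>2\<close> on the
  upper half disc, whose orbits lie on circles tangent to the real axis at the origin.\<close>

datatype sector_kind = Hyperbolic | Elliptic | Parabolic

fun model_field :: "sector_kind \<Rightarrow> complex \<Rightarrow> complex" where
  "model_field Hyperbolic = (\<lambda>w. cnj w)"
| "model_field Elliptic = (\<lambda>w. w ^ 3)"
| "model_field Parabolic = (\<lambda>w. w)"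

definition quarter_disc :: "complex set" where
  "quarter_disc = {w. norm w \<le> 1 \<and> 0 \<le> Re w \<and> 0 \<le> Im w}"

definition quarter_edges :: "complex set" where
  "quarter_edges = {w \<in> quarter_disc. Re w = 0 \<or> Im w = 0}"

text \<open>The set \<open>S\<close>, with corner \<open>p\<close> and bounding orbits \<open>B\<close>, is a sector of kind \<open>k\<close>: a
  homeomorphism onto the model maps orbits to orbits, either all with the same or all with the
  reversed orientation.  Reversal makes attracting and repelling parabolic sectors both
  \<open>Parabolic\<close>.\<close>

definition is_sector ::
    "('a::real_normed_vector \<Rightarrow> 'a) \<Rightarrow> 'a \<Rightarrow> 'a set \<Rightarrow> 'a set \<Rightarrow> sector_kind \<Rightarrow> bool" where
  "is_sector X p S B k \<longleftrightarrow>
     (\<exists>h h'. homeomorphism S quarter_disc h h' \<and> h p = 0 \<and> h ` B = quarter_edges \<and>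
       ((\<forall>a\<in>S. \<forall>b\<in>S. flows_to X S a b \<longleftrightarrow>
            flows_to (model_field k) quarter_disc (h a) (h b)) \<or>
        (\<forall>a\<in>S. \<forall>b\<in>S. flows_to X S a b \<longleftrightarrow>
            flows_to (model_field k) quarter_disc (h b) (h a))))"

text \<open>The \<open>i\<close>-th of \<open>n\<close> equal wedges of the closed unit disc, and its two bounding rays.\<close>

definition wedge :: "nat \<Rightarrow> nat \<Rightarrow> complex set" where
  "wedge n i = {of_real r * cis \<theta> | r \<theta>. 0 \<le> r \<and> r \<le> 1 \<and>
     2 * pi * real i / real n \<le> \<theta> \<and> \<theta> \<le> 2 * pi * real (i + 1) / real n}"

definition wedge_rays :: "nat \<Rightarrow> nat \<Rightarrow> complex set" where
  "wedge_rays n i = {of_real r * cis (2 * pi * real k / real n) | r k.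
     0 \<le> r \<and> r \<le> 1 \<and> k \<in> {i, i + 1}}"

text \<open>\<open>V\<close> is a topological closed disc around the isolated singular point \<open>p\<close>, cut by finitely
  many orbits that tend to \<open>p\<close> into sectors whose kinds are, in cyclic order, \<open>ks\<close>.  A
  homeomorphism of the disc can make the cutting rays equally spaced, so using equal wedges
  loses no generality.\<close>

definition sectorial_decomposition ::
    "('a::real_normed_vector \<Rightarrow> 'a) \<Rightarrow> 'a \<Rightarrow> 'a set \<Rightarrow> sector_kind list \<Rightarrow> bool" where
  "sectorial_decomposition X p V ks \<longleftrightarrow>
     ks \<noteq> [] \<and> X p = 0 \<and> (\<forall>q\<in>V - {p}. X q \<noteq> 0) \<and> p \<in> interior V \<and>
     (\<exists>\<Theta> \<Theta>'. homeomorphism (cball (0::complex) 1) V \<Theta> \<Theta>' \<and> \<Theta> 0 = p \<and>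
       (\<forall>i<length ks. is_sector X p (\<Theta> ` wedge (length ks) i)
          (\<Theta> ` wedge_rays (length ks) i) (ks ! i)))"

text \<open>Parabolic sectors are not counted.  Asking for decompositions of arbitrarily small
  neighbourhoods makes this a property of the germ of \<open>X\<close> at \<open>p\<close>.\<close>

definition local_phase_portrait ::
    "('a::real_normed_vector \<Rightarrow> 'a) \<Rightarrow> 'a \<Rightarrow> nat \<Rightarrow> nat \<Rightarrow> bool" where
  "local_phase_portrait X p n_hyp n_ell \<longleftrightarrow>
     (\<forall>\<epsilon>>0. \<exists>V ks. V \<subseteq> ball p \<epsilon> \<and> sectorial_decomposition X p V ks \<and>
        count_list ks Hyperbolic = n_hyp \<and> count_list ks Elliptic = n_ell)"

end

theory Submission
  imports Defs "HOL-Complex_Analysis.Complex_Analysis" "HOL-Real_Asymp.Real_Asymp"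
begin

text \<open>
  Write \<open>a = (m - 1) / 2 > 0\<close> and \<open>k = \<psi>'(0)\<close>.

  Since \<open>\<psi>\<close> has an analytic inverse, the inverse of \<open>(x, y) \<mapsto> (x, \<Phi>(x, y))\<close> is
  \<open>(\<xi>, \<eta>) \<mapsto> (\<xi>, \<psi>\<^sup>-\<^sup>1(\<eta> + a \<xi>\<^sup>2))\<close>, and differentiating \<open>\<eta> = \<Phi>\<close> along the flow gives
  \<open>\<eta>' = - 2 a \<xi> \<eta> - \<xi> \<theta>(\<eta> + a \<xi>\<^sup>2)\<close>, where \<open>\<theta>(\<psi>(y)) = y \<psi>'(y)\<close>.  As \<open>\<theta>(t) = t + O(t\<^sup>2)\<close> and \<open>\<eta> + a \<xi>\<^sup>2\<close>
  is homogeneous of weight 2, replacing \<open>\<theta>(t)\<close> by \<open>t\<close> costs only terms of weight at least 5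
  (\<open>qh_coordinates\<close>).  A scaling multiplies the two coefficients of the form by \<open>1 / (\<gamma> \<alpha>)\<^sup>2\<close> and
  \<open>1 / (\<gamma> \<alpha>)\<close>; they are determined by the field because they are visible in its limits along
  the parabolas \<open>\<eta> = l \<xi>\<^sup>2\<close> (\<open>qh_form_unique\<close>), so the sign of \<open>b\<^sup>2 + 8 a\<close> cannot change.

  For the phase portrait only orbits matter, so a diffeomorphism that carries one field to a positive
  multiple of another transports sectorial decompositions (\<open>local_phase_portrait_conj\<close>).  Three such
  changes bring the field to \<open>x' = - a x\<^sup>2 + (a + 1) y\<close>, \<open>y' = - x y\<close> with \<open>a \<ge> 1/2\<close>:

  \<^item> \<open>(x, y) \<mapsto> (x q(y)\<^sup>a, y q(y))\<close> removes the higher-order terms of \<open>\<psi>\<close> once \<open>q\<close> solves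
    \<open>(y q)' = (\<psi>(y) / (k y)) q\<^sup>2\<^sup>a\<close>, a Bernoulli equation with a positive continuous solution near 0
    (\<open>linearising_coordinate\<close>, \<open>vfield_portrait\<close>); the map is smooth off the axis \<open>y = 0\<close> and the identity on it,
    which is enough because the axis is invariant (\<open>flows_to_glue\<close>);
  \<^item> \<open>y \<mapsto> y + \<beta> x\<^sup>2\<close> with a suitable \<open>\<beta>\<close> exchanges \<open>a\<close> and \<open>1 / (4 a)\<close>, because it interchanges the two
    invariant curves \<open>y = 0\<close> and \<open>y = c x\<^sup>2\<close> (\<open>qh_field_portrait\<close>);
  \<^item> a linear scaling of \<open>y\<close> turns any coefficient \<open>k \<noteq> 0\<close> into \<open>a + 1\<close> (\<open>qh_field_portrait_half\<close>).

  The remaining field is integrable, with first integral \<open>K = x\<^sup>2 y\<^sup>-\<^sup>2\<^sup>a + N(y)\<close>, and admits a global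
  chart.  In the upper half-plane \<open>\<tau> = x / (x\<^sup>2 + y)\<close> increases strictly along orbits, so that \<open>\<tau> + i J\<close> with
  \<open>J = exp(-K) / 2\<close> turns the orbits into horizontal lines, and \<open>-1 / (\<tau> + i J)\<close> turns them into
  arcs of circles tangent to the real axis at 0: the elliptic sector.  In the lower half-plane \<open>-x\<close> increases strictly,
  and together with a function of the first integral it turns the orbits into horizontal lines: the
  hyperbolic sector.  The two half-charts extend continuously to the axis and
  form an injective continuous map of the plane, hence a homeomorphism onto an open set by invariance
  of domain, and this open set contains the closed unit disc.  The preimage of
  the disc is a decomposed neighbourhood of the origin (\<open>model_sectorial_decomposition\<close>), and the
  quasi-homogeneous dilations shrink it arbitrarily.
\<close>

section \<open>Orbits under changes of coordinates and of time\<close>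

text \<open>A positive speed factor changes only the parametrisation of an orbit: with
  \<open>\<theta>(t) = \<integral>\<^sub>0\<^sup>t \<rho>\<close>, the curve \<open>\<delta> \<circ> \<theta>\<^sup>-\<^sup>1\<close> is a solution.\<close>
lemma flows_to_reparametrised:
  fixes \<delta> :: "real \<Rightarrow> 'a::real_normed_vector"
  assumes T: "0 \<le> T" and \<rho>: "continuous_on {0..T} \<rho>" "\<And>t. t \<in> {0..T} \<Longrightarrow> 0 < \<rho> t"
    and \<delta>: "\<And>t. t \<in> {0..T} \<Longrightarrow> \<delta> t \<in> S"
      "\<And>t. t \<in> {0..T} \<Longrightarrow> (\<delta> has_vector_derivative \<rho> t *\<^sub>R X (\<delta> t)) (at t within {0..T})"
  shows "flows_to X S (\<delta> 0) (\<delta> T)"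
proof -
  \<comment> \<open>extending \<open>\<rho>\<close> by constants makes \<open>\<theta>\<^sup>-\<^sup>1\<close> differentiable up to the ends\<close>
  define clamp where "clamp t = max 0 (min T t)" for t
  have clamp: "clamp t \<in> {0..T}" "t \<in> {0..T} \<Longrightarrow> clamp t = t" for t
    using T by (auto simp: clamp_def)
  have cc: "continuous_on UNIV clamp"
    unfolding clamp_def by (intro continuous_intros)
  define r where "r = \<rho> \<circ> clamp"
  have rc: "continuous_on UNIV r"
    unfolding r_def by (rule continuous_on_compose[OF cc]) (use clamp \<rho> in \<open>auto intro: continuous_on_subset\<close>)
  have rpos: "r t > 0" for t
    unfolding r_def using clamp(1) \<rho>(2) by auto
  define \<theta> where "\<theta> t = integral {-1..t} r - integral {-1..0} r" for t
  have \<theta>': "(\<theta> has_real_derivative r t) (at t)" if "-1 < t" "t < T + 1" for t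
  proof -
    have "((\<lambda>u. integral {-1..u} r) has_vector_derivative r t) (at t within {-1..T+1})"
      by (rule integral_has_vector_derivative) (use rc that in \<open>auto intro: continuous_on_subset\<close>)
    moreover have "at t within {-1..T+1} = at t"
      by (rule at_within_interior) (use that in auto)
    ultimately have "((\<lambda>u. integral {-1..u} r) has_real_derivative r t) (at t)"
      by (simp add: has_real_derivative_iff_has_vector_derivative)
    then show ?thesis
      unfolding \<theta>_def by (auto intro!: derivative_eq_intros)
  qed
  have mono: "\<theta> s < \<theta> t" if "-1 < s" "s < t" "t < T + 1" for s t
  proof (rule DERIV_pos_imp_increasing[OF that(2)])
    fix u assume "s \<le> u" "u \<le> t"
    then have "(\<theta> has_real_derivative r u) (at u)" using that by (intro \<theta>') auto
    then show "\<exists>y. (\<theta> has_real_derivative y) (at u) \<and> y > 0" using rpos by blast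
  qed
  have cont\<theta>: "isCont \<theta> t" if "-1 < t" "t < T+1" for t
    using \<theta>'[OF that] DERIV_isCont by blast
  have inj\<theta>: "s = t" if "-1 < s" "s < T + 1" "-1 < t" "t < T + 1" "\<theta> s = \<theta> t" for s t
    using mono[of s t] mono[of t s] that by (metis less_irrefl linorder_neqE_linordered_idom)
  define \<sigma> where "\<sigma> = the_inv_into {-1<..<T+1} \<theta>"
  have \<sigma>\<theta>: "\<sigma> (\<theta> t) = t" if "-1 < t" "t < T+1" for t
    unfolding \<sigma>_def by (rule the_inv_into_f_f) (use that inj\<theta> in \<open>auto simp: inj_on_def\<close>)
  have \<theta>0: "\<theta> 0 = 0" by (simp add: \<theta>_def)
  have \<sigma>img: "\<exists>t\<in>{0..T}. \<theta> t = y" if "y \<in> {0..\<theta> T}" for y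
  proof -
    have "\<exists>t\<ge>0. t \<le> T \<and> \<theta> t = y"
      by (rule IVT) (use that T cont\<theta> \<theta>0 in \<open>simp_all\<close>)
    then show ?thesis by auto
  qed
  have \<sigma>der: "(\<sigma> has_real_derivative inverse (\<rho> (\<sigma> y))) (at y)" if y: "y \<in> {0..\<theta> T}" for y
  proof -
    obtain t where t: "t \<in> {0..T}" "\<theta> t = y" using \<sigma>img[OF y] by auto
    have st: "\<sigma> y = t" using \<sigma>\<theta> t by force
    have t': "t \<in> {-1<..<T+1}" using t by auto
    have "(\<sigma> has_derivative (\<lambda>h. inverse (r t) * h)) (at (\<theta> t))"
    proof (rule has_derivative_inverse_strong[where f = \<theta> and S = "{-1<..<T+1}"])
      show "continuous_on {-1<..<T+1} \<theta>"
        using cont\<theta> by (intro continuous_at_imp_continuous_on) auto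
      show "(\<theta> has_derivative (\<lambda>h. r t * h)) (at t)"
        using \<theta>'[of t] t' by (simp add: has_field_derivative_def)
      show "(\<lambda>h. r t * h) \<circ> (\<lambda>h. inverse (r t) * h) = id"
        using rpos[of t] by (auto simp: fun_eq_iff field_simps)
    qed (use t' \<sigma>\<theta> in auto)
    moreover have "r t = \<rho> t" using clamp(2) t by (simp add: r_def)
    ultimately show ?thesis
      using t st by (simp add: has_field_derivative_def)
  qed
  have \<sigma>in: "\<sigma> y \<in> {0..T}" if "y \<in> {0..\<theta> T}" for y
    using \<sigma>img[OF that] \<sigma>\<theta> by force
  have "0 \<le> \<theta> T" using mono[of 0 T] \<theta>0 T by (cases "T = 0") auto
  moreover have "(\<delta> \<circ> \<sigma>) 0 = \<delta> 0" "(\<delta> \<circ> \<sigma>) (\<theta> T) = \<delta> T"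
    using \<sigma>\<theta>[of 0] \<sigma>\<theta>[of T] \<theta>0 T by auto
  moreover have "(\<delta> \<circ> \<sigma>) y \<in> S \<and>
      (\<delta> \<circ> \<sigma> has_vector_derivative X ((\<delta> \<circ> \<sigma>) y)) (at y within {0..\<theta> T})"
    if y: "y \<in> {0..\<theta> T}" for y
  proof
    show "(\<delta> \<circ> \<sigma>) y \<in> S" using \<sigma>in[OF y] \<delta>(1) by auto
    have "(\<sigma> has_vector_derivative inverse (\<rho> (\<sigma> y))) (at y within {0..\<theta> T})"
      using \<sigma>der[OF y] has_real_derivative_iff_has_vector_derivative has_vector_derivative_at_within
      by blast
    moreover have "(\<delta> has_vector_derivative \<rho> (\<sigma> y) *\<^sub>R X (\<delta> (\<sigma> y))) (at (\<sigma> y) within \<sigma> ` {0..\<theta> T})"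
      by (rule has_vector_derivative_within_subset[OF \<delta>(2)]) (use \<sigma>in y in auto)
    ultimately have "(\<delta> \<circ> \<sigma> has_vector_derivative
        inverse (\<rho> (\<sigma> y)) *\<^sub>R \<rho> (\<sigma> y) *\<^sub>R X (\<delta> (\<sigma> y))) (at y within {0..\<theta> T})"
      by (rule vector_diff_chain_within)
    then show "(\<delta> \<circ> \<sigma> has_vector_derivative X ((\<delta> \<circ> \<sigma>) y)) (at y within {0..\<theta> T})"
      using \<rho>(2)[OF \<sigma>in[OF y]] by simp
  qed
  ultimately show ?thesis
    unfolding flows_to_def by blast
qed

lemma flows_to_push:
  fixes D :: "'a::real_normed_vector \<Rightarrow> 'a \<Rightarrow> 'b::real_normed_vector"
  assumes D: "\<And>q. q \<in> S \<Longrightarrow> (\<Psi> has_derivative D q) (at q)"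
    and X: "\<And>q. q \<in> S \<Longrightarrow> D q (X q) = \<mu> q *\<^sub>R Y (\<Psi> q)"
    and \<mu>: "continuous_on S \<mu>" "\<And>q. q \<in> S \<Longrightarrow> 0 < \<mu> q"
    and fl: "flows_to X S a b"
  shows "flows_to Y (\<Psi> ` S) (\<Psi> a) (\<Psi> b)"
proof -
  obtain T \<gamma> where T: "0 \<le> T" "\<gamma> 0 = a" "\<gamma> T = b"
    and \<gamma>: "\<And>t. t \<in> {0..T} \<Longrightarrow> \<gamma> t \<in> S"
      "\<And>t. t \<in> {0..T} \<Longrightarrow> (\<gamma> has_vector_derivative X (\<gamma> t)) (at t within {0..T})"
    using fl unfolding flows_to_def by blast
  have c\<gamma>: "continuous_on {0..T} \<gamma>"
    by (rule continuous_on_vector_derivative) (rule \<gamma>(2))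
  have "flows_to Y (\<Psi> ` S) ((\<Psi> \<circ> \<gamma>) 0) ((\<Psi> \<circ> \<gamma>) T)"
  proof (rule flows_to_reparametrised[where \<rho> = "\<mu> \<circ> \<gamma>"])
    show "continuous_on {0..T} (\<mu> \<circ> \<gamma>)"
      by (rule continuous_on_compose[OF c\<gamma>]) (use \<mu>(1) \<gamma>(1) in \<open>auto intro: continuous_on_subset\<close>)
    fix t assume t: "t \<in> {0..T}"
    show "(\<Psi> \<circ> \<gamma> has_vector_derivative (\<mu> \<circ> \<gamma>) t *\<^sub>R Y ((\<Psi> \<circ> \<gamma>) t)) (at t within {0..T})"
      using vector_derivative_diff_chain_within[OF \<gamma>(2)[OF t], of \<Psi> "D (\<gamma> t)"]
        D[OF \<gamma>(1)[OF t]] X[OF \<gamma>(1)[OF t]] by (auto intro: has_derivative_at_withinI)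
  qed (use T \<gamma> \<mu> in auto)
  then show ?thesis using T by simp
qed

text \<open>The converse direction pushes forward along \<open>\<Psi>'\<close>, whose derivative exists because \<open>D q\<close> is
  injective, hence invertible, and \<open>\<Psi>'\<close> is already continuous.\<close>
lemma flows_to_conj:
  fixes D :: "'a::euclidean_space \<Rightarrow> 'a \<Rightarrow> 'b::euclidean_space"
  assumes "open U" "open W" "homeomorphism U W \<Psi> \<Psi>'" "S \<subseteq> U"
    and D: "\<And>q. q \<in> S \<Longrightarrow> (\<Psi> has_derivative D q) (at q)"
    and inj: "\<And>q v. q \<in> S \<Longrightarrow> D q v = 0 \<Longrightarrow> v = 0"
    and X: "\<And>q. q \<in> S \<Longrightarrow> D q (X q) = \<mu> q *\<^sub>R Y (\<Psi> q)"
    and \<mu>: "continuous_on S \<mu>" "\<And>q. q \<in> S \<Longrightarrow> 0 < \<mu> q"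
    and ab: "a \<in> S" "b \<in> S"
  shows "flows_to X S a b \<longleftrightarrow> flows_to Y (\<Psi> ` S) (\<Psi> a) (\<Psi> b)"
proof
  assume "flows_to X S a b"
  then show "flows_to Y (\<Psi> ` S) (\<Psi> a) (\<Psi> b)"
    using D X \<mu> by (intro flows_to_push[where D = D and \<mu> = \<mu>]) auto
next
  assume fl: "flows_to Y (\<Psi> ` S) (\<Psi> a) (\<Psi> b)"
  have \<Psi>': "\<Psi>' (\<Psi> q) = q" if "q \<in> U" for q
    using assms(3) that by (auto simp: homeomorphism_def)
  have \<Psi>W: "\<Psi> (\<Psi>' w) = w" "\<Psi>' w \<in> U" if "w \<in> W" for w
    using assms(3) that by (auto simp: homeomorphism_def)
  have U: "\<Psi> q \<in> W" if "q \<in> U" for q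
    using assms(3) that by (auto simp: homeomorphism_def)
  have img: "\<Psi>' ` \<Psi> ` S = S" using \<Psi>' assms(4) by force
  have "\<exists>E. \<forall>q\<in>S. (\<Psi>' has_derivative E (\<Psi> q)) (at (\<Psi> q)) \<and> (\<forall>v. E (\<Psi> q) (D q v) = v)"
  proof -
    have "\<exists>E. (\<Psi>' has_derivative E) (at (\<Psi> q)) \<and> (\<forall>v. E (D q v) = v)" if q: "q \<in> S" for q
    proof -
      have lin: "linear (D q)" using D[OF q] has_derivative_linear by blast
      then have "inj (D q)" using inj[OF q] linear_injective_0 by blast
      then obtain E where E: "linear E" "E \<circ> D q = id"
        using linear_injective_left_inverse[OF lin] by blast
      have "(\<Psi>' has_derivative E) (at (\<Psi> q))"
      proof (rule has_derivative_inverse_basic_x[where T = W])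
        show "continuous (at (\<Psi> q)) \<Psi>'"
          using assms(2,3,4) U q by (auto simp: homeomorphism_def continuous_on_eq_continuous_at)
      qed (use D[OF q] E \<Psi>' \<Psi>W U assms(2,4) q in \<open>auto simp: linear_conv_bounded_linear\<close>)
      then show ?thesis using E by (auto simp: fun_eq_iff)
    qed
    then obtain E where E: "\<forall>q\<in>S. (\<Psi>' has_derivative E q) (at (\<Psi> q)) \<and> (\<forall>v. E q (D q v) = v)"
      by metis
    show ?thesis
      by (rule exI[of _ "\<lambda>w. E (\<Psi>' w)"]) (use E \<Psi>' assms(4) in auto)
  qed
  then obtain E where E: "\<And>q. q \<in> S \<Longrightarrow> (\<Psi>' has_derivative E (\<Psi> q)) (at (\<Psi> q))"
    "\<And>q v. q \<in> S \<Longrightarrow> E (\<Psi> q) (D q v) = v" by blast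
  have "flows_to X (\<Psi>' ` \<Psi> ` S) (\<Psi>' (\<Psi> a)) (\<Psi>' (\<Psi> b))"
  proof (rule flows_to_push[where D = E and \<mu> = "\<lambda>w. inverse (\<mu> (\<Psi>' w))", OF _ _ _ _ fl])
    show "E w (Y w) = inverse (\<mu> (\<Psi>' w)) *\<^sub>R X (\<Psi>' w)" if w: "w \<in> \<Psi> ` S" for w
    proof -
      obtain q where q: "q \<in> S" "w = \<Psi> q" using w by auto
      have lin: "linear (E w)" using E(1)[OF q(1)] has_derivative_linear q by blast
      have "X q = E w (D q (X q))" using E(2) q by simp
      also have "\<dots> = \<mu> q *\<^sub>R E w (Y w)" using X[OF q(1)] q lin by (simp add: linear_cmul)
      finally have "inverse (\<mu> q) *\<^sub>R X q = inverse (\<mu> q) *\<^sub>R \<mu> q *\<^sub>R E w (Y w)" by simp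
      then show ?thesis using q \<Psi>'[of q] assms(4) \<mu>(2)[OF q(1)] by auto
    qed
    have "continuous_on (\<Psi> ` S) (\<lambda>w. \<mu> (\<Psi>' w))"
    proof (rule continuous_on_compose2[OF \<mu>(1)])
      show "continuous_on (\<Psi> ` S) \<Psi>'"
        using assms(3,4) U by (auto simp: homeomorphism_def intro: continuous_on_subset)
    qed (use img in auto)
    then show "continuous_on (\<Psi> ` S) (\<lambda>w. inverse (\<mu> (\<Psi>' w)))"
      using \<mu>(2) \<Psi>' assms(4) by (intro continuous_on_inverse) force+
    show "0 < inverse (\<mu> (\<Psi>' w))" if "w \<in> \<Psi> ` S" for w
      using that \<mu>(2) \<Psi>' assms(4) by force
  qed (use E in auto)
  moreover have "\<Psi>' (\<Psi> a) = a" "\<Psi>' (\<Psi> b) = b" using \<Psi>' ab assms(4) by auto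
  ultimately show "flows_to X S a b" using img by simp
qed

text \<open>Invariance of domain supplies the inverse homeomorphism.  The separate function \<open>h\<close> allows one to
  use on \<open>S\<close> a formula that agrees with the chart only there.\<close>
lemma flows_to_chart:
  fixes \<Psi> h :: "'a::euclidean_space \<Rightarrow> 'b::euclidean_space"
  assumes "DIM('a) = DIM('b)" "open U" "continuous_on U \<Psi>" "inj_on \<Psi> U" "S \<subseteq> U"
    and h: "\<And>q. q \<in> S \<Longrightarrow> h q = \<Psi> q"
    and "\<And>q. q \<in> S \<Longrightarrow> (\<Psi> has_derivative D q) (at q)"
    and "\<And>q v. q \<in> S \<Longrightarrow> D q v = 0 \<Longrightarrow> v = 0"
    and "\<And>q. q \<in> S \<Longrightarrow> D q (X q) = \<mu> q *\<^sub>R Y (\<Psi> q)"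
    and "continuous_on S \<mu>" "\<And>q. q \<in> S \<Longrightarrow> 0 < \<mu> q"
    and ab: "a \<in> S" "b \<in> S"
  shows "flows_to X S a b \<longleftrightarrow> flows_to Y (h ` S) (h a) (h b)"
proof -
  obtain \<Psi>' where \<Psi>': "homeomorphism U (\<Psi> ` U) \<Psi> \<Psi>'"
    using invariance_of_domain_homeomorphism assms(1-4) by (metis order_refl)
  have op: "open (\<Psi> ` U)"
    by (rule invariance_of_domain_gen) (use assms(1-4) in auto)
  have "h ` S = \<Psi> ` S" using h by (auto cong: image_cong)
  then show ?thesis
    using flows_to_conj[OF assms(2) op \<Psi>' assms(5,7-11) ab] h ab by simp
qed

lemma flows_to_cong:
  assumes "\<And>q. q \<in> S \<Longrightarrow> X q = Y q"
  shows "flows_to X S a b \<longleftrightarrow> flows_to Y S a b"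
  unfolding flows_to_def using assms by (metis (no_types, lifting))

lemma flows_to_in: "flows_to X S a b \<Longrightarrow> a \<in> S \<and> b \<in> S"
  unfolding flows_to_def by force

lemma flows_to_stationary: "X p = 0 \<Longrightarrow> p \<in> S \<Longrightarrow> flows_to X S p p"
  unfolding flows_to_def by (rule exI[of _ 0], simp, rule exI[of _ "\<lambda>_. p"]) auto

section \<open>Invariant zero sets\<close>

text \<open>Gronwall's inequality: \<open>\<phi>\<^sup>2 exp(- 2 L t)\<close> decreases and \<open>\<phi>\<^sup>2 exp(2 L t)\<close> increases, so a zero propagates forwards
  and backwards in time.\<close>
lemma zero_of_linear_growth:
  fixes \<phi> :: "real \<Rightarrow> real"
  assumes d: "\<And>t. t \<in> {0..T} \<Longrightarrow> (\<phi> has_real_derivative \<phi>' t) (at t within {0..T})"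
    and b: "\<And>t. t \<in> {0..T} \<Longrightarrow> \<bar>\<phi>' t\<bar> \<le> L * \<bar>\<phi> t\<bar>"
    and s: "s \<in> {0..T}" "\<phi> s = 0" and t: "t \<in> {0..T}"
  shows "\<phi> t = 0"
proof -
  have cont: "continuous_on {0..T} \<phi>"
    by (rule DERIV_continuous_on) (rule d)
  have within: "at x within {0..T} = at x" if "0 < x" "x < T" for x
    by (rule at_within_interior) (use that in auto)
  have d': "(\<phi> has_real_derivative \<phi>' x) (at x)" if "0 < x" "x < T" for x
    using d[of x] within that by auto
  have sq: "\<phi> x * \<phi>' x \<le> L * (\<phi> x)\<^sup>2" "- (L * (\<phi> x)\<^sup>2) \<le> \<phi> x * \<phi>' x" if "x \<in> {0..T}" for x
  proof -
    have "\<bar>\<phi> x * \<phi>' x\<bar> \<le> L * (\<phi> x)\<^sup>2"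
      using mult_left_mono[OF b[OF that], of "\<bar>\<phi> x\<bar>"] by (simp add: abs_mult power2_eq_square mult_ac)
    then show "\<phi> x * \<phi>' x \<le> L * (\<phi> x)\<^sup>2" "- (L * (\<phi> x)\<^sup>2) \<le> \<phi> x * \<phi>' x" by linarith+
  qed
  show ?thesis
  proof (cases "s \<le> t")
    case True
    have "(\<phi> t)\<^sup>2 * exp (- 2 * L * t) \<le> (\<phi> s)\<^sup>2 * exp (- 2 * L * s)"
    proof (rule DERIV_nonpos_imp_decreasing_open[OF True])
      fix x assume x: "s < x" "x < t"
      have "((\<lambda>x. (\<phi> x)\<^sup>2 * exp (- 2 * L * x)) has_real_derivative
          2 * exp (- 2 * L * x) * (\<phi> x * \<phi>' x - L * (\<phi> x)\<^sup>2)) (at x)"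
        using x s t by (auto intro!: derivative_eq_intros d' simp: algebra_simps power2_eq_square)
      moreover have "2 * exp (- 2 * L * x) * (\<phi> x * \<phi>' x - L * (\<phi> x)\<^sup>2) \<le> 0"
        using sq(1)[of x] x s t by (intro mult_nonneg_nonpos) auto
      ultimately show "\<exists>y. ((\<lambda>x. (\<phi> x)\<^sup>2 * exp (- 2 * L * x)) has_real_derivative y) (at x) \<and> y \<le> 0"
        by blast
    next
      show "continuous_on {s..t} (\<lambda>x. (\<phi> x)\<^sup>2 * exp (- 2 * L * x))"
        by (intro continuous_intros continuous_on_subset[OF cont]) (use s t in auto)
    qed
    then have "(\<phi> t)\<^sup>2 \<le> 0" using s(2) by (simp add: mult_le_0_iff)
    then show ?thesis by simp
  next
    case False
    then have ts: "t \<le> s" by simp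
    have "(\<phi> t)\<^sup>2 * exp (2 * L * t) \<le> (\<phi> s)\<^sup>2 * exp (2 * L * s)"
    proof (rule DERIV_nonneg_imp_increasing_open[OF ts])
      fix x assume x: "t < x" "x < s"
      have "((\<lambda>x. (\<phi> x)\<^sup>2 * exp (2 * L * x)) has_real_derivative
          2 * exp (2 * L * x) * (\<phi> x * \<phi>' x + L * (\<phi> x)\<^sup>2)) (at x)"
        using x s t by (auto intro!: derivative_eq_intros d' simp: algebra_simps power2_eq_square)
      moreover have "0 \<le> 2 * exp (2 * L * x) * (\<phi> x * \<phi>' x + L * (\<phi> x)\<^sup>2)"
        using sq(2)[of x] x s t by (intro mult_nonneg_nonneg) auto
      ultimately show "\<exists>y. ((\<lambda>x. (\<phi> x)\<^sup>2 * exp (2 * L * x)) has_real_derivative y) (at x) \<and> 0 \<le> y"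
        by blast
    next
      show "continuous_on {t..s} (\<lambda>x. (\<phi> x)\<^sup>2 * exp (2 * L * x))"
        by (intro continuous_intros continuous_on_subset[OF cont]) (use s t in auto)
    qed
    then have "(\<phi> t)\<^sup>2 \<le> 0" using s(2) by (simp add: mult_le_0_iff)
    then show ?thesis by simp
  qed
qed

text \<open>By \<open>zero_of_linear_growth\<close>, this differential inequality makes \<open>f = 0\<close> and \<open>f \<noteq> 0\<close> invariant under
  the flow of \<open>X\<close> in \<open>S\<close>.  No uniqueness theorem for solutions is involved, and \<open>S\<close> may be any set.\<close>
definition invariant_zero_set ::
    "('a::real_normed_vector \<Rightarrow> 'a) \<Rightarrow> 'a set \<Rightarrow> ('a \<Rightarrow> real) \<Rightarrow> bool" where
  "invariant_zero_set X S f \<longleftrightarrow>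
     (\<exists>f' g. continuous_on S g \<and>
        (\<forall>q\<in>S. (f has_derivative f' q) (at q) \<and> \<bar>f' q (X q)\<bar> \<le> g q * \<bar>f q\<bar>))"

lemma flows_to_split:
  assumes inv: "invariant_zero_set X S f"
  shows "flows_to X S a b \<longleftrightarrow>
      flows_to X {q\<in>S. f q = 0} a b \<or> flows_to X {q\<in>S. f q \<noteq> 0} a b"
proof
  assume "flows_to X S a b"
  then obtain T \<gamma> where T: "0 \<le> T" "\<gamma> 0 = a" "\<gamma> T = b"
    and \<gamma>: "\<And>t. t \<in> {0..T} \<Longrightarrow> \<gamma> t \<in> S"
      "\<And>t. t \<in> {0..T} \<Longrightarrow> (\<gamma> has_vector_derivative X (\<gamma> t)) (at t within {0..T})"
    unfolding flows_to_def by blast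
  obtain f' g where g: "continuous_on S g"
    and f: "\<And>q. q \<in> S \<Longrightarrow> (f has_derivative f' q) (at q)"
      "\<And>q. q \<in> S \<Longrightarrow> \<bar>f' q (X q)\<bar> \<le> g q * \<bar>f q\<bar>"
    using inv unfolding invariant_zero_set_def by blast
  have c\<gamma>: "continuous_on {0..T} \<gamma>"
    by (rule continuous_on_vector_derivative) (rule \<gamma>(2))
  have "continuous_on {0..T} (g \<circ> \<gamma>)"
    by (rule continuous_on_compose[OF c\<gamma>]) (use g \<gamma>(1) in \<open>auto intro: continuous_on_subset\<close>)
  then have "\<exists>x\<in>{0..T}. \<forall>y\<in>{0..T}. (g \<circ> \<gamma>) y \<le> (g \<circ> \<gamma>) x"
    using T by (intro continuous_attains_sup) auto
  then obtain x where "\<forall>y\<in>{0..T}. g (\<gamma> y) \<le> g (\<gamma> x)" by auto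
  then obtain L where L: "\<And>t. t \<in> {0..T} \<Longrightarrow> g (\<gamma> t) \<le> L" by blast
  have d: "(f \<circ> \<gamma> has_real_derivative f' (\<gamma> t) (X (\<gamma> t))) (at t within {0..T})"
    if t: "t \<in> {0..T}" for t
    using vector_derivative_diff_chain_within[OF \<gamma>(2)[OF t], of f "f' (\<gamma> t)"] f(1)[OF \<gamma>(1)[OF t]]
    by (auto intro: has_derivative_at_withinI simp: has_real_derivative_iff_has_vector_derivative)
  have bd: "\<bar>f' (\<gamma> t) (X (\<gamma> t))\<bar> \<le> L * \<bar>(f \<circ> \<gamma>) t\<bar>" if "t \<in> {0..T}" for t
    using f(2)[OF \<gamma>(1)[OF that]] mult_right_mono[OF L[OF that], of "\<bar>f (\<gamma> t)\<bar>"] by auto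
  have "(\<forall>t\<in>{0..T}. f (\<gamma> t) = 0) \<or> (\<forall>t\<in>{0..T}. f (\<gamma> t) \<noteq> 0)"
  proof (cases "\<exists>s\<in>{0..T}. f (\<gamma> s) = 0")
    case True
    then obtain s where s: "s \<in> {0..T}" "(f \<circ> \<gamma>) s = 0" by auto
    show ?thesis
      using zero_of_linear_growth[of T "f \<circ> \<gamma>", OF d bd s] by simp
  qed blast
  then show "flows_to X {q\<in>S. f q = 0} a b \<or> flows_to X {q\<in>S. f q \<noteq> 0} a b"
    using T \<gamma> unfolding flows_to_def by blast
next
  assume "flows_to X {q\<in>S. f q = 0} a b \<or> flows_to X {q\<in>S. f q \<noteq> 0} a b"
  then show "flows_to X S a b" unfolding flows_to_def by blast
qed

text \<open>Charts are often smooth only off an invariant curve or point.  Since no orbit leaves or enters the zero set,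
  orbits can be compared on the zero set and off it separately, with two unrelated smooth charts.\<close>
lemma flows_to_glue:
  assumes inv: "invariant_zero_set X S f" "invariant_zero_set Y (h ` S) f'"
    and z: "\<And>q. q \<in> S \<Longrightarrow> f' (h q) = 0 \<longleftrightarrow> f q = 0"
    and eq0: "\<And>a b. a \<in> {q\<in>S. f q = 0} \<Longrightarrow> b \<in> {q\<in>S. f q = 0} \<Longrightarrow>
        flows_to X {q\<in>S. f q = 0} a b \<longleftrightarrow> flows_to Y (h ` {q\<in>S. f q = 0}) (h a) (h b)"
    and eq1: "\<And>a b. a \<in> {q\<in>S. f q \<noteq> 0} \<Longrightarrow> b \<in> {q\<in>S. f q \<noteq> 0} \<Longrightarrow>
        flows_to X {q\<in>S. f q \<noteq> 0} a b \<longleftrightarrow> flows_to Y (h ` {q\<in>S. f q \<noteq> 0}) (h a) (h b)"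
    and ab: "a \<in> S" "b \<in> S"
  shows "flows_to X S a b \<longleftrightarrow> flows_to Y (h ` S) (h a) (h b)"
proof -
  have im: "{w\<in>h ` S. f' w = 0} = h ` {q\<in>S. f q = 0}" "{w\<in>h ` S. f' w \<noteq> 0} = h ` {q\<in>S. f q \<noteq> 0}"
    using z by auto
  have "h c \<in> h ` {q\<in>S. f q = 0} \<longleftrightarrow> c \<in> {q\<in>S. f q = 0}"
    "h c \<in> h ` {q\<in>S. f q \<noteq> 0} \<longleftrightarrow> c \<in> {q\<in>S. f q \<noteq> 0}" if "c \<in> S" for c
    using z that by (auto simp flip: im)
  note hc = this
  have key: "flows_to X A a b \<longleftrightarrow> flows_to Y B (h a) (h b)"
    if "a \<in> A \<Longrightarrow> b \<in> A \<Longrightarrow> flows_to X A a b \<longleftrightarrow> flows_to Y B (h a) (h b)"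
      "h a \<in> B \<longleftrightarrow> a \<in> A" "h b \<in> B \<longleftrightarrow> b \<in> A" for A B
    using that flows_to_in[of X A a b] flows_to_in[of Y B "h a" "h b"] by argo
  show ?thesis
    unfolding flows_to_split[OF inv(1)] flows_to_split[OF inv(2)] im
    using key[OF eq0 hc(1)[OF ab(1)] hc(1)[OF ab(2)]] key[OF eq1 hc(2)[OF ab(1)] hc(2)[OF ab(2)]]
    by argo
qed

text \<open>The squared distance from a singular point decays at most exponentially, by Cauchy--Schwarz.\<close>
lemma invariant_point:
  assumes "continuous_on S g" "\<And>q. q \<in> S \<Longrightarrow> norm (X q) \<le> g q * norm (q - p)"
  shows "invariant_zero_set X S (\<lambda>q. (q - p) \<bullet> (q - p))"
  unfolding invariant_zero_set_def
proof (intro exI conjI ballI)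
  show "continuous_on S (\<lambda>q. 2 * g q)" using assms(1) by (intro continuous_intros)
  fix q assume q: "q \<in> S"
  show "((\<lambda>q. (q - p) \<bullet> (q - p)) has_derivative (\<lambda>h. 2 * ((q - p) \<bullet> h))) (at q)"
    by (auto intro!: derivative_eq_intros simp: inner_commute)
  have "\<bar>(q - p) \<bullet> X q\<bar> \<le> norm (q - p) * norm (X q)" by (rule Cauchy_Schwarz_ineq2)
  also have "\<dots> \<le> norm (q - p) * (g q * norm (q - p))"
    by (intro mult_left_mono assms(2) q) auto
  finally show "\<bar>2 * ((q - p) \<bullet> X q)\<bar> \<le> 2 * g q * \<bar>(q - p) \<bullet> (q - p)\<bar>"
    by (simp add: dot_square_norm power2_eq_square mult_ac abs_mult)
qed

lemma invariant_axis:
  assumes "\<And>q. snd (X q) = - fst q * snd q"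
  shows "invariant_zero_set X S (snd :: real \<times> real \<Rightarrow> real)"
  unfolding invariant_zero_set_def
proof (intro exI conjI ballI)
  show "continuous_on S (\<lambda>q. \<bar>fst q\<bar>)" by (intro continuous_intros)
  show "(snd has_derivative snd) (at q)" for q :: "real \<times> real"
    by (intro has_derivative_snd has_derivative_ident)
  show "\<bar>snd (X q)\<bar> \<le> \<bar>fst q\<bar> * \<bar>snd q\<bar>" for q
    by (simp add: assms abs_mult)
qed

lemma invariant_Im: "invariant_zero_set (\<lambda>_. 1) S Im"
  unfolding invariant_zero_set_def
proof (intro exI conjI ballI)
  show "continuous_on S (\<lambda>_. 0::real)" by (intro continuous_intros)
  show "(Im has_derivative Im) (at q)" for q
    by (rule bounded_linear_imp_has_derivative[OF bounded_linear_Im])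
qed auto

section \<open>Transport of sectorial decompositions\<close>

text \<open>The clause on orbits ranges over all subsets of \<open>U\<close>, because a sector is judged by the
  orbits inside it.\<close>
definition orbit_equivalence ::
    "('a::real_normed_vector \<Rightarrow> 'a) \<Rightarrow> 'a set \<Rightarrow> ('a \<Rightarrow> 'a) \<Rightarrow> 'a set \<Rightarrow> ('a \<Rightarrow> 'a) \<Rightarrow> ('a \<Rightarrow> 'a) \<Rightarrow> bool"
  where
  "orbit_equivalence X U Y W \<Psi> \<Psi>' \<longleftrightarrow> open U \<and> open W \<and> homeomorphism U W \<Psi> \<Psi>' \<and>
     (\<forall>q\<in>U. X q = 0 \<longleftrightarrow> Y (\<Psi> q) = 0) \<and>
     (\<forall>S\<subseteq>U. \<forall>a\<in>S. \<forall>b\<in>S. flows_to X S a b \<longleftrightarrow> flows_to Y (\<Psi> ` S) (\<Psi> a) (\<Psi> b))"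

lemma homeomorphism_imp_open_image:
  assumes "homeomorphism U W \<Psi> \<Psi>'" "open W" "A \<subseteq> U" "open A"
  shows "open (\<Psi> ` A)"
proof -
  have "openin (top_of_set W) (\<Psi> ` A)"
    by (rule homeomorphism_imp_open_map[OF assms(1)]) (use assms in \<open>simp add: openin_open_eq open_subset\<close>)
  then show ?thesis using assms(2) openin_open_trans by blast
qed

lemma is_sector_pullback:
  assumes eq: "orbit_equivalence X U Y W \<Psi> \<Psi>'" and p: "p \<in> U"
    and S: "is_sector Y (\<Psi> p) S B k" "S \<subseteq> W" "B \<subseteq> W"
  shows "is_sector X p (\<Psi>' ` S) (\<Psi>' ` B) k"
proof -
  have hom: "homeomorphism U W \<Psi> \<Psi>'"
    and fl: "\<And>S a b. S \<subseteq> U \<Longrightarrow> a \<in> S \<Longrightarrow> b \<in> S \<Longrightarrow>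
      flows_to X S a b \<longleftrightarrow> flows_to Y (\<Psi> ` S) (\<Psi> a) (\<Psi> b)"
    using eq by (auto simp: orbit_equivalence_def)
  have inv: "\<Psi> (\<Psi>' w) = w" "\<Psi>' w \<in> U" if "w \<in> W" for w
    using hom that by (auto simp: homeomorphism_def)
  obtain h h' where h: "homeomorphism S quarter_disc h h'" "h (\<Psi> p) = 0" "h ` B = quarter_edges"
    and or: "(\<forall>a\<in>S. \<forall>b\<in>S. flows_to Y S a b \<longleftrightarrow> flows_to (model_field k) quarter_disc (h a) (h b)) \<or>
       (\<forall>a\<in>S. \<forall>b\<in>S. flows_to Y S a b \<longleftrightarrow> flows_to (model_field k) quarter_disc (h b) (h a))"
    using S(1) unfolding is_sector_def by blast
  have im: "\<Psi> ` \<Psi>' ` A = A" if "A \<subseteq> W" for A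
    using inv that by force
  have U: "\<Psi>' ` S \<subseteq> U" using inv(2) S(2) by auto
  have "homeomorphism (\<Psi>' ` S) S \<Psi> \<Psi>'"
    by (rule homeomorphism_of_subsets[OF hom U]) (use S(2) im in auto)
  then have "homeomorphism (\<Psi>' ` S) quarter_disc (h \<circ> \<Psi>) (\<Psi>' \<circ> h')"
    using h(1) by (rule homeomorphism_compose)
  moreover have "(h \<circ> \<Psi>) ` \<Psi>' ` B = quarter_edges"
    by (simp only: image_comp [symmetric] im[OF S(3)] h(3))
  moreover have fS: "flows_to X (\<Psi>' ` S) a b \<longleftrightarrow> flows_to Y S (\<Psi> a) (\<Psi> b)" "\<Psi> a \<in> S" "\<Psi> b \<in> S"
    if "a \<in> \<Psi>' ` S" "b \<in> \<Psi>' ` S" for a b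
    using fl[OF U that] im[OF S(2)] that by auto
  moreover from or have "(\<forall>a\<in>\<Psi>' ` S. \<forall>b\<in>\<Psi>' ` S. flows_to X (\<Psi>' ` S) a b \<longleftrightarrow>
        flows_to (model_field k) quarter_disc ((h \<circ> \<Psi>) a) ((h \<circ> \<Psi>) b)) \<or>
      (\<forall>a\<in>\<Psi>' ` S. \<forall>b\<in>\<Psi>' ` S. flows_to X (\<Psi>' ` S) a b \<longleftrightarrow>
        flows_to (model_field k) quarter_disc ((h \<circ> \<Psi>) b) ((h \<circ> \<Psi>) a))"
    by (elim disjE; intro disjI1 disjI2 ballI; subst fS(1); (simp only: o_apply fS(2,3))?)
  ultimately show ?thesis
    unfolding is_sector_def using h(2)
    by (intro exI[of _ "h \<circ> \<Psi>"] exI[of _ "\<Psi>' \<circ> h'"]) (simp only: o_apply simp_thms)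
qed

lemma wedge_subset_cball: "wedge n i \<subseteq> cball 0 1" "wedge_rays n i \<subseteq> cball 0 1"
  by (auto simp: wedge_def wedge_rays_def norm_mult)

lemma sectorial_decomposition_pullback:
  assumes eq: "orbit_equivalence X U Y W \<Psi> \<Psi>'" and p: "p \<in> U"
    and V: "sectorial_decomposition Y (\<Psi> p) V ks" "V \<subseteq> W"
  shows "sectorial_decomposition X p (\<Psi>' ` V) ks"
proof -
  have hom: "homeomorphism U W \<Psi> \<Psi>'" and op: "open U" "open W"
    and zero: "\<And>q. q \<in> U \<Longrightarrow> X q = 0 \<longleftrightarrow> Y (\<Psi> q) = 0"
    using eq by (auto simp: orbit_equivalence_def)
  have inv: "\<Psi> (\<Psi>' w) = w" "\<Psi>' w \<in> U" if "w \<in> W" for w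
    using hom that by (auto simp: homeomorphism_def)
  have inv': "\<Psi>' (\<Psi> q) = q" if "q \<in> U" for q
    using hom that by (auto simp: homeomorphism_def)
  obtain \<Theta> \<Theta>' where \<Theta>: "homeomorphism (cball (0::complex) 1) V \<Theta> \<Theta>'" "\<Theta> 0 = \<Psi> p"
    "\<And>i. i < length ks \<Longrightarrow> is_sector Y (\<Psi> p) (\<Theta> ` wedge (length ks) i)
          (\<Theta> ` wedge_rays (length ks) i) (ks ! i)"
    using V(1) unfolding sectorial_decomposition_def by blast
  have im\<Theta>: "\<Theta> ` A \<subseteq> W" if "A \<subseteq> cball 0 1" for A
    using \<Theta>(1) that V(2) by (auto simp: homeomorphism_def)
  have "homeomorphism (cball 0 1) (\<Psi>' ` V) (\<Psi>' \<circ> \<Theta>) (\<Theta>' \<circ> \<Psi>)"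
    by (rule homeomorphism_compose[OF \<Theta>(1)],
        rule homeomorphism_of_subsets[OF homeomorphism_symD[OF hom]]) (use V(2) inv in force)+
  moreover have "is_sector X p ((\<Psi>' \<circ> \<Theta>) ` wedge (length ks) i)
      ((\<Psi>' \<circ> \<Theta>) ` wedge_rays (length ks) i) (ks ! i)" if "i < length ks" for i
    using is_sector_pullback[OF eq p \<Theta>(3)[OF that] im\<Theta> im\<Theta>] wedge_subset_cball
    by (simp add: image_comp)
  moreover have "p \<in> interior (\<Psi>' ` V)"
  proof (rule interiorI)
    show "open (\<Psi>' ` interior V)"
      by (rule homeomorphism_imp_open_image[OF homeomorphism_symD[OF hom]])
        (use op V(2) interior_subset in auto)
    show "p \<in> \<Psi>' ` interior V"
      using V(1) inv'[OF p] unfolding sectorial_decomposition_def by force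
  qed (use interior_subset in blast)
  moreover have "X q \<noteq> 0" if q: "q \<in> \<Psi>' ` V - {p}" for q
  proof -
    obtain v where v: "v \<in> V" "q = \<Psi>' v" "\<Psi>' v \<noteq> p" using q by blast
    then have "v \<in> V - {\<Psi> p}" using inv'[OF p] by auto
    then show ?thesis
      using V zero[of q] inv v unfolding sectorial_decomposition_def by auto
  qed
  ultimately show ?thesis
    using V(1) zero[OF p] \<Theta>(2) inv'[OF p] unfolding sectorial_decomposition_def by auto
qed

lemma local_phase_portrait_pullback:
  assumes eq: "orbit_equivalence X U Y W \<Psi> \<Psi>'" and p: "p \<in> U"
    and Y: "local_phase_portrait Y (\<Psi> p) m n"
  shows "local_phase_portrait X p m n"
  unfolding local_phase_portrait_def
proof (intro allI impI)
  fix \<epsilon> :: real assume "0 < \<epsilon>"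
  have hom: "homeomorphism U W \<Psi> \<Psi>'" and op: "open U" "open W"
    using eq by (auto simp: orbit_equivalence_def)
  have "open (\<Psi> ` (ball p \<epsilon> \<inter> U))"
    by (rule homeomorphism_imp_open_image[OF hom]) (use op in auto)
  then obtain e where e: "e > 0" "ball (\<Psi> p) e \<subseteq> \<Psi> ` (ball p \<epsilon> \<inter> U)"
    using p \<open>0 < \<epsilon>\<close> by (metis IntI centre_in_ball image_eqI open_contains_ball)
  obtain V ks where V: "V \<subseteq> ball (\<Psi> p) e" "sectorial_decomposition Y (\<Psi> p) V ks"
      "count_list ks Hyperbolic = m" "count_list ks Elliptic = n"
    using Y e(1) unfolding local_phase_portrait_def by blast
  have "V \<subseteq> W" using V(1) e(2) hom by (auto simp: homeomorphism_def)
  moreover have "\<Psi>' ` V \<subseteq> ball p \<epsilon>"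
    using V(1) e(2) hom by (force simp: homeomorphism_def)
  ultimately show "\<exists>V ks. V \<subseteq> ball p \<epsilon> \<and> sectorial_decomposition X p V ks \<and>
        count_list ks Hyperbolic = m \<and> count_list ks Elliptic = n"
    using sectorial_decomposition_pullback[OF eq p V(2)] V(3,4) by blast
qed

text \<open>Singular points correspond because the derivative is injective and the speed factor is positive.\<close>
lemma orbit_equivalenceI:
  fixes X Y \<Psi> :: "'a::euclidean_space \<Rightarrow> 'a"
  assumes U: "open U" "inj_on \<Psi> U"
    and D: "\<And>q. q \<in> U \<Longrightarrow> (\<Psi> has_derivative D q) (at q)"
    and inj: "\<And>q v. q \<in> U \<Longrightarrow> D q v = 0 \<Longrightarrow> v = 0"
    and X: "\<And>q. q \<in> U \<Longrightarrow> D q (X q) = \<mu> q *\<^sub>R Y (\<Psi> q)"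
    and \<mu>: "continuous_on U \<mu>" "\<And>q. q \<in> U \<Longrightarrow> 0 < \<mu> q"
  shows "\<exists>\<Psi>'. orbit_equivalence X U Y (\<Psi> ` U) \<Psi> \<Psi>'"
proof -
  have cont: "continuous_on U \<Psi>"
    using D has_derivative_continuous continuous_at_imp_continuous_on by blast
  obtain \<Psi>' where \<Psi>': "homeomorphism U (\<Psi> ` U) \<Psi> \<Psi>'"
    using invariance_of_domain_homeomorphism[OF U(1) cont order_refl U(2)] by blast
  have op: "open (\<Psi> ` U)" by (rule invariance_of_domain[OF cont U])
  have zero: "X q = 0 \<longleftrightarrow> Y (\<Psi> q) = 0" if q: "q \<in> U" for q
  proof -
    have "D q 0 = 0" using has_derivative_linear[OF D[OF q]] linear_0 by blast
    then have "X q = 0 \<longleftrightarrow> D q (X q) = 0" using inj[OF q] by auto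
    then show ?thesis using X[OF q] \<mu>(2)[OF q] by simp
  qed
  have "flows_to X S a b \<longleftrightarrow> flows_to Y (\<Psi> ` S) (\<Psi> a) (\<Psi> b)"
    if "S \<subseteq> U" "a \<in> S" "b \<in> S" for S a b
    by (rule flows_to_conj[OF U(1) op \<Psi>' that(1) D inj X _ _ that(2,3)])
      (use that \<mu> in \<open>auto intro: continuous_on_subset\<close>)
  then show ?thesis
    unfolding orbit_equivalence_def using U(1) op \<Psi>' zero by blast
qed

lemma local_phase_portrait_conj:
  fixes X Y \<Psi> :: "'a::euclidean_space \<Rightarrow> 'a"
  assumes "open U" "inj_on \<Psi> U" "\<And>q. q \<in> U \<Longrightarrow> (\<Psi> has_derivative D q) (at q)"
    and "\<And>q v. q \<in> U \<Longrightarrow> D q v = 0 \<Longrightarrow> v = 0"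
    and "\<And>q. q \<in> U \<Longrightarrow> D q (X q) = \<mu> q *\<^sub>R Y (\<Psi> q)"
    and "continuous_on U \<mu>" "\<And>q. q \<in> U \<Longrightarrow> 0 < \<mu> q"
    and "p \<in> U" "local_phase_portrait Y (\<Psi> p) m n"
  shows "local_phase_portrait X p m n"
proof -
  have "\<exists>\<Psi>'. orbit_equivalence X U Y (\<Psi> ` U) \<Psi> \<Psi>'"
    by (rule orbit_equivalenceI[where D = D and \<mu> = \<mu>]) (fact assms)+
  then show ?thesis using local_phase_portrait_pullback assms(8,9) by blast
qed

section \<open>Model sectors with rectified orbits\<close>

text \<open>A sector is compared with its model through a common field \<open>E\<close> on the image: \<open>Z\<close> rectifies \<open>X\<close>,
  and \<open>M\<close> rectifies the model field.  Neither has to be a chart at the singular point, which is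
  glued in by \<open>invariant_point\<close>; the bounds \<open>g\<close> and \<open>g'\<close> serve this purpose.\<close>
lemma is_sector_by_chart:
  fixes X :: "'a::real_inner \<Rightarrow> 'a"
  assumes H: "homeomorphism quarter_disc S H H'" "H 0 = p" "H ` quarter_edges = B"
    and X0: "X p = 0" "continuous_on S g" "\<And>q. q \<in> S \<Longrightarrow> norm (X q) \<le> g q * norm (q - p)"
    and M: "\<And>w. w \<in> quarter_disc - {0} \<Longrightarrow> Z (H w) = M w"
    and X: "\<And>a b. a \<in> S - {p} \<Longrightarrow> b \<in> S - {p} \<Longrightarrow>
        flows_to X (S - {p}) a b \<longleftrightarrow> flows_to E (Z ` (S - {p})) (Z a) (Z b)"
    and model: "\<And>v w. v \<in> quarter_disc - {0} \<Longrightarrow> w \<in> quarter_disc - {0} \<Longrightarrow>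
        flows_to (model_field k) (quarter_disc - {0}) v w \<longleftrightarrow>
        flows_to E (M ` (quarter_disc - {0})) (M v) (M w)"
      "continuous_on quarter_disc g'" "\<And>w. w \<in> quarter_disc \<Longrightarrow> norm (model_field k w) \<le> g' w * norm w"
  shows "is_sector X p S B k"
proof -
  have QD0: "0 \<in> quarter_disc" "quarter_edges \<subseteq> quarter_disc"
    by (auto simp: quarter_disc_def quarter_edges_def)
  have HH: "H' (H w) = w" "H w \<in> S" if "w \<in> quarter_disc" for w
    using H(1) that by (auto simp: homeomorphism_def)
  have HS: "H (H' q) = q" "H' q \<in> quarter_disc" if "q \<in> S" for q
    using H(1) that by (auto simp: homeomorphism_def)
  have H'p: "H' p = 0" using HH QD0 H(2) by force
  have H'z: "H' q = 0 \<longleftrightarrow> q = p" if "q \<in> S" for q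
    using HS[OF that] H'p H(2) by force
  have pS: "p \<in> S" using HH(2)[OF QD0(1)] H(2) by simp
  have H'S: "H' ` S = quarter_disc" using H(1) by (auto simp: homeomorphism_def)
  have H'S0: "H' ` (S - {p}) = quarter_disc - {0}" using H'S H'z H'p pS by force
  have ZS: "Z ` (S - {p}) = M ` (quarter_disc - {0})"
  proof -
    have "Z q = M (H' q)" if "q \<in> S - {p}" for q
      using M[of "H' q"] HS[of q] H'z that by auto
    then have "Z ` (S - {p}) = M ` H' ` (S - {p})" by force
    then show ?thesis using H'S0 by simp
  qed
  have m0: "model_field k 0 = 0" by (cases k) auto
  have fl: "flows_to X S a b \<longleftrightarrow> flows_to (model_field k) (H' ` S) (H' a) (H' b)"
    if ab: "a \<in> S" "b \<in> S" for a b
  proof (rule flows_to_glue[where f = "\<lambda>q. (q - p) \<bullet> (q - p)" and f' = "\<lambda>w. (w - 0) \<bullet> (w - 0)"])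
    show "invariant_zero_set X S (\<lambda>q. (q - p) \<bullet> (q - p))"
      by (rule invariant_point[OF X0(2,3)])
    show "invariant_zero_set (model_field k) (H' ` S) (\<lambda>w. (w - 0) \<bullet> (w - 0))"
      by (rule invariant_point[where g = g']) (use model H'S in auto)
    have "{q \<in> S. (q - p) \<bullet> (q - p) = 0} = {p}" using pS by auto
    then show "flows_to X {q \<in> S. (q - p) \<bullet> (q - p) = 0} a b =
          flows_to (model_field k) (H' ` {q \<in> S. (q - p) \<bullet> (q - p) = 0}) (H' a) (H' b)"
      if "a \<in> {q \<in> S. (q - p) \<bullet> (q - p) = 0}" "b \<in> {q \<in> S. (q - p) \<bullet> (q - p) = 0}" for a b
      using that m0 X0(1) H'p by (auto intro!: flows_to_stationary)
    have nz: "{q \<in> S. (q - p) \<bullet> (q - p) \<noteq> 0} = S - {p}" by auto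
    show "flows_to X {q \<in> S. (q - p) \<bullet> (q - p) \<noteq> 0} a b =
          flows_to (model_field k) (H' ` {q \<in> S. (q - p) \<bullet> (q - p) \<noteq> 0}) (H' a) (H' b)"
      if "a \<in> {q \<in> S. (q - p) \<bullet> (q - p) \<noteq> 0}" "b \<in> {q \<in> S. (q - p) \<bullet> (q - p) \<noteq> 0}" for a b
    proof -
      have ab: "a \<in> S - {p}" "b \<in> S - {p}" using that nz by auto
      then have ab': "H' a \<in> quarter_disc - {0}" "H' b \<in> quarter_disc - {0}" using H'S0 by auto
      have "Z a = M (H' a)" "Z b = M (H' b)" using M[OF ab'(1)] M[OF ab'(2)] HS ab by auto
      then show ?thesis
        unfolding nz using X[OF ab] model(1)[OF ab'] ZS H'S0 by simp
    qed
  qed (use ab H'z in auto)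
  have "H' ` B = quarter_edges"
    using HH QD0(2) by (force simp: H(3)[symmetric])
  then show ?thesis
    unfolding is_sector_def
    using homeomorphism_symD[OF H(1)] H'p fl unfolding H'S by blast
qed

text \<open>Squaring is injective on this open half-plane, which contains the quarter disc without its corner.\<close>
lemma open_half_plane: "open {w. 0 < Re w + Im w}"
  by (intro open_Collect_less continuous_intros)

lemma square_inj_half_plane:
  assumes "0 < Re v + Im v" "0 < Re w + Im w" "v\<^sup>2 = (w::complex)\<^sup>2"
  shows "v = w"
  using assms by (auto simp: power2_eq_iff)

lemma quarter_disc_subset: "quarter_disc - {0} \<subseteq> {w. 0 < Re w + Im w}"
  by (auto simp: quarter_disc_def complex_eq_iff add_nonneg_eq_0_iff less_le)

text \<open>If \<open>w' = w\<^sup>3\<close>, then \<open>Z = - 1 / w\<^sup>2\<close> satisfies \<open>Z' = 2 w' / w\<^sup>3 = 2\<close>.\<close>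
lemma elliptic_model_chart:
  assumes "v \<in> quarter_disc - {0}" "w \<in> quarter_disc - {0}"
  defines "M \<equiv> (\<lambda>w::complex. - inverse (w\<^sup>2))"
  shows "flows_to (model_field Elliptic) (quarter_disc - {0}) v w \<longleftrightarrow>
        flows_to (\<lambda>_. 1) (M ` (quarter_disc - {0})) (M v) (M w)"
proof -
  let ?U = "{w. 0 < Re w + Im w}"
  have U0: "w \<noteq> 0" if "w \<in> ?U" for w using that by auto
  have c: "continuous_on ?U M"
    unfolding M_def using U0 by (intro continuous_intros) auto
  have inj: "inj_on M ?U"
    unfolding M_def inj_on_def using square_inj_half_plane by auto
  obtain M' where M': "homeomorphism ?U (M ` ?U) M M'"
    using invariance_of_domain_homeomorphism[OF open_half_plane c _ inj] by auto
  have op: "open (M ` ?U)"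
    by (rule invariance_of_domain[OF c open_half_plane inj])
  have nz: "w \<noteq> 0" if "w \<in> quarter_disc - {0}" for w :: complex using that by auto
  show ?thesis
  proof (rule flows_to_conj[OF open_half_plane op M' quarter_disc_subset,
        where D = "\<lambda>w h. (2 / w ^ 3) * h" and \<mu> = "\<lambda>_. 2"])
    fix q :: complex assume q: "q \<in> quarter_disc - {0}"
    have "(M has_field_derivative 2 / q ^ 3) (at q)"
      unfolding M_def using nz[OF q]
      by (auto intro!: derivative_eq_intros simp: field_simps power_numeral_reduce)
    then show "(M has_derivative (\<lambda>h. (2 / q ^ 3) * h)) (at q)"
      by (simp only: has_field_derivative_def)
  qed (use assms nz in \<open>auto simp: scaleR_conv_of_real\<close>)
qed

text \<open>If \<open>w' = cnj w\<close>, then \<open>z = w\<^sup>2\<close> satisfies \<open>z' = 2 \<bar>w\<bar>\<^sup>2\<close>, a positive multiple of 1.\<close>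
lemma hyperbolic_model_chart:
  assumes "v \<in> quarter_disc - {0}" "w \<in> quarter_disc - {0}"
  defines "M \<equiv> (\<lambda>w::complex. w\<^sup>2)"
  shows "flows_to (model_field Hyperbolic) (quarter_disc - {0}) v w \<longleftrightarrow>
        flows_to (\<lambda>_. 1) (M ` (quarter_disc - {0})) (M v) (M w)"
proof -
  let ?U = "{w. 0 < Re w + Im w}"
  have c: "continuous_on ?U M"
    unfolding M_def by (intro continuous_intros)
  have inj: "inj_on M ?U"
    unfolding M_def inj_on_def using square_inj_half_plane by auto
  obtain M' where M': "homeomorphism ?U (M ` ?U) M M'"
    using invariance_of_domain_homeomorphism[OF open_half_plane c _ inj] by auto
  have op: "open (M ` ?U)"
    by (rule invariance_of_domain[OF c open_half_plane inj])
  show ?thesis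
  proof (rule flows_to_conj[OF open_half_plane op M' quarter_disc_subset,
        where D = "\<lambda>w h. (2 * w) * h" and \<mu> = "\<lambda>w. 2 * (norm w)\<^sup>2"])
    fix q :: complex assume q: "q \<in> quarter_disc - {0}"
    have "(M has_field_derivative 2 * q) (at q)"
      unfolding M_def by (auto intro!: derivative_eq_intros)
    then show "(M has_derivative (\<lambda>h. (2 * q) * h)) (at q)"
      by (simp only: has_field_derivative_def)
    show "2 * q * model_field Hyperbolic q = (2 * (norm q)\<^sup>2) *\<^sub>R 1"
      using complex_norm_square[of q] by (simp add: scaleR_conv_of_real mult_ac)
  qed (use assms in \<open>auto intro!: continuous_intros\<close>)
qed

lemma half_disc_polar:
  assumes "norm z \<le> 1" "0 \<le> Im z"
  obtains r \<theta> where "0 \<le> r" "r \<le> 1" "0 \<le> \<theta>" "\<theta> \<le> pi" "z = of_real r * cis \<theta>"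
proof -
  have "0 \<le> Arg z" using assms(2) Arg_less_0[of z] by linarith
  moreover have "Arg z \<le> pi" by (rule Arg_le_pi)
  moreover have "z = of_real (norm z) * cis (Arg z)"
    by (cases "z = 0") (simp_all add: Arg_eq cis_conv_exp mult_ac)
  ultimately show ?thesis using that[of "norm z" "Arg z"] assms(1) by simp
qed

lemma wedge_upper: "wedge 2 0 = {z. norm z \<le> 1 \<and> 0 \<le> Im z}"
proof (intro equalityI subsetI)
  fix z assume "z \<in> {z. norm z \<le> 1 \<and> 0 \<le> Im z}"
  then obtain r \<theta> where "0 \<le> r" "r \<le> 1" "0 \<le> \<theta>" "\<theta> \<le> pi" "z = of_real r * cis \<theta>"
    using half_disc_polar by auto
  then show "z \<in> wedge 2 0" by (auto simp: wedge_def)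
qed (auto simp: wedge_def norm_mult sin_ge_zero)

lemma wedge_lower: "wedge 2 1 = {z. norm z \<le> 1 \<and> Im z \<le> 0}"
proof (intro equalityI subsetI)
  fix z assume "z \<in> {z. norm z \<le> 1 \<and> Im z \<le> 0}"
  then have "norm (cnj z) \<le> 1" "0 \<le> Im (cnj z)" by auto
  then obtain r \<theta> where r: "0 \<le> r" "r \<le> 1" "0 \<le> \<theta>" "\<theta> \<le> pi" "cnj z = of_real r * cis \<theta>"
    by (rule half_disc_polar)
  have "cnj (cnj z) = of_real r * cis (2 * pi - \<theta>)"
    unfolding r(5) by (simp add: complex_eq_iff cos_diff sin_diff)
  then have "z = of_real r * cis (2 * pi - \<theta>)" by simp
  then show "z \<in> wedge 2 1"
    using r unfolding wedge_def by (intro CollectI) (rule exI[of _ r], rule exI[of _ "2 * pi - \<theta>"], auto)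
next
  fix z assume "z \<in> wedge 2 1"
  then obtain r \<theta> where r: "z = of_real r * cis \<theta>" "0 \<le> r" "r \<le> 1" "pi \<le> \<theta>" "\<theta> \<le> 2 * pi"
    by (auto simp: wedge_def)
  have "sin \<theta> \<le> 0" using sin_ge_zero[of "\<theta> - pi"] r by (simp add: sin_diff)
  then show "z \<in> {z. norm z \<le> 1 \<and> Im z \<le> 0}" using r by (simp add: norm_mult mult_nonneg_nonpos)
qed

lemma wedge_rays_2: "i < 2 \<Longrightarrow> wedge_rays 2 i = {z. norm z \<le> 1 \<and> Im z = 0}"
proof -
  assume i: "i < 2"
  have sub: "wedge_rays 2 i \<subseteq> {z. norm z \<le> 1 \<and> Im z = 0}"
    using i by (auto simp: wedge_rays_def norm_mult less_2_cases_iff)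
  have "z \<in> wedge_rays 2 i" if z: "norm z \<le> 1" "Im z = 0" for z
  proof -
    have z': "z = of_real (Re z)" "\<bar>Re z\<bar> \<le> 1" using z abs_Re_le_cmod[of z] by (auto simp: complex_eq_iff)
    consider "0 \<le> Re z" | "Re z \<le> 0" by linarith
    then show ?thesis
    proof cases
      case 1
      have "z = of_real (Re z) * cis (2 * pi * real (2 * i) / real 2)"
        using z'(1) i by (auto simp: less_2_cases_iff)
      then show ?thesis
        using 1 z' i unfolding wedge_rays_def
        by (intro CollectI exI[of _ "Re z"] exI[of _ "2 * i"]) (auto simp: less_2_cases_iff)
    next
      case 2
      have "z = of_real (- Re z) * cis (2 * pi * real 1 / real 2)"
        using z'(1) by simp
      then show ?thesis
        using 2 z' i unfolding wedge_rays_def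
        by (intro CollectI exI[of _ "- Re z"] exI[of _ "1::nat"]) (auto simp: less_2_cases_iff)
    qed
  qed
  then show ?thesis using sub by auto
qed

lemma compact_quarter_disc: "compact quarter_disc"
proof -
  have e: "quarter_disc = cball 0 1 \<inter> ({w. 0 \<le> Re w} \<inter> {w. 0 \<le> Im w})"
    by (auto simp: quarter_disc_def)
  have "closed ({w. 0 \<le> Re w} \<inter> {w. 0 \<le> Im w})"
    by (intro closed_Int closed_Collect_le continuous_intros)
  then show ?thesis unfolding e by (rule compact_Int_closed[OF compact_cball])
qed

lemma square_quarter_disc:
  "(\<lambda>w. w\<^sup>2) ` quarter_disc = {z. norm z \<le> 1 \<and> 0 \<le> Im z}"
  "(\<lambda>w. w\<^sup>2) ` quarter_edges = {z. norm z \<le> 1 \<and> Im z = 0}"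
  "inj_on (\<lambda>w. w\<^sup>2) quarter_disc"
proof -
  have sq: "norm (w\<^sup>2) \<le> 1 \<and> 0 \<le> Im (w\<^sup>2)" if "w \<in> quarter_disc" for w
    using that by (auto simp: quarter_disc_def norm_power power_le_one Im_power2)
  have im0: "Im (w\<^sup>2) = 0 \<longleftrightarrow> Re w = 0 \<or> Im w = 0" for w by (auto simp: Im_power2)
  have root: "csqrt z \<in> quarter_disc" if "norm z \<le> 1" "0 \<le> Im z" for z
  proof -
    have p: "0 < Re (csqrt z) \<or> Re (csqrt z) = 0 \<and> 0 \<le> Im (csqrt z)" by (rule csqrt_principal)
    have "Im ((csqrt z)\<^sup>2) = 2 * Re (csqrt z) * Im (csqrt z)" by (simp only: Im_power2)
    then have "0 \<le> Re (csqrt z) * Im (csqrt z)" using that by simp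
    then have "0 \<le> Im (csqrt z)" using p by (auto simp: zero_le_mult_iff)
    moreover have "norm (csqrt z) \<le> 1"
    proof -
      have "(norm (csqrt z))\<^sup>2 = norm z" by (simp flip: norm_power)
      then show ?thesis using that(1) abs_square_le_1[of "norm (csqrt z)"] by simp
    qed
    ultimately show ?thesis using p by (auto simp: quarter_disc_def)
  qed
  show 1: "(\<lambda>w. w\<^sup>2) ` quarter_disc = {z. norm z \<le> 1 \<and> 0 \<le> Im z}"
  proof (intro equalityI subsetI)
    fix z assume "z \<in> {z. norm z \<le> 1 \<and> 0 \<le> Im z}"
    then have "csqrt z \<in> quarter_disc" using root by auto
    then show "z \<in> (\<lambda>w. w\<^sup>2) ` quarter_disc" by (intro image_eqI[of _ _ "csqrt z"]) simp_all
  qed (use sq in auto)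
  show "(\<lambda>w. w\<^sup>2) ` quarter_edges = {z. norm z \<le> 1 \<and> Im z = 0}"
  proof (intro equalityI subsetI)
    fix z assume z: "z \<in> {z. norm z \<le> 1 \<and> Im z = 0}"
    then have "csqrt z \<in> quarter_disc" using root by auto
    moreover have "Im ((csqrt z)\<^sup>2) = 0" using z by (simp only: power2_csqrt mem_Collect_eq)
    ultimately have "csqrt z \<in> quarter_edges" unfolding im0 quarter_edges_def by simp
    then show "z \<in> (\<lambda>w. w\<^sup>2) ` quarter_edges" by (intro image_eqI[of _ _ "csqrt z"]) simp_all
  next
    fix z assume "z \<in> (\<lambda>w. w\<^sup>2) ` quarter_edges"
    then obtain w where w: "z = w\<^sup>2" "w \<in> quarter_disc" "Re w = 0 \<or> Im w = 0"
      by (auto simp: quarter_edges_def)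
    then show "z \<in> {z. norm z \<le> 1 \<and> Im z = 0}" using sq[OF w(2)] im0[of w] by blast
  qed
  show "inj_on (\<lambda>w. w\<^sup>2) quarter_disc"
  proof (rule inj_onI)
    fix v w assume vw: "v \<in> quarter_disc" "w \<in> quarter_disc" "v\<^sup>2 = w\<^sup>2"
    show "v = w"
    proof (cases "v = 0 \<or> w = 0")
      case True
      then show ?thesis using vw(3) by auto
    next
      case False
      then have "v \<in> {w. 0 < Re w + Im w}" "w \<in> {w. 0 < Re w + Im w}"
        using quarter_disc_subset vw(1,2) by blast+
      then show ?thesis using square_inj_half_plane[OF _ _ vw(3)] by simp
    qed
  qed
qed

section \<open>The integrable quasi-homogeneous fields\<close>

definition qh_field :: "real \<Rightarrow> real \<Rightarrow> real \<times> real \<Rightarrow> real \<times> real" where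
  "qh_field a k = (\<lambda>(x, y). (- a * x\<^sup>2 + k * y, - x * y))"

text \<open>The antiderivative of \<open>2 (a + 1) y\<^sup>-\<^sup>2\<^sup>a\<close>; at \<open>a = 1/2\<close> the factor \<open>2 (a + 1)\<close> is 3.\<close>
definition drift :: "real \<Rightarrow> real \<Rightarrow> real" where
  "drift a y = (if a = 1 / 2 then 3 * ln y else - (2 * (a + 1) / (2 * a - 1)) * y powr (1 - 2 * a))"

lemma drift_deriv:
  assumes "0 < y"
  shows "(drift a has_real_derivative 2 * (a + 1) * y powr (- 2 * a)) (at y)"
proof (cases "a = 1 / 2")
  case True
  have "((\<lambda>y. 3 * ln y) has_real_derivative 2 * (a + 1) * y powr (- 2 * a)) (at y)"
    using assms unfolding True by (auto intro!: derivative_eq_intros simp: powr_minus field_simps)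
  then show ?thesis unfolding True by (simp add: drift_def[abs_def])
next
  case False
  have "((\<lambda>y. - (2 * (a + 1) / (2 * a - 1)) * y powr (1 - 2 * a)) has_real_derivative
      - (2 * (a + 1) / (2 * a - 1)) * ((1 - 2 * a) * y powr (1 - 2 * a - 1))) (at y)"
    using assms by (intro DERIV_cmult has_real_derivative_powr)
  moreover have "- (2 * (a + 1) / (2 * a - 1)) * ((1 - 2 * a) * y powr (1 - 2 * a - 1))
      = 2 * (a + 1) * y powr (- 2 * a)"
    using False by (simp add: field_simps)
  ultimately show ?thesis using False by (simp add: drift_def[abs_def])
qed

lemma drift_strict_mono:
  assumes "-1 < a" "0 < y" "y < z"
  shows "drift a y < drift a z"
proof (rule DERIV_pos_imp_increasing[OF assms(3)])
  fix u assume "y \<le> u" "u \<le> z"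
  then show "\<exists>d. (drift a has_real_derivative d) (at u) \<and> 0 < d"
    using drift_deriv[of u a] assms by (intro exI[of _ "2 * (a + 1) * u powr (- 2 * a)"]) auto
qed

lemma continuous_on_drift: "continuous_on {0<..} (drift a)"
  using drift_deriv by (intro DERIV_continuous_on) (auto intro: has_field_derivative_at_within)

lemma powr_at_right_0_at_top: "c < 0 \<Longrightarrow> filterlim (\<lambda>y::real. y powr c) at_top (at_right 0)"
  by real_asymp

lemma powr_at_right_0_0: "0 < c \<Longrightarrow> ((\<lambda>y::real. y powr c) \<longlongrightarrow> 0) (at_right 0)"
  by real_asymp

text \<open>In the range \<open>a \<ge> 1/2\<close> the antiderivative tends to \<open>-\<infinity>\<close> at 0, which makes
  the chart below continuous along the axis \<open>y = 0\<close>.\<close>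
locale quasi_homogeneous_model =
  fixes a :: real
  assumes a: "1 / 2 \<le> a"

context quasi_homogeneous_model begin

lemma drift_at_bot: "filterlim (drift a) at_bot (at_right 0)"
proof (cases "a = 1 / 2")
  case True
  have "filterlim (\<lambda>y::real. 3 * ln y) at_bot (at_right 0)" by real_asymp
  then show ?thesis using True by (simp add: drift_def[abs_def])
next
  case False
  then have "filterlim (\<lambda>y. (2 * (a + 1) / (2 * a - 1)) * y powr (1 - 2 * a)) at_top (at_right 0)"
    using a by (intro filterlim_tendsto_pos_mult_at_top[OF tendsto_const] powr_at_right_0_at_top) auto
  then show ?thesis
    using False by (simp add: drift_def[abs_def] filterlim_uminus_at_top)
qed

text \<open>For \<open>a > 1/2\<close> the antiderivative is negative and tends to 0 at infinity, so it exceeds exactly the negative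
  bounds.\<close>
lemma drift_above:
  assumes "c < 0"
  obtains Y where "0 < Y" "c < drift a Y"
proof (cases "a = 1 / 2")
  case True
  then show ?thesis using that[of 1] assms by (simp add: drift_def)
next
  case False
  define e where "e = 2 * (a + 1) / (2 * a - 1)"
  have e: "0 < e" using False a by (simp add: e_def)
  have "((\<lambda>y. y powr (1 - 2 * a)) \<longlongrightarrow> 0) at_top"
    using False a by (intro tendsto_neg_powr filterlim_ident) auto
  then have "\<forall>\<^sub>F y in at_top. y powr (1 - 2 * a) < - c / e"
    using assms e by (intro order_tendstoD(2)[where y = 0]) (auto simp: field_simps)
  then have "\<forall>\<^sub>F y in at_top. 0 < y \<and> y powr (1 - 2 * a) < - c / e"
    using eventually_gt_at_top[of 0] by (rule eventually_conj[rotated])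
  then obtain y where y: "0 < y" "y powr (1 - 2 * a) < - c / e"
    using eventually_happens'[OF trivial_limit_at_top_linorder] by blast
  then have "e * y powr (1 - 2 * a) < - c" using e y(2) by (simp only: pos_less_divide_eq mult.commute)
  moreover have "drift a y = - (e * y powr (1 - 2 * a))" using False by (simp add: drift_def e_def)
  ultimately have "c < drift a y" by simp
  then show ?thesis using that y(1) by blast
qed

lemma powr_drift_tendsto_0: "((\<lambda>y. y powr (2 * a) * drift a y) \<longlongrightarrow> 0) (at_right 0)"
proof (cases "a = 1 / 2")
  case True
  have "((\<lambda>y::real. y powr 1 * (3 * ln y)) \<longlongrightarrow> 0) (at_right 0)" by real_asymp
  then show ?thesis unfolding True by (simp add: drift_def[abs_def])
next
  case False
  have "((\<lambda>y. - (2 * (a + 1) / (2 * a - 1)) * y) \<longlongrightarrow> - (2 * (a + 1) / (2 * a - 1)) * 0) (at_right 0)"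
    by (intro tendsto_intros)
  moreover have "\<forall>\<^sub>F y in at_right 0. - (2 * (a + 1) / (2 * a - 1)) * y = y powr (2 * a) * drift a y"
    using eventually_at_right_less[of "0::real"]
    by eventually_elim (use False in \<open>simp add: drift_def mult.left_commute powr_add[symmetric]\<close>)
  ultimately show ?thesis by (simp add: filterlim_cong)
qed

lemma powr_drift_bound: "\<forall>\<^sub>F y in at_right 0. y powr (2 * a - 1) * drift a y \<le> - 1"
proof (cases "a = 1 / 2")
  case True
  have "\<forall>\<^sub>F y in at_right (0::real). 3 * ln y \<le> - 1" by real_asymp
  then show ?thesis
    using eventually_at_right_less[of "0::real"]
    unfolding True by eventually_elim (simp add: drift_def)
next
  case False
  show ?thesis
    using eventually_at_right_less[of "0::real"]
  proof eventually_elim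
    case (elim y)
    have "y powr (2 * a - 1) * drift a y = - (2 * (a + 1) / (2 * a - 1))"
      using elim False by (simp add: drift_def mult.left_commute powr_add[symmetric])
    also have "\<dots> \<le> - 1" using False a by (simp add: field_simps)
    finally show ?case .
  qed
qed

text \<open>The value of \<open>x\<^sup>2\<close> at height \<open>y\<close> on the level \<open>K\<close> of the first integral, where this is nonnegative.\<close>
definition level_sq :: "real \<Rightarrow> real \<Rightarrow> real" where
  "level_sq K y = y powr (2 * a) * (K - drift a y)"

lemma level_sq_deriv:
  assumes "0 < y"
  shows "(level_sq K has_real_derivative 2 * a * level_sq K y / y - 2 * (a + 1)) (at y)"
proof -
  have "(level_sq K has_real_derivative
      2 * a * y powr (2 * a - 1) * (K - drift a y) +
      (0 - 2 * (a + 1) * y powr (- 2 * a)) * y powr (2 * a)) (at y)"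
    unfolding level_sq_def[abs_def]
    by (intro DERIV_mult DERIV_diff DERIV_const drift_deriv has_real_derivative_powr assms)
  moreover have "y powr (- 2 * a) * y powr (2 * a) = 1" "y powr (2 * a - 1) = y powr (2 * a) / y"
    using assms by (simp_all add: powr_add[symmetric] powr_diff)
  then have "2 * a * y powr (2 * a - 1) * (K - drift a y) +
      (0 - 2 * (a + 1) * y powr (- 2 * a)) * y powr (2 * a) = 2 * a * level_sq K y / y - 2 * (a + 1)"
    unfolding level_sq_def by (simp add: algebra_simps)
  ultimately show ?thesis by simp
qed

text \<open>On a level of the first integral, the quotient is the square of \<open>\<tau> = x / (x\<^sup>2 + y)\<close>.
  Its derivative has the sign of \<open>- (a (x\<^sup>2 - y)\<^sup>2 + y\<^sup>2)\<close>.\<close>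
lemma level_decreasing:
  assumes "0 < y" "y < z" "drift a z \<le> K"
  shows "level_sq K z / (level_sq K z + z)\<^sup>2 < level_sq K y / (level_sq K y + y)\<^sup>2"
proof (rule DERIV_neg_imp_decreasing[OF assms(2)])
  fix u assume u: "y \<le> u" "u \<le> z"
  let ?s = "level_sq K u"
  have up: "0 < u" using u assms by simp
  have "drift a u \<le> K"
    using drift_strict_mono[of a u z] a up u assms by (cases "u = z") auto
  then have s: "0 \<le> ?s" by (simp add: level_sq_def)
  have pos: "0 < ?s + u" using s up by simp
  let ?d = "2 * a * ?s / u - 2 * (a + 1)"
  let ?D = "(?d * (?s + u)\<^sup>2 - ?s * (2 * (?s + u) * (?d + 1))) / ((?s + u)\<^sup>2 * (?s + u)\<^sup>2)"
  have "((\<lambda>u. (level_sq K u + u)\<^sup>2) has_real_derivative 2 * (?s + u) * (?d + 1)) (at u)"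
    by (rule DERIV_cong, rule DERIV_power, rule DERIV_add, rule level_sq_deriv[OF up], rule DERIV_ident)
      simp
  then have "((\<lambda>u. level_sq K u / (level_sq K u + u)\<^sup>2) has_real_derivative ?D) (at u)"
    using pos by (intro DERIV_divide level_sq_deriv up) auto
  moreover have "?D = - (2 / u) * (a * (?s - u)\<^sup>2 + u\<^sup>2) * (?s + u) / ((?s + u)\<^sup>2 * (?s + u)\<^sup>2)"
  proof -
    have "?d * (?s + u)\<^sup>2 - ?s * (2 * (?s + u) * (?d + 1)) =
        - (2 / u) * (a * (?s - u)\<^sup>2 + u\<^sup>2) * (?s + u)"
      using up by (simp add: field_simps power2_eq_square)
    then show ?thesis by (rule arg_cong)
  qed
  moreover have "\<dots> < 0"
    using up pos a s by (intro divide_neg_pos mult_neg_pos mult_pos_pos add_nonneg_pos) auto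
  ultimately show "\<exists>d. ((\<lambda>u. level_sq K u / (level_sq K u + u)\<^sup>2) has_real_derivative d) (at u) \<and> d < 0"
    by (intro exI[of _ ?D] conjI) simp_all
qed

text \<open>Constant along \<open>x' = - a x\<^sup>2 + (a + 1) y\<close>, \<open>y' = - x y\<close> for \<open>y > 0\<close>: \<open>x\<^sup>2 y\<^sup>-\<^sup>2\<^sup>a\<close> and \<open>drift a y\<close> change at the
  opposite rates \<open>\<plusminus> 2 (a + 1) x y\<^bsup>1 - 2a\<^esup>\<close>.\<close>
definition first_integral :: "real \<times> real \<Rightarrow> real" where
  "first_integral = (\<lambda>(x, y). x\<^sup>2 * y powr (- 2 * a) + drift a y)"

lemma level_sq_first_integral:
  assumes "0 < y"
  shows "level_sq (first_integral (x, y)) y = x\<^sup>2" "drift a y \<le> first_integral (x, y)"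
  using assms by (auto simp: level_sq_def first_integral_def mult.left_commute powr_add[symmetric])

lemma first_integral_level_sq:
  assumes "0 < y" "x\<^sup>2 = level_sq K y"
  shows "first_integral (x, y) = K"
proof -
  have "x\<^sup>2 * y powr (- 2 * a) = (y powr (2 * a) * y powr (- 2 * a)) * (K - drift a y)"
    unfolding assms(2) level_sq_def by (simp only: mult_ac)
  then show ?thesis using assms(1) by (simp add: first_integral_def powr_add[symmetric])
qed

lemma upper_inj:
  assumes y: "0 < y" "0 < y'" and
    \<tau>: "x / (x\<^sup>2 + y) = x' / (x'\<^sup>2 + y')" and K: "first_integral (x, y) = first_integral (x', y')"
  shows "(x, y) = (x', y')"
proof -
  let ?K = "first_integral (x, y)"
  have s: "level_sq ?K y = x\<^sup>2" "level_sq ?K y' = x'\<^sup>2" "drift a y \<le> ?K" "drift a y' \<le> ?K"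
    using level_sq_first_integral y K by metis+
  have "(x / (x\<^sup>2 + y))\<^sup>2 = (x' / (x'\<^sup>2 + y'))\<^sup>2" using \<tau> by simp
  then have "level_sq ?K y / (level_sq ?K y + y)\<^sup>2 = level_sq ?K y' / (level_sq ?K y' + y')\<^sup>2"
    unfolding s by (simp add: power_divide)
  then have yy: "y = y'"
    using level_decreasing[OF y(1) _ s(4)] level_decreasing[OF y(2) _ s(3)]
    by (metis less_irrefl linorder_neqE_linordered_idom)
  then have "x\<^sup>2 = x'\<^sup>2" using s by simp
  then have "x = x'" using \<tau> yy y add_nonneg_pos[OF zero_le_power2 y(1), of x] by simp
  then show ?thesis using yy by simp
qed

text \<open>Put \<open>K = - ln (2 J)\<close> and look for a height at which the square of \<open>x / (x\<^sup>2 + y)\<close> on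
  the level \<open>K\<close> equals \<open>\<tau>\<^sup>2\<close>.  Near height 0 this square is larger than \<open>\<tau>\<^sup>2\<close>.  If the level reaches
  the axis \<open>x = 0\<close>, the square is 0 there.  Otherwise \<open>K \<ge> 0\<close>, whence \<open>J \<le> 1/2\<close> and \<open>\<tau> \<noteq> 0\<close>, and the
  square is at most \<open>1 / (4 y)\<close>, hence at most \<open>\<tau>\<^sup>2\<close> at height \<open>1 / (4 \<tau>\<^sup>2)\<close>.  The intermediate value
  theorem gives the height, and the sign of \<open>x\<close> is that of \<open>\<tau>\<close>.\<close>
lemma upper_surj:
  assumes "0 < J" "1 \<le> \<tau>\<^sup>2 + J\<^sup>2"
  obtains x y where "0 < y" "x / (x\<^sup>2 + y) = \<tau>" "exp (- first_integral (x, y)) / 2 = J"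
proof -
  define K where "K = - ln (2 * J)"
  let ?t = "\<lambda>u. level_sq K u / (level_sq K u + u)\<^sup>2"
  have "\<forall>\<^sub>F u in at_right 0. level_sq K u + 4 * u < 1 / (\<tau>\<^sup>2 + 1)"
  proof -
    have "((\<lambda>u. u powr (2 * a) * K - u powr (2 * a) * drift a u + 4 * u) \<longlongrightarrow> 0 * K - 0 + 4 * 0) (at_right 0)"
      using a by (intro tendsto_intros powr_drift_tendsto_0 powr_at_right_0_0) auto
    then have "((\<lambda>u. level_sq K u + 4 * u) \<longlongrightarrow> 0) (at_right 0)"
      by (simp add: level_sq_def right_diff_distrib)
    moreover have "0 < 1 / (\<tau>\<^sup>2 + 1)" by (simp add: add_nonneg_pos)
    ultimately show ?thesis by (rule order_tendstoD)
  qed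
  moreover have "\<forall>\<^sub>F u in at_right 0. drift a u < min (2 * K) K"
    using drift_at_bot unfolding filterlim_at_bot_dense by blast
  ultimately have small: "\<forall>\<^sub>F u in at_right 0. \<tau>\<^sup>2 < ?t u \<and> drift a u < K"
    using powr_drift_bound eventually_at_right_less[of "0::real"]
  proof eventually_elim
    case (elim u)
    let ?s = "level_sq K u"
    have "1 / 2 \<le> u powr (2 * a - 1) * (K - drift a u)"
    proof -
      have "u powr (2 * a - 1) * (- drift a u) \<le> u powr (2 * a - 1) * (2 * (K - drift a u))"
        using elim(2) by (intro mult_left_mono) auto
      then show ?thesis using elim(3) by (simp add: algebra_simps)
    qed
    then have "u * (1 / 2) \<le> u * (u powr (2 * a - 1) * (K - drift a u))"
      using elim(4) by (intro mult_left_mono) auto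
    also have "\<dots> = ?s" using elim(4) by (simp add: level_sq_def powr_diff)
    finally have s: "u \<le> 2 * ?s" by simp
    then have sp: "0 < ?s" using elim(4) by simp
    have "u * u \<le> u * (2 * ?s)" using s elim(4) by (intro mult_left_mono) auto
    then have "(?s + u)\<^sup>2 \<le> ?s * (?s + 4 * u)" by (simp add: power2_eq_square algebra_simps)
    also have "\<dots> < ?s * (1 / (\<tau>\<^sup>2 + 1))" using elim(1) sp by (intro mult_strict_left_mono)
    finally have "(\<tau>\<^sup>2 + 1) * (?s + u)\<^sup>2 < ?s"
      by (simp add: pos_less_divide_eq add_nonneg_pos mult.commute)
    moreover have "\<tau>\<^sup>2 * (?s + u)\<^sup>2 \<le> (\<tau>\<^sup>2 + 1) * (?s + u)\<^sup>2" by (intro mult_right_mono) auto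
    ultimately have "\<tau>\<^sup>2 * (?s + u)\<^sup>2 < ?s" by linarith
    then have "\<tau>\<^sup>2 < ?t u" using sp elim(4) by (simp add: pos_less_divide_eq)
    then show ?case using elim(2) by simp
  qed
  \<comment> \<open>a height at which the square is small enough: the end of the level, or \<open>1 / (4 \<tau>\<^sup>2)\<close>\<close>
  have "\<exists>u2>0. drift a u2 \<le> K \<and> ?t u2 \<le> \<tau>\<^sup>2"
  proof (cases "\<exists>u>0. drift a u = K")
    case True
    then obtain u where "0 < u" "drift a u = K" by blast
    then show ?thesis by (intro exI[of _ u]) (auto simp: level_sq_def)
  next
    case False
    have below: "drift a u < K" if "0 < u" for u
    proof (rule ccontr)
      assume "\<not> drift a u < K"
      then have u: "K \<le> drift a u" by simp
      have "\<forall>\<^sub>F v in at_right 0. drift a v < K \<and> 0 < v \<and> v < u"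
        using small eventually_at_right_less[of "0::real"] eventually_at_right_real[OF that]
        by eventually_elim auto
      then obtain v where v: "drift a v < K" "0 < v" "v < u"
        using eventually_happens'[OF trivial_limit_at_right_real] by blast
      have "\<exists>x\<ge>v. x \<le> u \<and> drift a x = K"
      proof (rule IVT')
        show "continuous_on {v..u} (drift a)"
          by (rule continuous_on_subset[OF continuous_on_drift]) (use v in auto)
      qed (use v u in auto)
      then obtain w where w: "v \<le> w" "drift a w = K" by blast
      then have "0 < w" using v(2) by linarith
      then show False using False w(2) by simp
    qed
    have "0 \<le> K"
    proof (rule ccontr)
      assume "\<not> 0 \<le> K"
      then obtain Y where "0 < Y" "K < drift a Y" using drift_above[of K] by auto
      then show False using below[of Y] by simp
    qed
    then have "2 * J \<le> 1"
      using assms(1) ln_le_zero_iff[of "2 * J"] by (simp add: K_def)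
    then have "J\<^sup>2 < 1" using assms(1) abs_square_less_1[of J] by simp
    then have \<tau>: "0 < \<tau>\<^sup>2" using assms(2) by linarith
    define u where "u = 1 / (4 * \<tau>\<^sup>2)"
    have u: "0 < u" "\<tau>\<^sup>2 * (4 * u) = 1" using \<tau> by (auto simp: u_def)
    define L where "L = level_sq K u"
    have s: "0 \<le> L" using below[OF u(1)] by (simp add: level_sq_def L_def)
    have "4 * u * L \<le> (L + u)\<^sup>2"
      using zero_le_power2[of "L - u"] by (simp add: power2_eq_square algebra_simps)
    then have "\<tau>\<^sup>2 * (4 * u * L) \<le> \<tau>\<^sup>2 * (L + u)\<^sup>2" by (rule mult_left_mono) simp
    then have "L \<le> \<tau>\<^sup>2 * (L + u)\<^sup>2" using u(2) by (metis mult.assoc mult_1)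
    moreover have "0 < (L + u)\<^sup>2" using s u by (intro zero_less_power) simp
    ultimately have "?t u \<le> \<tau>\<^sup>2" unfolding L_def by (simp only: pos_divide_le_eq)
    then show ?thesis using below[OF u(1)] u(1) by (intro exI[of _ u]) auto
  qed
  then obtain u2 where u2: "0 < u2" "drift a u2 \<le> K" "?t u2 \<le> \<tau>\<^sup>2" by blast
  have "\<forall>\<^sub>F v in at_right 0. \<tau>\<^sup>2 < ?t v \<and> 0 < v \<and> v < u2"
    using small eventually_at_right_less[of "0::real"] eventually_at_right_real[OF u2(1)]
    by eventually_elim auto
  then obtain u1 where u1: "\<tau>\<^sup>2 < ?t u1" "0 < u1" "u1 < u2"
    using eventually_happens'[OF trivial_limit_at_right_real] by blast
  have sge: "drift a u \<le> K" "0 \<le> level_sq K u" "0 < level_sq K u + u" if "u1 \<le> u" "u \<le> u2" for u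
  proof -
    show "drift a u \<le> K"
      using drift_strict_mono[of a u u2] a u1 u2 that by (cases "u = u2") auto
    then show "0 \<le> level_sq K u" by (simp add: level_sq_def)
    then show "0 < level_sq K u + u" using u1 that by simp
  qed
  have "\<exists>u\<ge>u1. u \<le> u2 \<and> ?t u = \<tau>\<^sup>2"
  proof (rule IVT2')
    have "continuous_on {u1..u2} (level_sq K)"
      by (rule DERIV_continuous_on, rule has_field_derivative_at_within[OF level_sq_deriv]) (use u1 in auto)
    then show "continuous_on {u1..u2} ?t"
      using sge(3) by (intro continuous_intros) force+
  qed (use u1 u2 in auto)
  then obtain u where u: "u1 \<le> u" "u \<le> u2" "?t u = \<tau>\<^sup>2" by blast
  have up: "0 < u" using u u1 by simp
  define x where "x = \<tau> * (level_sq K u + u)"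
  have x2: "x\<^sup>2 = level_sq K u"
  proof -
    have "x\<^sup>2 = ?t u * (level_sq K u + u)\<^sup>2" unfolding u(3) x_def by (rule power_mult_distrib)
    then show ?thesis using sge(3)[OF u(1,2)] by simp
  qed
  have "first_integral (x, u) = K" by (rule first_integral_level_sq[OF up x2])
  then have "exp (- first_integral (x, u)) / 2 = J" using assms(1) by (simp add: K_def)
  moreover have "x / (x\<^sup>2 + u) = \<tau>" unfolding x2 using sge(3)[OF u(1,2)] by (simp add: x_def)
  ultimately show ?thesis using that up by blast
qed

end

section \<open>A chart of the plane that rectifies the model\<close>

context quasi_homogeneous_model begin

text \<open>The first integral for \<open>y < 0\<close>, in terms of \<open>w = - y\<close>, is \<open>x\<^sup>2 w\<^sup>-\<^sup>2\<^sup>a - drift a w\<close>; this is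
  \<open>2 exp\<close> of its negative, which tends to 0 at the axis and exceeds every value below 2 far away.\<close>
definition lower_level :: "real \<times> real \<Rightarrow> real" where
  "lower_level = (\<lambda>(x, w). 2 * exp (drift a w - x\<^sup>2 * w powr (- 2 * a)))"

text \<open>The first component is strictly monotone along orbits and the second is constant on them.\<close>
definition upper_coord :: "real \<times> real \<Rightarrow> complex" where
  "upper_coord = (\<lambda>(x, y). Complex (x / (x\<^sup>2 + y)) (exp (- first_integral (x, y)) / 2))"

text \<open>Near a point \<open>(x, 0)\<close> with \<open>x \<noteq> 0\<close>, \<open>upper_coord\<close> tends to \<open>1 / x\<close>; near the origin it
  tends to infinity.  In both cases \<open>- 1 / upper_coord\<close> tends to \<open>- x\<close>, in agreement with
  the values on the axis and with the limits from below.\<close>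
definition portrait_chart :: "real \<times> real \<Rightarrow> complex" where
  "portrait_chart = (\<lambda>(x, y).
     if 0 < y then - inverse (upper_coord (x, y))
     else if y = 0 then - of_real x
     else Complex (- x) (- lower_level (x, - y)))"

lemma portrait_chart_simps:
  "0 < y \<Longrightarrow> portrait_chart (x, y) = - inverse (upper_coord (x, y))"
  "portrait_chart (x, 0) = - of_real x"
  "y < 0 \<Longrightarrow> portrait_chart (x, y) = Complex (- x) (- lower_level (x, - y))"
  by (auto simp: portrait_chart_def)

lemma portrait_chart_cases:
  "0 < snd q \<Longrightarrow> portrait_chart q = - inverse (upper_coord q)"
  "snd q = 0 \<Longrightarrow> portrait_chart q = - of_real (fst q)"
  "snd q < 0 \<Longrightarrow> portrait_chart q = Complex (- fst q) (- lower_level (fst q, - snd q))"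
  by (cases q; simp add: portrait_chart_simps)+

lemma Im_portrait_chart: "0 < Im (portrait_chart (x, y)) \<longleftrightarrow> 0 < y" "Im (portrait_chart (x, y)) < 0 \<longleftrightarrow> y < 0"
proof -
  have "0 < Im (portrait_chart (x, y))" if "0 < y"
  proof -
    have "upper_coord (x, y) \<noteq> 0" by (simp add: upper_coord_def complex_eq_iff)
    then have "0 < (Re (upper_coord (x, y)))\<^sup>2 + (Im (upper_coord (x, y)))\<^sup>2"
      by (simp add: complex_neq_0)
    then show ?thesis using that
      by (simp add: portrait_chart_simps upper_coord_def)
  qed
  moreover have "Im (portrait_chart (x, y)) < 0" if "y < 0"
    using that by (simp add: portrait_chart_simps lower_level_def)
  moreover have "Im (portrait_chart (x, y)) = 0" if "y = 0"
    using that by (simp add: portrait_chart_simps)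
  ultimately show "0 < Im (portrait_chart (x, y)) \<longleftrightarrow> 0 < y" "Im (portrait_chart (x, y)) < 0 \<longleftrightarrow> y < 0"
    by (metis linorder_neqE_linordered_idom less_asym less_irrefl)+
qed

lemma lower_level_strict_mono:
  assumes "0 < w" "w < w'"
  shows "lower_level (x, w) < lower_level (x, w')"
proof -
  have "x\<^sup>2 * w' powr (- 2 * a) \<le> x\<^sup>2 * w powr (- 2 * a)"
    using assms a by (intro mult_left_mono powr_mono2') auto
  then show ?thesis
    using drift_strict_mono[of a w w'] a assms by (simp add: lower_level_def)
qed

text \<open>The three pieces have images with positive, zero and negative imaginary part.\<close>
lemma inj_portrait_chart: "inj portrait_chart"
proof (rule injI, clarify)
  fix x y x' y' assume eq: "portrait_chart (x, y) = portrait_chart (x', y')"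
  consider "0 < y" "0 < y'" | "y = 0" "y' = 0" | "y < 0" "y' < 0"
    using Im_portrait_chart[of x y] Im_portrait_chart[of x' y'] eq
    by (metis linorder_neqE_linordered_idom)
  then show "x = x' \<and> y = y'"
  proof cases
    case 1
    then have "upper_coord (x, y) = upper_coord (x', y')"
      using eq by (simp add: portrait_chart_simps)
    then have "x / (x\<^sup>2 + y) = x' / (x'\<^sup>2 + y')" "first_integral (x, y) = first_integral (x', y')"
      by (simp_all add: upper_coord_def)
    then have "(x, y) = (x', y')" by (rule upper_inj[OF 1])
    then show ?thesis by simp
  next
    case 2
    then have "- of_real x = (- of_real x' :: complex)"
      using eq portrait_chart_simps(2)[of x] portrait_chart_simps(2)[of x'] by simp
    then show ?thesis using 2 by simp
  next
    case 3
    then have "Complex (- x) (- lower_level (x, - y)) = Complex (- x') (- lower_level (x', - y'))"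
      using eq by (simp only: portrait_chart_simps(3)[OF 3(1)] portrait_chart_simps(3)[OF 3(2)])
    then have xx: "x = x'" and l: "lower_level (x, - y) = lower_level (x, - y')" by auto
    have "\<not> y < y'" "\<not> y' < y"
      using lower_level_strict_mono[of "- y" "- y'" x] lower_level_strict_mono[of "- y'" "- y" x] 3 l
      by auto
    then show ?thesis using xx by simp
  qed
qed

text \<open>The exponent \<open>drift a w - x\<^sup>2 w\<^sup>-\<^sup>2\<^sup>a\<close> tends to \<open>-\<infinity>\<close> at 0 and eventually
  exceeds every negative number.\<close>
lemma lower_surj:
  assumes "0 < J" "J \<le> 1"
  obtains w where "0 < w" "lower_level (x, w) = J"
proof -
  let ?E = "\<lambda>w. drift a w - x\<^sup>2 * w powr (- 2 * a)"
  have J2: "ln (J / 2) < 0" using assms by simp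
  have "((\<lambda>w. x\<^sup>2 * w powr (- 2 * a)) \<longlongrightarrow> x\<^sup>2 * 0) at_top"
    using a by (intro tendsto_intros tendsto_neg_powr filterlim_ident) auto
  then have "\<forall>\<^sub>F w in at_top. x\<^sup>2 * w powr (- 2 * a) < - ln (J / 2) / 2"
    using J2 by (intro order_tendstoD(2)[where y = "x\<^sup>2 * 0"]) auto
  note ev = this
  obtain Y where Y: "0 < Y" "ln (J / 2) / 2 < drift a Y"
    using drift_above[of "ln (J / 2) / 2"] J2 by auto
  have "\<forall>\<^sub>F w in at_top. x\<^sup>2 * w powr (- 2 * a) < - ln (J / 2) / 2 \<and> Y < w"
    by (rule eventually_conj[OF ev eventually_gt_at_top])
  then obtain w2 where w2: "x\<^sup>2 * w2 powr (- 2 * a) < - ln (J / 2) / 2" "Y < w2"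
    using eventually_happens'[OF trivial_limit_at_top_linorder] by blast
  have w20: "0 < w2" using Y w2 by simp
  have e2: "ln (J / 2) \<le> ?E w2"
    using drift_strict_mono[of a Y w2] a Y w2 by simp
  have "\<forall>\<^sub>F w in at_right 0. drift a w < ln (J / 2)"
    using drift_at_bot unfolding filterlim_at_bot_dense by blast
  then have "\<forall>\<^sub>F w in at_right 0. drift a w < ln (J / 2) \<and> 0 < w \<and> w < w2"
    using eventually_at_right_less[of "0::real"] eventually_at_right_real[OF w20]
    by eventually_elim auto
  then obtain w1 where w1: "drift a w1 < ln (J / 2)" "0 < w1" "w1 < w2"
    using eventually_happens'[OF trivial_limit_at_right_real] by blast
  have "\<exists>w\<ge>w1. w \<le> w2 \<and> ?E w = ln (J / 2)"
  proof (rule IVT')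
    have "0 \<le> x\<^sup>2 * w1 powr (- 2 * a)" by simp
    then show "?E w1 \<le> ln (J / 2)" using w1(1) by linarith
    show "continuous_on {w1..w2} ?E"
      using w1 by (intro continuous_intros continuous_on_subset[OF continuous_on_drift]) auto
  qed (use w1 e2 in auto)
  then obtain w where w: "w1 \<le> w" "?E w = ln (J / 2)" by blast
  have "lower_level (x, w) = J" using assms w(2) by (simp only: lower_level_def prod.case) simp
  then show ?thesis using that[of w] w(1) w1 by simp
qed

lemma cball_subset_range_portrait_chart: "cball 0 1 \<subseteq> range portrait_chart"
proof
  fix z :: complex assume z: "z \<in> cball 0 1"
  consider "0 < Im z" | "Im z = 0" | "Im z < 0" by linarith
  then show "z \<in> range portrait_chart"
  proof cases
    case 1
    define Z where "Z = - inverse z"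
    have z0: "z \<noteq> 0" using 1 by auto
    have "0 < Im Z" using 1 by (simp add: Z_def divide_pos_pos complex_neq_0[symmetric] z0)
    moreover have "1 \<le> norm Z"
      using z z0 by (simp add: Z_def norm_inverse one_le_inverse_iff)
    then have "1 \<le> (Re Z)\<^sup>2 + (Im Z)\<^sup>2"
      by (simp add: cmod_def)
    ultimately obtain x y where xy: "0 < y" "x / (x\<^sup>2 + y) = Re Z" "exp (- first_integral (x, y)) / 2 = Im Z"
      by (rule upper_surj)
    then have "upper_coord (x, y) = Z" by (simp add: upper_coord_def complex_eq_iff)
    then have "portrait_chart (x, y) = z" using xy(1) z0 by (simp add: portrait_chart_simps Z_def)
    then show ?thesis by (metis rangeI)
  next
    case 2
    then have "portrait_chart (- Re z, 0) = z" by (simp add: portrait_chart_simps complex_eq_iff)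
    then show ?thesis by (metis rangeI)
  next
    case 3
    have "- Im z \<le> 1" using abs_Im_le_cmod[of z] z by simp
    then obtain w where "0 < w" "lower_level (- Re z, w) = - Im z"
      using lower_surj[of "- Im z" "- Re z"] 3 by auto
    then have "portrait_chart (- Re z, - w) = z" by (simp add: portrait_chart_simps complex_eq_iff)
    then show ?thesis by (metis rangeI)
  qed
qed

lemma continuous_on_first_integral: "continuous_on {q. 0 < snd q} first_integral"
  unfolding first_integral_def case_prod_beta
  by (intro continuous_intros continuous_on_compose2[OF continuous_on_drift]) auto

lemma continuous_on_upper_coord: "continuous_on {q. 0 < snd q} upper_coord"
proof -
  have "(fst q)\<^sup>2 + snd q \<noteq> 0" if "0 < snd q" for q :: "real \<times> real"
    using add_nonneg_pos[OF zero_le_power2[of "fst q"] that] by simp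
  then have c: "continuous_on {q::real \<times> real. 0 < snd q} (\<lambda>q. fst q / ((fst q)\<^sup>2 + snd q))"
    by (intro continuous_intros) auto
  have e: "upper_coord = (\<lambda>q. of_real (fst q / ((fst q)\<^sup>2 + snd q)) + \<i> * of_real (exp (- first_integral q) / 2))"
    by (simp add: upper_coord_def fun_eq_iff Complex_eq)
  show ?thesis
    unfolding e by (intro continuous_intros c continuous_on_first_integral) auto
qed

lemma upper_coord_nonzero: "upper_coord q \<noteq> 0"
  by (cases q) (simp add: upper_coord_def complex_eq_iff)

lemma continuous_on_lower_level: "continuous_on {q. 0 < snd q} lower_level"
  unfolding lower_level_def case_prod_beta
  by (intro continuous_intros continuous_on_compose2[OF continuous_on_drift]) auto

lemma lower_level_tendsto:
  "((\<lambda>q. lower_level (fst q, - snd q)) \<longlongrightarrow> 0) (at (x, 0) within {q. snd q < 0})"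
proof (rule tendsto_sandwich[OF _ _ tendsto_const])
  have "0 \<le> x\<^sup>2 * w powr (- 2 * a)" for x w :: real by simp
  then show "\<forall>\<^sub>F q in at (x, 0) within {q. snd q < 0}. lower_level (fst q, - snd q) \<le> 2 * exp (drift a (- snd q))"
    by (intro always_eventually) (simp add: lower_level_def)
  show "\<forall>\<^sub>F q in at (x, 0) within {q. snd q < 0}. 0 \<le> lower_level (fst q, - snd q)"
    by (simp add: lower_level_def)
  have lim: "filterlim (\<lambda>q. - snd q) (at_right 0) (at (x, 0) within {q::real \<times> real. snd q < 0})"
    unfolding filterlim_at
    by (auto simp: eventually_at_filter intro!: tendsto_eq_intros)
  have "((\<lambda>w. 2 * exp (drift a w)) \<longlongrightarrow> 2 * 0) (at_right 0)"
    by (intro tendsto_intros filterlim_compose[OF exp_at_bot drift_at_bot])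
  from filterlim_compose[OF this lim]
  show "((\<lambda>q. 2 * exp (drift a (- snd q))) \<longlongrightarrow> 0) (at (x, 0) within {q. snd q < 0})" by simp
qed

text \<open>At \<open>x \<noteq> 0\<close> the first integral tends to \<open>\<infinity>\<close>, so \<open>J\<close> tends to 0 while \<open>\<tau>\<close> tends to \<open>1 / x\<close>.
  At the origin one has to exclude that \<open>\<tau>\<close> and \<open>J\<close> are both bounded: if \<open>\<bar>\<tau>\<bar> < M\<close>, then
  \<open>\<bar>x\<bar> \<le> 2 M y\<close> near the origin, so that the term \<open>x\<^sup>2 y\<^sup>-\<^sup>2\<^sup>a\<close> of the first integral is dominated by the drift, and
  \<open>J\<close> is large.\<close>
lemma upper_chart_tendsto:
  "((\<lambda>q. - inverse (upper_coord q)) \<longlongrightarrow> - of_real x) (at (x, 0) within {q. 0 < snd q})"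
    (is "(_ \<longlongrightarrow> _) ?F")
proof -
  have lim: "filterlim snd (at_right 0) ?F"
    unfolding filterlim_at by (auto simp: eventually_at_filter intro!: tendsto_eq_intros)
  have lim1: "(fst \<longlongrightarrow> x) ?F" by (auto intro!: tendsto_eq_intros)
  have lim2: "(snd \<longlongrightarrow> 0) ?F" using lim by (simp add: filterlim_at)
  have pos: "\<forall>\<^sub>F q in ?F. 0 < snd q" by (auto simp: eventually_at_filter)
  show ?thesis
  proof (cases "x = 0")
    case False
    have "((\<lambda>q. exp (- first_integral q) / 2) \<longlongrightarrow> 0) ?F"
    proof (rule tendsto_sandwich[OF always_eventually _ tendsto_const])
      have "((\<lambda>q. (fst q)\<^sup>2 + snd q powr (2 * a) * drift a (snd q)) \<longlongrightarrow> x\<^sup>2 + 0) ?F"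
        by (intro tendsto_intros lim1 filterlim_compose[OF powr_drift_tendsto_0 lim])
      then have "\<forall>\<^sub>F q in ?F. x\<^sup>2 / 2 < (fst q)\<^sup>2 + snd q powr (2 * a) * drift a (snd q)"
        by (rule order_tendstoD) (use False in simp)
      then show "\<forall>\<^sub>F q in ?F. exp (- first_integral q) / 2 \<le> exp (- (x\<^sup>2 / 2 * snd q powr (- 2 * a))) / 2"
        using pos
      proof eventually_elim
        case (elim q)
        have "x\<^sup>2 / 2 * snd q powr (- 2 * a) \<le>
            ((fst q)\<^sup>2 + snd q powr (2 * a) * drift a (snd q)) * snd q powr (- 2 * a)"
          using elim by (intro mult_right_mono) auto
        also have "\<dots> = first_integral q"
        proof -
          have "snd q powr (2 * a) * snd q powr (- 2 * a) = 1"
            using elim(2) by (simp add: powr_add[symmetric])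
          then have "snd q powr (2 * a) * drift a (snd q) * snd q powr (- 2 * a) = drift a (snd q)"
            by (metis mult.commute mult.left_commute mult.right_neutral)
          then show ?thesis by (simp add: first_integral_def case_prod_beta distrib_right)
        qed
        finally show ?case by simp
      qed
      have "filterlim (\<lambda>y. x\<^sup>2 / 2 * y powr (- 2 * a)) at_top (at_right 0)"
        using False a
        by (intro filterlim_tendsto_pos_mult_at_top[OF tendsto_const] powr_at_right_0_at_top) auto
      then have "((\<lambda>y. exp (- (x\<^sup>2 / 2 * y powr (- 2 * a))) / 2) \<longlongrightarrow> 0 / 2) (at_right 0)"
        by (intro tendsto_intros filterlim_compose[OF exp_at_bot]) (auto simp: filterlim_uminus_at_top)
      from filterlim_compose[OF this lim]
      show "((\<lambda>q. exp (- (x\<^sup>2 / 2 * snd q powr (- 2 * a))) / 2) \<longlongrightarrow> 0) ?F" by simp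
    qed auto
    moreover have "((\<lambda>q. fst q / ((fst q)\<^sup>2 + snd q)) \<longlongrightarrow> x / (x\<^sup>2 + 0)) ?F"
      using False by (intro tendsto_intros lim1 lim2) auto
    ultimately have "((\<lambda>q. Complex (fst q / ((fst q)\<^sup>2 + snd q)) (exp (- first_integral q) / 2))
        \<longlongrightarrow> Complex (x / (x\<^sup>2 + 0)) 0) ?F"
      by (rule tendsto_Complex[rotated])
    then have "(upper_coord \<longlongrightarrow> of_real (1 / x)) ?F"
      using False by (simp add: upper_coord_def case_prod_beta' complex_of_real_def power2_eq_square)
    then have "((\<lambda>q. - inverse (upper_coord q)) \<longlongrightarrow> - inverse (of_real (1 / x))) ?F"
      using False by (intro tendsto_intros) auto
    then show ?thesis using False by simp
  next
    case True
    have "filterlim upper_coord at_infinity ?F"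
      unfolding filterlim_at_infinity[OF order_refl]
    proof (intro allI impI)
      fix M :: real assume M: "0 < M"
      have "\<forall>\<^sub>F y in at_right 0. drift a y < - (2 * ln (2 * M))"
        using drift_at_bot unfolding filterlim_at_bot_dense by blast
      have e1: "\<forall>\<^sub>F q in ?F. drift a (snd q) < - (2 * ln (2 * M))"
        using eventually_compose_filterlim[OF \<open>\<forall>\<^sub>F y in at_right 0. drift a y < - (2 * ln (2 * M))\<close> lim] .
      have e2: "\<forall>\<^sub>F q in ?F. snd q powr (2 * a - 1) * drift a (snd q) \<le> - 1"
        using eventually_compose_filterlim[OF powr_drift_bound lim] .
      have e3: "\<forall>\<^sub>F q in ?F. snd q < 1 / (8 * M\<^sup>2)"
        by (rule order_tendstoD[OF lim2]) (use M in auto)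
      have e4: "\<forall>\<^sub>F q in ?F. \<bar>fst q\<bar> < 1 / (2 * M)"
        using tendsto_rabs[OF lim1] by (rule order_tendstoD) (use M True in auto)
      show "\<forall>\<^sub>F q in ?F. M \<le> norm (upper_coord q)"
        using e1 e2 e3 e4 pos
      proof eventually_elim
        case (elim q)
        obtain x' y where q: "q = (x', y)" by fastforce
        have y: "0 < y" and x': "\<bar>x'\<bar> * M \<le> 1 / 2" using elim M by (auto simp: q field_simps)
        have xy: "0 < x'\<^sup>2 + y" using y by (simp add: add_nonneg_pos)
        show ?case
        proof (cases "M \<le> \<bar>x' / (x'\<^sup>2 + y)\<bar>")
          case True
          then show ?thesis
            using abs_Re_le_cmod[of "upper_coord q"] by (simp add: upper_coord_def q)
        next
          case False
          then have "\<bar>x'\<bar> < M * (x'\<^sup>2 + y)"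
            using xy by (simp add: abs_divide divide_less_eq not_le)
          also have "M * x'\<^sup>2 \<le> \<bar>x'\<bar> / 2"
            using mult_left_mono[OF x', of "\<bar>x'\<bar>"] by (simp add: power2_eq_square mult_ac)
          then have "M * (x'\<^sup>2 + y) \<le> \<bar>x'\<bar> / 2 + M * y" by (simp add: distrib_left)
          finally have "\<bar>x'\<bar> \<le> 2 * M * y" by simp
          then have "x'\<^sup>2 \<le> (2 * M * y)\<^sup>2" using M y by (intro abs_le_square_iff[THEN iffD1]) auto
          then have "x'\<^sup>2 * y powr (- 2 * a) \<le> (2 * M * y)\<^sup>2 * y powr (- 2 * a)"
            by (intro mult_right_mono) auto
          also have "\<dots> = 4 * M\<^sup>2 * y * y powr (1 - 2 * a)"
            using y by (simp add: powr_diff powr_minus field_simps power2_eq_square)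
          also have "\<dots> \<le> 4 * M\<^sup>2 * y * (- drift a y)"
          proof (intro mult_left_mono)
            have "y powr (1 - 2 * a) * 1 \<le> y powr (1 - 2 * a) * (y powr (2 * a - 1) * (- drift a y))"
              using elim(2) by (intro mult_left_mono) (auto simp: q)
            also have "\<dots> = - drift a y"
            proof -
              have "y powr (1 - 2 * a) * y powr (2 * a - 1) = 1"
                using y by (simp add: powr_add[symmetric])
              then show ?thesis by (simp add: mult.assoc[symmetric])
            qed
            finally show "y powr (1 - 2 * a) \<le> - drift a y" by simp
          qed (use y in auto)
          also have "\<dots> \<le> (1 / 2) * (- drift a y)"
          proof (intro mult_right_mono)
            show "4 * M\<^sup>2 * y \<le> 1 / 2" using elim(3) M by (simp add: q field_simps)
            have "0 < y powr (2 * a - 1) * (- drift a y)" using elim(2) by (simp add: q)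
            then show "0 \<le> - drift a y" by (simp add: zero_less_mult_iff mult_less_0_iff)
          qed
          finally have "first_integral q \<le> drift a y / 2" by (simp add: first_integral_def q)
          then have "ln (2 * M) \<le> - first_integral q" using elim(1) by (simp add: q)
          then have "exp (ln (2 * M)) \<le> exp (- first_integral q)" by simp
          then have "M \<le> Im (upper_coord q)" using M by (simp add: upper_coord_def q)
          then show ?thesis using abs_Im_le_cmod[of "upper_coord q"] by linarith
        qed
      qed
    qed
    then have "((\<lambda>q. inverse (upper_coord q)) \<longlongrightarrow> 0) ?F"
      by (rule filterlim_compose[OF tendsto_inverse_0])
    then show ?thesis using True tendsto_minus by fastforce
  qed
qed

lemma continuous_on_portrait_chart: "continuous_on UNIV portrait_chart"
proof (intro continuous_at_imp_continuous_on ballI)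
  fix q :: "real \<times> real"
  obtain x y where q: "q = (x, y)" by fastforce
  have op: "open {q::real \<times> real. 0 < snd q}" "open {q::real \<times> real. snd q < 0}"
    by (intro open_Collect_less continuous_intros)+
  consider "0 < y" | "y = 0" | "y < 0" by linarith
  then show "isCont portrait_chart q"
  proof cases
    case 1
    have "continuous_on {q. 0 < snd q} portrait_chart"
      by (rule continuous_on_eq[of _ "\<lambda>q. - inverse (upper_coord q)"])
        (auto intro!: continuous_intros continuous_on_upper_coord simp: upper_coord_nonzero portrait_chart_cases)
    then show ?thesis using continuous_on_eq_continuous_at[OF op(1)] 1 q by auto
  next
    case 3
    have "continuous_on {q. snd q < 0} (\<lambda>q. Complex (- fst q) (- lower_level (fst q, - snd q)))"
      unfolding Complex_eq
      by (intro continuous_intros continuous_on_compose2[OF continuous_on_lower_level]) auto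
    then have "continuous_on {q. snd q < 0} portrait_chart"
      by (rule continuous_on_eq) (auto simp: portrait_chart_cases)
    then show ?thesis using continuous_on_eq_continuous_at[OF op(2)] 3 q by auto
  next
    case 2
    have "(portrait_chart \<longlongrightarrow> - of_real x) (at (x, 0) within {q. 0 < snd q})"
      using upper_chart_tendsto[of x]
      by (rule tendsto_cong[THEN iffD1, rotated])
        (auto simp: eventually_at_filter portrait_chart_cases)
    moreover have "(portrait_chart \<longlongrightarrow> - of_real x) (at (x, 0) within {q. snd q = 0})"
    proof -
      have "((\<lambda>q. - complex_of_real (fst q)) \<longlongrightarrow> - of_real x) (at (x, 0) within {q::real \<times> real. snd q = 0})"
        by (auto intro!: tendsto_eq_intros)
      then show ?thesis
        by (rule tendsto_cong[THEN iffD1, rotated])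
          (auto simp: eventually_at_filter portrait_chart_cases)
    qed
    moreover have "(portrait_chart \<longlongrightarrow> - of_real x) (at (x, 0) within {q. snd q < 0})"
    proof -
      have "((\<lambda>q. Complex (- fst q) (- lower_level (fst q, - snd q))) \<longlongrightarrow> Complex (- x) (- 0))
          (at (x, 0) within {q. snd q < 0})"
        by (intro tendsto_Complex tendsto_minus lower_level_tendsto) (auto intro!: tendsto_eq_intros)
      moreover have "Complex (- x) (- 0) = - of_real x" by (simp add: complex_eq_iff)
      ultimately have "((\<lambda>q. Complex (- fst q) (- lower_level (fst q, - snd q))) \<longlongrightarrow> - of_real x)
          (at (x, 0) within {q. snd q < 0})" by simp
      then show ?thesis
        by (rule tendsto_cong[THEN iffD1, rotated])
          (auto simp: eventually_at_filter portrait_chart_cases)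
    qed
    ultimately have "(portrait_chart \<longlongrightarrow> - of_real x)
        (at (x, 0) within ({q. 0 < snd q} \<union> {q. snd q = 0} \<union> {q. snd q < 0}))"
      by (simp add: at_within_union filterlim_sup)
    moreover have "({q. 0 < snd q} \<union> {q. snd q = 0} \<union> {q. snd q < 0}) = (UNIV :: (real \<times> real) set)"
      by auto
    ultimately show ?thesis
      using 2 q by (simp add: isCont_def portrait_chart_simps)
  qed
qed

end

section \<open>Orbits of the model in the chart\<close>

lemma Complex_has_derivative:
  assumes "(f has_derivative f') F" "(g has_derivative g') F"
  shows "((\<lambda>q. Complex (f q) (g q)) has_derivative (\<lambda>h. Complex (f' h) (g' h))) F"
proof -
  have e: "Complex u v = u *\<^sub>R 1 + v *\<^sub>R \<i>" for u v by (simp add: complex_eq_iff)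
  show ?thesis
    unfolding e using assms by (intro has_derivative_add has_derivative_scaleR_left)
qed

context quasi_homogeneous_model begin

abbreviation "model \<equiv> qh_field a (a + 1)"

lemma first_integral_deriv:
  assumes "0 < y"
  shows "(first_integral has_derivative
      (\<lambda>(u, v). 2 * x * y powr (- 2 * a) * u
         + (- 2 * a * x\<^sup>2 * y powr (- 2 * a - 1) + 2 * (a + 1) * y powr (- 2 * a)) * v)) (at (x, y))"
proof -
  have p: "((\<lambda>y. y powr (- 2 * a)) has_derivative (\<lambda>h. (- 2 * a * y powr (- 2 * a - 1)) * h)) (at (snd (x, y)))"
    using has_real_derivative_powr[OF assms, of "- 2 * a"] by (simp only: has_field_derivative_def snd_conv)
  have d: "(drift a has_derivative (\<lambda>h. (2 * (a + 1) * y powr (- 2 * a)) * h)) (at (snd (x, y)))"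
    using drift_deriv[OF assms] by (simp only: has_field_derivative_def snd_conv)
  have sn: "(snd has_derivative snd) (at (x, y))" by (intro has_derivative_snd has_derivative_ident)
  have "((\<lambda>q. (fst q)\<^sup>2 * snd q powr (- 2 * a) + drift a (snd q)) has_derivative
      (\<lambda>h. (fst (x, y))\<^sup>2 * ((- 2 * a * y powr (- 2 * a - 1)) * snd h)
          + (2 * fst h * fst (x, y)) * snd (x, y) powr (- 2 * a)
          + (2 * (a + 1) * y powr (- 2 * a)) * snd h)) (at (x, y))"
    by (intro has_derivative_add has_derivative_mult has_derivative_compose[OF sn p]
        has_derivative_compose[OF sn d] has_derivative_ident)
      (auto intro!: derivative_eq_intros)
  then show ?thesis
    by (simp add: first_integral_def case_prod_beta' algebra_simps)
qed

text \<open>The last equation says that \<open>lower_level\<close> is constant along the flow of the model.\<close>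
lemma lower_level_deriv:
  fixes x y :: real
  assumes "y < 0"
  defines "E \<equiv> lower_level (x, - y) * (- y) powr (- 2 * a)"
  defines "A \<equiv> - (2 * x * E)" and "B \<equiv> - (E * (2 * (a + 1) + 2 * a * x\<^sup>2 / (- y)))"
  shows "((\<lambda>q. lower_level (fst q, - snd q)) has_derivative (\<lambda>(u, v). A * u + B * v)) (at (x, y))"
    "B < 0" "A * (- a * x\<^sup>2 + (a + 1) * y) + B * (- x * y) = 0"
proof -
  define w where "w = - y"
  have w: "0 < w" using assms by (simp add: w_def)
  have p: "((\<lambda>y. y powr (- 2 * a)) has_derivative (\<lambda>h. (- 2 * a * w powr (- 2 * a - 1)) * h)) (at (- snd (x, y)))"
    using has_real_derivative_powr[OF w, of "- 2 * a"] by (simp only: has_field_derivative_def w_def snd_conv)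
  have d: "(drift a has_derivative (\<lambda>h. (2 * (a + 1) * w powr (- 2 * a)) * h)) (at (- snd (x, y)))"
    using drift_deriv[OF w] by (simp only: has_field_derivative_def w_def snd_conv)
  have n: "((\<lambda>q. - snd q) has_derivative (\<lambda>h. - snd h)) (at (x, y))"
    by (auto intro!: derivative_eq_intros)
  have "((\<lambda>q. drift a (- snd q) - (fst q)\<^sup>2 * (- snd q) powr (- 2 * a)) has_derivative
      (\<lambda>h. (2 * (a + 1) * w powr (- 2 * a)) * (- snd h)
          - ((fst (x, y))\<^sup>2 * ((- 2 * a * w powr (- 2 * a - 1)) * (- snd h))
          + (2 * fst h * fst (x, y)) * (- snd (x, y)) powr (- 2 * a)))) (at (x, y))"
    by (intro has_derivative_diff has_derivative_mult has_derivative_compose[OF n p]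
        has_derivative_compose[OF n d] has_derivative_ident)
      (auto intro!: derivative_eq_intros)
  from has_derivative_mult_right[OF has_derivative_exp[OF this], of 2]
  have D: "((\<lambda>q. lower_level (fst q, - snd q)) has_derivative
      (\<lambda>h. 2 * (exp (drift a w - x\<^sup>2 * w powr (- 2 * a)) *
         ((2 * (a + 1) * w powr (- 2 * a)) * (- snd h)
          - (x\<^sup>2 * ((- 2 * a * w powr (- 2 * a - 1)) * (- snd h))
          + (2 * fst h * x) * w powr (- 2 * a)))))) (at (x, y))"
    by (simp add: lower_level_def w_def mult_ac)
  have E: "0 < E" "E = 2 * exp (drift a w - x\<^sup>2 * w powr (- 2 * a)) * w powr (- 2 * a)"
    using w by (simp_all add: E_def lower_level_def w_def)
  have P: "w powr (- 2 * a - 1) = w powr (- 2 * a) / w" using w by (simp add: powr_diff)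
  show "((\<lambda>q. lower_level (fst q, - snd q)) has_derivative (\<lambda>(u, v). A * u + B * v)) (at (x, y))"
    using D unfolding P A_def B_def E(2) by (simp add: case_prod_beta' algebra_simps flip: w_def)
  have "0 \<le> 2 * a * x\<^sup>2 / w" using a w by simp
  then have "0 < E * (2 * (a + 1) + 2 * a * x\<^sup>2 / w)" using a E by (intro mult_pos_pos) auto
  then show "B < 0" by (simp add: B_def w_def)
  show "A * (- a * x\<^sup>2 + (a + 1) * y) + B * (- x * y) = 0"
    using assms(1) unfolding A_def B_def by (simp add: field_simps power2_eq_square)
qed

text \<open>The model moves \<open>\<tau> = x / (x\<^sup>2 + y)\<close> at the rate \<open>(a (x\<^sup>2 - y)\<^sup>2 + y\<^sup>2) / (x\<^sup>2 + y)\<^sup>2 > 0\<close>, which is a sum of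
  squares precisely for the coefficient \<open>a + 1\<close> of \<open>y\<close>, and keeps the second component fixed.\<close>
lemma upper_chart_conj:
  assumes S: "S \<subseteq> {q. 0 < snd q}" and ab: "p \<in> S" "q \<in> S"
    and h: "\<And>q. q \<in> S \<Longrightarrow> h q = upper_coord q"
  shows "flows_to model S p q \<longleftrightarrow> flows_to (\<lambda>_. 1) (h ` S) (h p) (h q)"
proof -
  let ?\<tau>' = "\<lambda>(x, y) (u, v). ((y - x\<^sup>2) * u - x * v) / (x\<^sup>2 + y)\<^sup>2"
  let ?K' = "\<lambda>(x, y) (u, v). 2 * x * y powr (- 2 * a) * u
         + (- 2 * a * x\<^sup>2 * y powr (- 2 * a - 1) + 2 * (a + 1) * y powr (- 2 * a)) * v"
  let ?D = "\<lambda>q h. Complex (?\<tau>' q h) (- exp (- first_integral q) / 2 * ?K' q h)"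
  let ?\<mu> = "\<lambda>(x, y). (a * (x\<^sup>2 - y)\<^sup>2 + y\<^sup>2) / (x\<^sup>2 + y)\<^sup>2"
  have pos: "0 < x\<^sup>2 + y" if "0 < y" for x y :: real using that by (simp add: add_nonneg_pos)
  have inj: "inj_on upper_coord {q. 0 < snd q}"
  proof (rule inj_onI, clarify)
    fix x y x' y' assume y: "0 < snd (x, y)" "0 < snd (x', y')" and e: "upper_coord (x, y) = upper_coord (x', y')"
    then have "portrait_chart (x, y) = portrait_chart (x', y')"
      by (simp add: portrait_chart_cases)
    from injD[OF inj_portrait_chart this] show "x = x' \<and> y = y'" by simp
  qed
  show ?thesis
  proof (rule flows_to_chart[where \<Psi> = upper_coord and U = "{q. 0 < snd q}" and D = ?D and \<mu> = ?\<mu>])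
    show "open {q::real \<times> real. 0 < snd q}" by (intro open_Collect_less continuous_intros)
    fix q assume q: "q \<in> S"
    obtain x y where xy: "q = (x, y)" by fastforce
    have y: "0 < y" using q S xy by auto
    note p = pos[OF y, of x]
    have "((\<lambda>q. fst q / ((fst q)\<^sup>2 + snd q)) has_derivative ?\<tau>' q) (at q)"
      unfolding xy using p
      by (auto intro!: derivative_eq_intros simp: case_prod_beta' field_simps power2_eq_square)
    moreover have "((\<lambda>q. exp (- first_integral q) / 2) has_derivative
        (\<lambda>h. - exp (- first_integral q) / 2 * ?K' q h)) (at q)"
      using first_integral_deriv[OF y, of x] unfolding xy
      by (auto intro!: derivative_eq_intros simp: fun_eq_iff)
    ultimately have "((\<lambda>q. Complex (fst q / ((fst q)\<^sup>2 + snd q)) (exp (- first_integral q) / 2)) has_derivative ?D q) (at q)"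
      by (rule Complex_has_derivative)
    moreover have "upper_coord = (\<lambda>q. Complex (fst q / ((fst q)\<^sup>2 + snd q)) (exp (- first_integral q) / 2))"
      by (simp add: upper_coord_def fun_eq_iff)
    ultimately show "(upper_coord has_derivative ?D q) (at q)" by (simp only:)
    have P: "y powr (- 2 * a - 1) = y powr (- 2 * a) / y" using y by (simp add: powr_diff)
    have K': "?K' q (u, v) = 2 * y powr (- 2 * a) / y * (x * y * u + (- a * x\<^sup>2 + (a + 1) * y) * v)" for u v
      unfolding xy prod.case P using y by (simp add: field_simps)
    have PP: "0 < 2 * y powr (- 2 * a) / y" using y by simp
    show "h = 0" if "?D q h = 0" for h
    proof -
      obtain u v where h: "h = (u, v)" by fastforce
      have 1: "(y - x\<^sup>2) * u - x * v = 0" using that p by (simp add: h xy complex_eq_iff)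
      have nz: "t = 0" if "c * t = 0" "0 < c" for c t :: real using that by simp
      have "?K' q (u, v) = 0" using that by (simp add: h complex_eq_iff)
      then have 2: "x * y * u + (- a * x\<^sup>2 + (a + 1) * y) * v = 0"
        unfolding K' by (rule nz[OF _ PP])
      \<comment> \<open>eliminating \<open>v\<close> from the two linear equations; the determinant is the numerator of the rate\<close>
      have "u * (a * (x\<^sup>2 - y)\<^sup>2 + y\<^sup>2) =
          x * (x * y * u + (- a * x\<^sup>2 + (a + 1) * y) * v)
          + (- a * x\<^sup>2 + (a + 1) * y) * ((y - x\<^sup>2) * u - x * v)"
        by (simp add: algebra_simps power2_eq_square)
      then have "u * (a * (x\<^sup>2 - y)\<^sup>2 + y\<^sup>2) = 0" using 1 2 by simp
      moreover have "0 < a * (x\<^sup>2 - y)\<^sup>2 + y\<^sup>2" using a y by (simp add: add_nonneg_pos)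
      ultimately have u: "u = 0" by simp
      have "v = 0"
      proof (cases "x = 0")
        case True
        then show ?thesis using 2 u y a by simp
      next
        case False
        then show ?thesis using 1 u by simp
      qed
      then show ?thesis using u h by (simp add: zero_prod_def)
    qed
    have "?\<tau>' q (model q) = ?\<mu> q"
      unfolding xy by (simp add: qh_field_def algebra_simps power2_eq_square)
    moreover have "?K' q (model q) = 0"
      using K'[of "- a * x\<^sup>2 + (a + 1) * y" "- x * y"] by (simp add: xy qh_field_def algebra_simps)
    ultimately show "?D q (model q) = ?\<mu> q *\<^sub>R 1"
      by (simp only: complex_eq_iff) simp
    show "0 < ?\<mu> q"
      unfolding xy prod.case using p a y by (intro divide_pos_pos add_nonneg_pos) auto
  next
    have "(fst q)\<^sup>2 + snd q \<noteq> 0" if "q \<in> S" for q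
    proof -
      have "0 < snd q" using S that by blast
      from pos[OF this, of "fst q"] show ?thesis by simp
    qed
    then show "continuous_on S ?\<mu>"
      unfolding case_prod_beta' by (intro continuous_intros) auto
  qed (fact S ab h inj continuous_on_upper_coord | simp)+
qed

text \<open>On the axis \<open>1 / x\<close> moves at the rate \<open>a\<close>.  The chart \<open>(1 / x, y)\<close> of a neighbourhood of the punctured axis
  is used only on the axis itself.\<close>
lemma upper_axis_conj:
  assumes S: "S \<subseteq> {q. snd q = 0} - {0}" and ab: "p \<in> S" "q \<in> S"
    and h: "\<And>q. q \<in> S \<Longrightarrow> h q = complex_of_real (1 / fst q)"
  shows "flows_to model S p q \<longleftrightarrow> flows_to (\<lambda>_. 1) (h ` S) (h p) (h q)"
proof (rule flows_to_chart[where \<Psi> = "\<lambda>q. Complex (1 / fst q) (snd q)" and U = "{q. fst q \<noteq> 0}"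
      and D = "\<lambda>q h. Complex (- fst h / (fst q)\<^sup>2) (snd h)" and \<mu> = "\<lambda>_. a"])
  show "open {q::real \<times> real. fst q \<noteq> 0}" by (intro open_Collect_neq continuous_intros)
  show "continuous_on {q::real \<times> real. fst q \<noteq> 0} (\<lambda>q. Complex (1 / fst q) (snd q))"
    unfolding Complex_eq by (intro continuous_intros) auto
  show "S \<subseteq> {q. fst q \<noteq> 0}" using S by (auto simp: zero_prod_def)
  fix q assume "q \<in> S"
  then have q: "fst q \<noteq> 0" "snd q = 0" using S by (auto simp: zero_prod_def prod_eq_iff)
  show "((\<lambda>q. Complex (1 / fst q) (snd q)) has_derivative
      (\<lambda>h. Complex (- fst h / (fst q)\<^sup>2) (snd h))) (at q)"
    using q by (intro Complex_has_derivative)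
      (auto intro!: derivative_eq_intros simp: power2_eq_square field_simps)
  show "Complex (- fst (model q) / (fst q)\<^sup>2) (snd (model q)) = a *\<^sub>R 1"
    using q by (simp add: qh_field_def case_prod_beta complex_eq_iff)
  show "h q = Complex (1 / fst q) (snd q)"
    using q h[OF \<open>q \<in> S\<close>] by (simp add: complex_eq_iff)
  show "v = 0" if "Complex (- fst v / (fst q)\<^sup>2) (snd v) = 0" for v :: "real \<times> real"
    using that q by (simp add: complex_eq_iff prod_eq_iff)
qed (use ab a in \<open>auto simp: inj_on_def\<close>)

text \<open>Below the axis \<open>- x\<close> moves at the rate \<open>a x\<^sup>2 - (a + 1) y > 0\<close>.\<close>
lemma lower_chart_conj:
  assumes S: "S \<subseteq> {q. snd q < 0}" and ab: "p \<in> S" "q \<in> S"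
    and h: "\<And>q. q \<in> S \<Longrightarrow> h q = Complex (- fst q) (lower_level (fst q, - snd q))"
  shows "flows_to model S p q \<longleftrightarrow> flows_to (\<lambda>_. 1) (h ` S) (h p) (h q)"
proof -
  let ?\<Psi> = "\<lambda>q. Complex (- fst q) (lower_level (fst q, - snd q))"
  define E where "E q = lower_level (fst q, - snd q) * (- snd q) powr (- 2 * a)" for q
  define A where "A q = - (2 * fst q * E q)" for q
  define B where "B q = - (E q * (2 * (a + 1) + 2 * a * (fst q)\<^sup>2 / (- snd q)))" for q
  have AB: "((\<lambda>q. lower_level (fst q, - snd q)) has_derivative (\<lambda>(u, v). A q * u + B q * v)) (at q)"
    "B q < 0" "A q * (- a * (fst q)\<^sup>2 + (a + 1) * snd q) + B q * (- fst q * snd q) = 0"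
    if "snd q < 0" for q
    using lower_level_deriv[OF that, of "fst q"] unfolding A_def B_def E_def by simp_all
  have inj: "inj_on ?\<Psi> {q. snd q < 0}"
  proof (rule inj_onI)
    fix q q' :: "real \<times> real" assume q: "q \<in> {q. snd q < 0}" "q' \<in> {q. snd q < 0}" and e: "?\<Psi> q = ?\<Psi> q'"
    have "portrait_chart q = cnj (?\<Psi> q)" if "snd q < 0" for q
      using that by (simp add: portrait_chart_cases complex_eq_iff)
    then have "portrait_chart q = portrait_chart q'" using q e by (metis mem_Collect_eq)
    then show "q = q'" by (rule injD[OF inj_portrait_chart])
  qed
  show ?thesis
  proof (rule flows_to_chart[where \<Psi> = ?\<Psi> and U = "{q. snd q < 0}"
        and D = "\<lambda>q h. Complex (- fst h) (A q * fst h + B q * snd h)"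
        and \<mu> = "\<lambda>q. a * (fst q)\<^sup>2 - (a + 1) * snd q"])
    show "open {q::real \<times> real. snd q < 0}" by (intro open_Collect_less continuous_intros)
    show "continuous_on {q. snd q < 0} ?\<Psi>"
      unfolding Complex_eq
      by (intro continuous_intros continuous_on_compose2[OF continuous_on_lower_level]) auto
    fix q assume "q \<in> S"
    then have q: "snd q < 0" using S by auto
    show "(?\<Psi> has_derivative (\<lambda>h. Complex (- fst h) (A q * fst h + B q * snd h))) (at q)"
      using AB(1)[OF q] by (intro Complex_has_derivative) (auto intro!: derivative_eq_intros simp: case_prod_beta')
    show "v = 0" if "Complex (- fst v) (A q * fst v + B q * snd v) = 0" for v
      using that AB(2)[OF q] by (auto simp: complex_eq_iff prod_eq_iff)
    show "Complex (- fst (model q)) (A q * fst (model q) + B q * snd (model q))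
        = (a * (fst q)\<^sup>2 - (a + 1) * snd q) *\<^sub>R 1"
      using AB(3)[OF q] by (simp add: complex_eq_iff qh_field_def case_prod_beta')
    have "0 < (a + 1) * - snd q" using a q by (intro mult_pos_pos) auto
    moreover have "0 \<le> a * (fst q)\<^sup>2" using a by simp
    ultimately show "0 < a * (fst q)\<^sup>2 - (a + 1) * snd q" by linarith
  next
    show "continuous_on S (\<lambda>q. a * (fst q)\<^sup>2 - (a + 1) * snd q)" by (intro continuous_intros)
  qed (fact S ab h inj | simp)+
qed

lemma lower_axis_conj:
  assumes S: "S \<subseteq> {q. snd q = 0} - {0}" and ab: "p \<in> S" "q \<in> S"
    and h: "\<And>q. q \<in> S \<Longrightarrow> h q = - complex_of_real (fst q)"
  shows "flows_to model S p q \<longleftrightarrow> flows_to (\<lambda>_. 1) (h ` S) (h p) (h q)"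
proof (rule flows_to_chart[where \<Psi> = "\<lambda>q. Complex (- fst q) (snd q)" and U = "UNIV"
      and D = "\<lambda>q h. Complex (- fst h) (snd h)" and \<mu> = "\<lambda>q. a * (fst q)\<^sup>2"])
  show "continuous_on (UNIV :: (real \<times> real) set) (\<lambda>q. Complex (- fst q) (snd q))"
    unfolding Complex_eq by (intro continuous_intros)
  fix q assume "q \<in> S"
  then have q: "fst q \<noteq> 0" "snd q = 0" using S by (auto simp: zero_prod_def prod_eq_iff)
  show "((\<lambda>q. Complex (- fst q) (snd q)) has_derivative (\<lambda>h. Complex (- fst h) (snd h))) (at q)"
    by (intro Complex_has_derivative) (auto intro!: derivative_eq_intros)
  show "Complex (- fst (model q)) (snd (model q)) = (a * (fst q)\<^sup>2) *\<^sub>R 1"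
    using q by (simp add: qh_field_def case_prod_beta complex_eq_iff)
  show "h q = Complex (- fst q) (snd q)"
    using q h[OF \<open>q \<in> S\<close>] by (simp add: complex_eq_iff)
  show "v = 0" if "Complex (- fst v) (snd v) = 0" for v :: "real \<times> real"
    using that by (simp add: complex_eq_iff prod_eq_iff)
  show "0 < a * (fst q)\<^sup>2" using q a by simp
qed (use ab in \<open>auto simp: inj_on_def prod_eq_iff intro!: continuous_intros\<close>)

text \<open>The axis consists of orbits, so the charts on the axis and above it can be glued.\<close>
lemma upper_conj:
  assumes S: "S \<subseteq> {q. 0 \<le> snd q} - {0}" and ab: "p \<in> S" "q \<in> S"
  defines "Z \<equiv> (\<lambda>q. - inverse (portrait_chart q))"
  shows "flows_to model S p q \<longleftrightarrow> flows_to (\<lambda>_. 1) (Z ` S) (Z p) (Z q)"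
proof (rule flows_to_glue[where f = snd and f' = Im])
  have up: "Z q = upper_coord q" if "0 < snd q" for q
    using that by (simp add: Z_def portrait_chart_cases)
  have ax: "Z q = of_real (1 / fst q)" if "snd q = 0" for q
    using that by (simp add: Z_def portrait_chart_cases divide_inverse)
  show "Im (Z q) = 0 \<longleftrightarrow> snd q = 0" if "q \<in> S" for q
  proof (cases "snd q = 0")
    case False
    then have "0 < snd q" using S that by auto
    then show ?thesis using up by (cases q) (simp add: upper_coord_def)
  qed (use ax in simp)
  show "flows_to model {q \<in> S. snd q = 0} v w \<longleftrightarrow> flows_to (\<lambda>_. 1) (Z ` {q \<in> S. snd q = 0}) (Z v) (Z w)"
    if "v \<in> {q \<in> S. snd q = 0}" "w \<in> {q \<in> S. snd q = 0}" for v w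
    by (rule upper_axis_conj[OF _ that]) (use S ax in auto)
  show "flows_to model {q \<in> S. snd q \<noteq> 0} v w \<longleftrightarrow> flows_to (\<lambda>_. 1) (Z ` {q \<in> S. snd q \<noteq> 0}) (Z v) (Z w)"
    if "v \<in> {q \<in> S. snd q \<noteq> 0}" "w \<in> {q \<in> S. snd q \<noteq> 0}" for v w
    by (rule upper_chart_conj[OF _ that]) (use S up in \<open>auto simp: less_le\<close>)
  show "invariant_zero_set model S snd"
    by (rule invariant_axis) (simp add: qh_field_def case_prod_beta)
qed (use ab invariant_Im in auto)

lemma lower_conj:
  assumes S: "S \<subseteq> {q. snd q \<le> 0} - {0}" and ab: "p \<in> S" "q \<in> S"
  defines "Z \<equiv> (\<lambda>q. cnj (portrait_chart q))"
  shows "flows_to model S p q \<longleftrightarrow> flows_to (\<lambda>_. 1) (Z ` S) (Z p) (Z q)"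
proof (rule flows_to_glue[where f = snd and f' = Im])
  have lo: "Z q = Complex (- fst q) (lower_level (fst q, - snd q))" if "snd q < 0" for q
    using that by (simp add: Z_def portrait_chart_cases complex_eq_iff)
  have ax: "Z q = - of_real (fst q)" if "snd q = 0" for q
    using that by (simp add: Z_def portrait_chart_cases)
  show "Im (Z q) = 0 \<longleftrightarrow> snd q = 0" if "q \<in> S" for q
  proof (cases "snd q = 0")
    case False
    then have "snd q < 0" using S that by auto
    then show ?thesis using lo by (cases q) (simp add: lower_level_def)
  qed (use ax in simp)
  show "flows_to model {q \<in> S. snd q = 0} v w \<longleftrightarrow> flows_to (\<lambda>_. 1) (Z ` {q \<in> S. snd q = 0}) (Z v) (Z w)"
    if "v \<in> {q \<in> S. snd q = 0}" "w \<in> {q \<in> S. snd q = 0}" for v w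
    by (rule lower_axis_conj[OF _ that]) (use S ax in auto)
  show "flows_to model {q \<in> S. snd q \<noteq> 0} v w \<longleftrightarrow> flows_to (\<lambda>_. 1) (Z ` {q \<in> S. snd q \<noteq> 0}) (Z v) (Z w)"
    if "v \<in> {q \<in> S. snd q \<noteq> 0}" "w \<in> {q \<in> S. snd q \<noteq> 0}" for v w
    by (rule lower_chart_conj[OF _ that]) (use S lo in \<open>auto simp: less_le\<close>)
  show "invariant_zero_set model S snd"
    by (rule invariant_axis) (simp add: qh_field_def case_prod_beta)
qed (use ab invariant_Im in auto)

end

section \<open>Phase portraits of the quasi-homogeneous fields\<close>

context quasi_homogeneous_model begin

lemma model_bound:
  "norm (model q) \<le> (\<bar>a\<bar> * \<bar>fst q\<bar> + \<bar>a + 1\<bar> + \<bar>fst q\<bar>) * norm (q - (0, 0))"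
proof -
  obtain x y where q: "q = (x, y)" by fastforce
  have x: "\<bar>x\<bar> \<le> norm (x, y)" using norm_fst_le[of x y] by simp
  have y: "\<bar>y\<bar> \<le> norm (x, y)" using norm_snd_le[of y x] by simp
  have "norm (model q) \<le> \<bar>- a * x\<^sup>2 + (a + 1) * y\<bar> + \<bar>- x * y\<bar>"
    using norm_Pair_le[of "- a * x\<^sup>2 + (a + 1) * y" "- x * y"] by (simp add: q qh_field_def)
  also have "\<dots> \<le> \<bar>a\<bar> * \<bar>x\<bar> * \<bar>x\<bar> + \<bar>a + 1\<bar> * \<bar>y\<bar> + \<bar>x\<bar> * \<bar>y\<bar>"
    using abs_triangle_ineq[of "- a * x\<^sup>2" "(a + 1) * y"] by (simp add: abs_mult power2_eq_square mult.assoc)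
  also have "\<dots> \<le> \<bar>a\<bar> * \<bar>x\<bar> * norm (x, y) + \<bar>a + 1\<bar> * norm (x, y) + \<bar>x\<bar> * norm (x, y)"
    by (intro add_mono mult_left_mono x y) auto
  finally show ?thesis by (simp add: q distrib_right zero_prod_def[symmetric])
qed

lemma model_zero: "model q = 0 \<longleftrightarrow> q = (0, 0)"
  using a by (cases q) (auto simp: qh_field_def zero_prod_def)

text \<open>The inverse \<open>g\<close> of the chart parametrises the neighbourhood by the unit disc, with the upper and lower half discs as
  the two wedges.  A half disc is the set of squares of the quarter disc, and
  \<open>- 1 / z\<close> above, \<open>cnj z\<close> below are the coordinates in which both the field and its model
  become a positive multiple of the constant field 1.\<close>
lemma model_sectorial_decomposition:
  "\<exists>V. compact V \<and> sectorial_decomposition model (0, 0) V [Elliptic, Hyperbolic]"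
proof -
  obtain g where g: "homeomorphism UNIV (range portrait_chart) portrait_chart g"
    using invariance_of_domain_homeomorphism[OF open_UNIV continuous_on_portrait_chart _ inj_portrait_chart]
    by auto
  have cg: "portrait_chart (g z) = z" if "norm z \<le> 1" for z
    using g cball_subset_range_portrait_chart that by (auto simp: homeomorphism_def)
  have gc: "g (portrait_chart q) = q" for q by (rule homeomorphism_apply1[OF g UNIV_I])
  define V where "V = g ` cball 0 1"
  have hom: "homeomorphism (cball 0 1) V g portrait_chart"
    unfolding V_def
    by (rule homeomorphism_of_subsets[OF homeomorphism_symD[OF g]])
      (use cball_subset_range_portrait_chart in auto)
  have contg: "continuous_on (cball 0 1) g" using hom by (auto simp: homeomorphism_def)
  have p0: "portrait_chart (0, 0) = 0" by (simp add: portrait_chart_cases)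
  have g0: "g 0 = (0, 0)" using gc[of "(0, 0)"] p0 by simp
  have V: "q \<in> V \<longleftrightarrow> norm (portrait_chart q) \<le> 1" for q
  proof
    assume "norm (portrait_chart q) \<le> 1"
    then show "q \<in> V" unfolding V_def by (intro image_eqI[of _ _ "portrait_chart q"]) (simp_all only: gc mem_cball_0)
  next
    assume "q \<in> V"
    then show "norm (portrait_chart q) \<le> 1" using cg by (auto simp: V_def)
  qed
  \<comment> \<open>\<open>c\<close> is the identity for the upper and the conjugation for the lower half disc\<close>
  have half: "\<exists>k. homeomorphism quarter_disc (g ` c ` (\<lambda>w. w\<^sup>2) ` quarter_disc) (\<lambda>w. g (c (w\<^sup>2))) k"
      (is "\<exists>k. homeomorphism _ _ ?H k")
    if c: "inj c" "continuous_on UNIV c" "\<And>z. norm (c z) = norm z" for c :: "complex \<Rightarrow> complex"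
  proof -
    have n: "norm (c (w\<^sup>2)) \<le> 1" if "w \<in> quarter_disc" for w
      using square_quarter_disc(1) that c(3)[of "w\<^sup>2"] by auto
    have inj: "inj_on ?H quarter_disc"
    proof (rule inj_onI)
      fix v w assume vw: "v \<in> quarter_disc" "w \<in> quarter_disc" "?H v = ?H w"
      then have "c (v\<^sup>2) = c (w\<^sup>2)" using cg n by metis
      then have "v\<^sup>2 = w\<^sup>2" using c(1) by (simp add: inj_eq)
      then show "v = w" using square_quarter_disc(3) vw by (auto dest: inj_onD)
    qed
    have cont: "continuous_on quarter_disc ?H"
      by (rule continuous_on_compose2[OF contg], rule continuous_on_compose2[OF c(2)])
        (use n in \<open>auto intro!: continuous_intros\<close>)
    have im: "?H ` quarter_disc = g ` c ` (\<lambda>w. w\<^sup>2) ` quarter_disc" by (simp add: image_image)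
    show ?thesis by (rule homeomorphism_compact[OF compact_quarter_disc cont im inj])
  qed
  obtain kE where kE: "homeomorphism quarter_disc (g ` wedge 2 0) (\<lambda>w. g (w\<^sup>2)) kE"
    using half[of "\<lambda>z. z"] unfolding wedge_upper square_quarter_disc(1) by auto
  have low: "cnj ` {z. norm z \<le> 1 \<and> 0 \<le> Im z} = wedge 2 1"
    unfolding wedge_lower by (auto intro!: image_eqI[of _ _ "cnj _"])
  obtain kH where kH: "homeomorphism quarter_disc (g ` wedge 2 1) (\<lambda>w. g (cnj (w\<^sup>2))) kH"
    using half[of cnj] unfolding square_quarter_disc(1) low
    by (auto simp: inj_on_def intro: continuous_intros)
  have gb: "continuous_on S (\<lambda>q. \<bar>a\<bar> * \<bar>fst q\<bar> + \<bar>a + 1\<bar> + \<bar>fst q\<bar>)" for S :: "(real \<times> real) set"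
    by (intro continuous_intros)
  have n2: "norm (w\<^sup>2) \<le> 1" if "w \<in> quarter_disc" for w
    using square_quarter_disc(1) that by auto
  have E: "is_sector model (0, 0) (g ` wedge 2 0) (g ` wedge_rays 2 0) Elliptic"
  proof (rule is_sector_by_chart[where H = "\<lambda>w. g (w\<^sup>2)" and Z = "\<lambda>q. - inverse (portrait_chart q)"
        and M = "\<lambda>w. - inverse (w\<^sup>2)" and E = "\<lambda>_. 1" and g' = "\<lambda>w. (norm w)\<^sup>2"
        and g = "\<lambda>q. \<bar>a\<bar> * \<bar>fst q\<bar> + \<bar>a + 1\<bar> + \<bar>fst q\<bar>"])
    show "homeomorphism quarter_disc (g ` wedge 2 0) (\<lambda>w. g (w\<^sup>2)) kE" by (rule kE)
    show "(\<lambda>w. g (w\<^sup>2)) ` quarter_edges = g ` wedge_rays 2 0"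
      by (simp add: wedge_rays_2 square_quarter_disc(2)[symmetric] image_image)
    have up: "g ` wedge 2 0 \<subseteq> {q. 0 \<le> snd q}"
    proof (rule image_subsetI)
      fix z assume "z \<in> wedge 2 0"
      then have "portrait_chart (g z) = z" "0 \<le> Im z" using cg by (auto simp: wedge_upper)
      then show "g z \<in> {q. 0 \<le> snd q}" using Im_portrait_chart(2)[of "fst (g z)" "snd (g z)"] by simp
    qed
    show "flows_to model (g ` wedge 2 0 - {(0, 0)}) v w \<longleftrightarrow>
        flows_to (\<lambda>_. 1) ((\<lambda>q. - inverse (portrait_chart q)) ` (g ` wedge 2 0 - {(0, 0)}))
          (- inverse (portrait_chart v)) (- inverse (portrait_chart w))"
      if "v \<in> g ` wedge 2 0 - {(0, 0)}" "w \<in> g ` wedge 2 0 - {(0, 0)}" for v w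
      by (rule upper_conj[OF _ that]) (use up in \<open>auto simp: zero_prod_def\<close>)
    show "norm (model_field Elliptic w) \<le> (norm w)\<^sup>2 * norm w" for w
      by (simp add: norm_power norm_mult power3_eq_cube power2_eq_square)
    show "- inverse (portrait_chart (g (w\<^sup>2))) = - inverse (w\<^sup>2)" if "w \<in> quarter_disc - {0}" for w
      using cg n2 that by simp
  qed (use g0 model_zero model_bound gb elliptic_model_chart in \<open>auto intro!: continuous_intros\<close>)
  have H: "is_sector model (0, 0) (g ` wedge 2 1) (g ` wedge_rays 2 1) Hyperbolic"
  proof (rule is_sector_by_chart[where H = "\<lambda>w. g (cnj (w\<^sup>2))" and Z = "\<lambda>q. cnj (portrait_chart q)"
        and M = "\<lambda>w. w\<^sup>2" and E = "\<lambda>_. 1" and g' = "\<lambda>w. 1"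
        and g = "\<lambda>q. \<bar>a\<bar> * \<bar>fst q\<bar> + \<bar>a + 1\<bar> + \<bar>fst q\<bar>"])
    show "homeomorphism quarter_disc (g ` wedge 2 1) (\<lambda>w. g (cnj (w\<^sup>2))) kH" by (rule kH)
    have "cnj ` {z. norm z \<le> 1 \<and> Im z = 0} = {z. norm z \<le> 1 \<and> Im z = 0}"
      by (auto intro!: image_eqI[of _ _ "cnj _"])
    moreover have "(\<lambda>w. g (cnj (w\<^sup>2))) ` quarter_edges = g ` cnj ` (\<lambda>w. w\<^sup>2) ` quarter_edges"
      by (simp only: image_image)
    ultimately show "(\<lambda>w. g (cnj (w\<^sup>2))) ` quarter_edges = g ` wedge_rays 2 1"
      by (simp only: square_quarter_disc(2) wedge_rays_2)
    have lo: "g ` wedge 2 1 \<subseteq> {q. snd q \<le> 0}"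
    proof (rule image_subsetI)
      fix z assume "z \<in> wedge 2 1"
      then have "portrait_chart (g z) = z" "Im z \<le> 0" using cg unfolding wedge_lower by auto
      then show "g z \<in> {q. snd q \<le> 0}" using Im_portrait_chart(1)[of "fst (g z)" "snd (g z)"] by simp
    qed
    show "flows_to model (g ` wedge 2 1 - {(0, 0)}) v w \<longleftrightarrow>
        flows_to (\<lambda>_. 1) ((\<lambda>q. cnj (portrait_chart q)) ` (g ` wedge 2 1 - {(0, 0)}))
          (cnj (portrait_chart v)) (cnj (portrait_chart w))"
      if "v \<in> g ` wedge 2 1 - {(0, 0)}" "w \<in> g ` wedge 2 1 - {(0, 0)}" for v w
      by (rule lower_conj[OF _ that]) (use lo in \<open>auto simp: zero_prod_def\<close>)
    show "cnj (portrait_chart (g (cnj (w\<^sup>2)))) = w\<^sup>2" if "w \<in> quarter_disc - {0}" for w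
    proof -
      have "norm (cnj (w\<^sup>2)) \<le> 1" using n2[of w] that by (simp only: complex_mod_cnj) simp
      then show ?thesis by (simp only: cg complex_cnj_cnj)
    qed
  qed (use g0 model_zero model_bound gb hyperbolic_model_chart in \<open>auto intro!: continuous_intros\<close>)
  have "sectorial_decomposition model (0, 0) V [Elliptic, Hyperbolic]"
    unfolding sectorial_decomposition_def
  proof (intro conjI exI allI impI)
    show "homeomorphism (cball 0 1) V g portrait_chart" by (rule hom)
    show "is_sector model (0, 0) (g ` wedge (length [Elliptic, Hyperbolic]) i)
          (g ` wedge_rays (length [Elliptic, Hyperbolic]) i) ([Elliptic, Hyperbolic] ! i)"
      if "i < length [Elliptic, Hyperbolic]" for i
    proof -
      have len: "length [Elliptic, Hyperbolic] = 2" by simp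
      have "i = 0 \<or> i = 1" using that by auto
      then show ?thesis unfolding len using E H by auto
    qed
    show "(0, 0) \<in> interior V"
    proof (rule interiorI)
      show "open (portrait_chart -` ball 0 1)"
        by (rule open_vimage[OF open_ball continuous_on_portrait_chart])
    qed (use p0 V in auto)
  qed (use model_zero g0 in auto)
  moreover have "compact V"
    unfolding V_def by (rule compact_continuous_image[OF contg compact_cball])
  ultimately show ?thesis by blast
qed

text \<open>The dilations \<open>(x, y) \<mapsto> (x / r, y / r\<^sup>2)\<close> carry the model to a positive multiple of itself, and pulling back along
  them shrinks a compact neighbourhood.\<close>
lemma model_local_phase_portrait: "local_phase_portrait model (0, 0) 1 1"
  unfolding local_phase_portrait_def
proof (intro allI impI)
  fix \<epsilon> :: real assume \<epsilon>: "0 < \<epsilon>"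
  obtain V where V: "compact V" "sectorial_decomposition model (0, 0) V [Elliptic, Hyperbolic]"
    using model_sectorial_decomposition by blast
  obtain M where M: "0 < M" "\<And>q. q \<in> V \<Longrightarrow> norm q \<le> M"
    using compact_imp_bounded[OF V(1)] by (auto simp: bounded_pos)
  define r where "r = min 1 (\<epsilon> / (3 * M))"
  have r: "0 < r" "r \<le> 1" "r * (2 * M) < \<epsilon>"
  proof -
    have "r * (2 * M) \<le> \<epsilon> / (3 * M) * (2 * M)" unfolding r_def using M by (intro mult_right_mono) auto
    also have "\<dots> < \<epsilon>" using M \<epsilon> by simp
    finally show "r * (2 * M) < \<epsilon>" .
  qed (use \<epsilon> M in \<open>auto simp: r_def\<close>)
  define s where "s = 1 / r"
  have s: "s \<noteq> 0" "r * s = 1" using r by (auto simp: s_def)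
  let ?\<Psi> = "\<lambda>q :: real \<times> real. (s * fst q, s\<^sup>2 * snd q)"
  have "\<exists>\<Psi>'. orbit_equivalence model UNIV model (range ?\<Psi>) ?\<Psi> \<Psi>'"
  proof (rule orbit_equivalenceI[where D = "\<lambda>_ h. (s * fst h, s\<^sup>2 * snd h)" and \<mu> = "\<lambda>_. r"])
    show "(?\<Psi> has_derivative (\<lambda>h. (s * fst h, s\<^sup>2 * snd h))) (at q)" for q
      using r by (auto intro!: derivative_eq_intros)
    show "(s * fst (model q), s\<^sup>2 * snd (model q)) = r *\<^sub>R model (?\<Psi> q)" for q
    proof -
      obtain x y where q: "q = (x, y)" by fastforce
      have "s * (- a * x\<^sup>2 + (a + 1) * y) = (r * s) * (s * (- a * x\<^sup>2 + (a + 1) * y))"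
        "s\<^sup>2 * (- x * y) = (r * s) * (s\<^sup>2 * (- x * y))"
        unfolding s(2) by simp_all
      then show ?thesis by (simp add: q qh_field_def algebra_simps power2_eq_square)
    qed
    show "v = 0" if "(s * fst v, s\<^sup>2 * snd v) = 0" for v :: "real \<times> real"
      using that s by (simp add: prod_eq_iff)
  qed (use r s in \<open>auto simp: inj_on_def prod_eq_iff\<close>)
  then obtain \<Psi>' where \<Psi>': "orbit_equivalence model UNIV model (range ?\<Psi>) ?\<Psi> \<Psi>'" by blast
  have inv: "\<Psi>' (?\<Psi> q) = q" for q
    using \<Psi>' by (auto simp: orbit_equivalence_def homeomorphism_def)
  have \<Psi>'_eq: "\<Psi>' q = (r * fst q, r\<^sup>2 * snd q)" for q
    using inv[of "(r * fst q, r\<^sup>2 * snd q)"] r by (simp add: s_def power_divide)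
  have sub: "\<Psi>' ` V \<subseteq> ball (0, 0) \<epsilon>"
  proof (rule image_subsetI)
    fix q assume q: "q \<in> V"
    have "norm (\<Psi>' q) \<le> norm (r * fst q) + norm (r\<^sup>2 * snd q)"
      unfolding \<Psi>'_eq by (rule norm_Pair_le)
    also have "\<dots> = r * \<bar>fst q\<bar> + r * (r * \<bar>snd q\<bar>)"
      using r by (simp add: abs_mult power2_eq_square)
    also have "\<dots> \<le> r * M + r * (1 * M)"
      using r M(2)[OF q] norm_fst_le[of "fst q" "snd q"] norm_snd_le[of "snd q" "fst q"]
      by (intro add_mono mult_left_mono mult_mono) auto
    also have "\<dots> < \<epsilon>" using r(3) by (simp add: mult_ac)
    finally show "\<Psi>' q \<in> ball (0, 0) \<epsilon>" by (simp add: zero_prod_def[symmetric])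
  qed
  have "V \<subseteq> range ?\<Psi>"
  proof
    fix q assume "q \<in> V"
    have "q = ?\<Psi> (\<Psi>' q)" using r by (simp add: \<Psi>'_eq s_def power_divide)
    then show "q \<in> range ?\<Psi>" by blast
  qed
  then have "sectorial_decomposition model (0, 0) (\<Psi>' ` V) [Elliptic, Hyperbolic]"
    using sectorial_decomposition_pullback[OF \<Psi>', of "(0, 0)" V] V(2) by simp
  then show "\<exists>V ks. V \<subseteq> ball (0, 0) \<epsilon> \<and> sectorial_decomposition model (0, 0) V ks \<and>
      count_list ks Hyperbolic = 1 \<and> count_list ks Elliptic = 1"
    using sub by (intro exI[of _ "\<Psi>' ` V"] exI[of _ "[Elliptic, Hyperbolic]"]) simp
qed

end

lemma qh_field_portrait_half:
  assumes "1 / 2 \<le> a" "k \<noteq> 0"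
  shows "local_phase_portrait (qh_field a k) (0, 0) 1 1"
proof -
  interpret quasi_homogeneous_model a by unfold_locales (rule assms(1))
  define c where "c = k / (a + 1)"
  have c: "c \<noteq> 0" "(a + 1) * c = k" using assms by (auto simp: c_def)
  show ?thesis
  proof (rule local_phase_portrait_conj[where U = UNIV and \<Psi> = "\<lambda>q. (fst q, c * snd q)"
        and D = "\<lambda>_ h. (fst h, c * snd h)" and \<mu> = "\<lambda>_. 1" and Y = model])
    show "((\<lambda>q. (fst q, c * snd q)) has_derivative (\<lambda>h. (fst h, c * snd h))) (at q)" for q
      by (auto intro!: derivative_eq_intros)
    show "(fst (qh_field a k q), c * snd (qh_field a k q)) = 1 *\<^sub>R model (fst q, c * snd q)" for q
    proof -
      have "k * snd q = (a + 1) * (c * snd q)" using c(2) by (simp only: mult.assoc[symmetric])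
      then show ?thesis by (cases q) (simp add: qh_field_def)
    qed
    show "local_phase_portrait model (fst (0, 0), c * snd (0, 0)) 1 1"
      using model_local_phase_portrait by simp
  qed (use c in \<open>auto simp: inj_on_def prod_eq_iff\<close>)
qed

text \<open>For \<open>a < 1/2\<close> the substitution \<open>y + b x\<^sup>2\<close> with \<open>2 k b = 1 - 2 a\<close> gives \<open>2 a\<close> times the field with
  parameters \<open>1 / (4 a) > 1/2\<close> and \<open>k / (2 a)\<close>: the invariant parabola \<open>y = - b x\<^sup>2\<close> becomes the axis.\<close>
lemma qh_field_portrait:
  assumes "0 < a" "k \<noteq> 0"
  shows "local_phase_portrait (qh_field a k) (0, 0) 1 1"
proof (cases "1 / 2 \<le> a")
  case True
  then show ?thesis using qh_field_portrait_half assms by blast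
next
  case False
  define b where "b = (1 - 2 * a) / (2 * k)"
  have bk: "2 * k * b = 1 - 2 * a" using assms by (simp add: b_def)
  let ?Y = "qh_field (1 / (4 * a)) (k / (2 * a))"
  let ?\<Psi> = "\<lambda>q. (fst q, snd q + b * (fst q)\<^sup>2)"
  show ?thesis
  proof (rule local_phase_portrait_conj[where U = UNIV and \<Psi> = ?\<Psi>
        and D = "\<lambda>q h. (fst h, snd h + 2 * b * fst q * fst h)" and \<mu> = "\<lambda>_. 2 * a" and Y = ?Y])
    show "(?\<Psi> has_derivative (\<lambda>h. (fst h, snd h + 2 * b * fst q * fst h))) (at q)" for q
      by (auto intro!: derivative_eq_intros)
    show "(fst (qh_field a k q), snd (qh_field a k q) + 2 * b * fst q * fst (qh_field a k q))
        = (2 * a) *\<^sub>R ?Y (?\<Psi> q)" for q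
    proof -
      obtain x y where q: "q = (x, y)" by fastforce
      have 1: "- a * x\<^sup>2 + k * y = 2 * a * (- (1 / (4 * a)) * x\<^sup>2 + k / (2 * a) * (y + b * x\<^sup>2))"
      proof -
        have c: "2 * a * (1 / (4 * a)) = 1 / 2" "2 * a * (k / (2 * a)) = k" using assms by simp_all
        have "2 * a * (- (1 / (4 * a)) * x\<^sup>2 + k / (2 * a) * (y + b * x\<^sup>2))
            = - (2 * a * (1 / (4 * a))) * x\<^sup>2 + 2 * a * (k / (2 * a)) * (y + b * x\<^sup>2)"
          by algebra
        also have "\<dots> = - (1 / 2) * x\<^sup>2 + k * y + (2 * k * b) / 2 * x\<^sup>2"
          unfolding c by algebra
        also have "\<dots> = - a * x\<^sup>2 + k * y" unfolding bk by (simp add: field_simps)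
        finally show ?thesis by simp
      qed
      have "- x * y + 2 * b * x * (- a * x\<^sup>2 + k * y) = - x * y + (2 * k * b) * x * y - 2 * a * b * x * x\<^sup>2"
        by (simp add: algebra_simps)
      then have 2: "- x * y + 2 * b * x * (- a * x\<^sup>2 + k * y) = 2 * a * (- x * (y + b * x\<^sup>2))"
        unfolding bk by (simp add: algebra_simps)
      show ?thesis using 1 2 by (simp add: q qh_field_def)
    qed
    have "1 / 2 \<le> 1 / (4 * a)" using False assms by (simp add: field_simps)
    then show "local_phase_portrait ?Y (?\<Psi> (0, 0)) 1 1"
      using qh_field_portrait_half[of "1 / (4 * a)" "k / (2 * a)"] assms by simp
  qed (use assms in \<open>auto simp: inj_on_def prod_eq_iff\<close>)
qed

section \<open>Removing the higher-order terms of the profile\<close>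

text \<open>For \<open>b > 0\<close> the integral from 0 works.  For \<open>b < 0\<close> that integral may diverge, but \<open>t\<^sup>b\<close> tends to infinity,
  so every antiderivative does.  In both cases the limit is l'Hopital's rule with the quotient of
  derivatives \<open>t r(t) / b\<close>.\<close>
lemma small_antiderivative:
  fixes r :: "real \<Rightarrow> real"
  assumes \<delta>: "0 < \<delta>" and r: "continuous_on {0..\<delta>} r" and b: "b \<noteq> 0"
  shows "\<exists>W. (\<forall>t\<in>{0<..<\<delta>}. (W has_real_derivative t powr b * r t) (at t)) \<and>
           ((\<lambda>t. W t / t powr b) \<longlongrightarrow> 0) (at_right 0)"
proof -
  have ev: "\<forall>\<^sub>F t in at_right 0. t \<in> {0<..<\<delta>}"
    using eventually_at_right_real[OF \<delta>] .
  have r0: "(r \<longlongrightarrow> r 0) (at_right 0)"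
  proof -
    have "(r \<longlongrightarrow> r 0) (at 0 within {0..\<delta>})"
      using r \<delta> by (simp add: continuous_on_def)
    then show ?thesis using \<delta> by (simp add: at_within_Icc_at_right)
  qed
  have ratio: "((\<lambda>t. (t powr b * r t) / (b * t powr (b - 1))) \<longlongrightarrow> 0) (at_right 0)"
  proof -
    have "((\<lambda>t. t * r t / b) \<longlongrightarrow> 0 * r 0 / b) (at_right 0)"
      by (intro tendsto_intros r0 b)
    moreover have "\<forall>\<^sub>F t in at_right 0. t * r t / b = (t powr b * r t) / (b * t powr (b - 1))"
      using ev by eventually_elim (simp add: powr_diff field_simps)
    ultimately show ?thesis by (simp add: filterlim_cong)
  qed
  have gder: "\<forall>\<^sub>F t in at_right 0. ((\<lambda>t. t powr b) has_real_derivative b * t powr (b - 1)) (at t)"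
    using ev by eventually_elim (auto intro: has_real_derivative_powr)
  have gnz: "\<forall>\<^sub>F t in at_right 0. b * t powr (b - 1) \<noteq> 0" "\<forall>\<^sub>F t in at_right 0. t powr b \<noteq> 0"
    using ev by (eventually_elim, use b in auto)+
  show ?thesis
  proof (cases "0 < b")
    case True
    define f where "f t = t powr b * r t" for t
    have cf: "continuous_on {0..\<delta>} f"
      unfolding f_def using True by (intro continuous_intros continuous_on_powr' r) auto
    define W where "W t = integral {0..t} f" for t
    have W: "(W has_real_derivative f t) (at t)" if t: "t \<in> {0<..<\<delta>}" for t
    proof -
      have "(W has_vector_derivative f t) (at t within {0..\<delta>})"
        unfolding W_def by (rule integral_has_vector_derivative[OF cf]) (use t in auto)
      moreover have "at t within {0..\<delta>} = at t" by (rule at_within_interior) (use t in auto)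
      ultimately show ?thesis by (simp add: has_real_derivative_iff_has_vector_derivative)
    qed
    have "continuous_on {0..\<delta>} W"
      unfolding W_def using cf by (intro indefinite_integral_continuous_1 integrable_continuous_real)
    then have "(W \<longlongrightarrow> W 0) (at 0 within {0..\<delta>})" using \<delta> by (simp add: continuous_on_def)
    then have "(W \<longlongrightarrow> 0) (at_right 0)" using \<delta> by (simp add: at_within_Icc_at_right W_def)
    moreover have "((\<lambda>t. t powr b) \<longlongrightarrow> 0) (at_right 0)" by (rule powr_at_right_0_0[OF True])
    moreover have "\<forall>\<^sub>F t in at_right 0. (W has_real_derivative t powr b * r t) (at t)"
      using ev by eventually_elim (use W in \<open>auto simp: f_def\<close>)
    ultimately have "((\<lambda>t. W t / t powr b) \<longlongrightarrow> 0) (at_right 0)"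
      using gnz gder ratio by (intro lhopital_right_0[of W "\<lambda>t. t powr b"]) auto
    then show ?thesis using W unfolding f_def by (intro exI[of _ W] conjI ballI)
  next
    case False
    have "\<exists>W. \<forall>t. ereal 0 < ereal t \<longrightarrow> ereal t < ereal \<delta> \<longrightarrow> (W has_vector_derivative t powr b * r t) (at t)"
    proof (rule einterval_antiderivative)
      fix t assume "ereal 0 < ereal t" "ereal t < ereal \<delta>"
      then have t: "t \<in> {0<..<\<delta>}" by auto
      have "continuous_on {0<..<\<delta>} (\<lambda>t. t powr b * r t)"
        by (intro continuous_intros continuous_on_subset[OF r]) auto
      then show "isCont (\<lambda>t. t powr b * r t) t" using t by (simp add: continuous_on_eq_continuous_at)
    qed (use \<delta> in simp)
    then obtain W where W: "\<And>t. t \<in> {0<..<\<delta>} \<Longrightarrow> (W has_real_derivative t powr b * r t) (at t)"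
      by (auto simp: has_real_derivative_iff_has_vector_derivative)
    have "filterlim (\<lambda>t. t powr b) at_top (at_right 0)" using False b by (intro powr_at_right_0_at_top) auto
    moreover have "\<forall>\<^sub>F t in at_right 0. (W has_real_derivative t powr b * r t) (at t)"
      using ev by eventually_elim (use W in auto)
    ultimately have "((\<lambda>t. W t / t powr b) \<longlongrightarrow> 0) (at_right 0)"
      using gnz gder ratio by (intro lhopital_right_0_at_top[of "\<lambda>t. t powr b"]) auto
    then show ?thesis using W by (intro exI[of _ W] conjI ballI)
  qed
qed

text \<open>With \<open>Y = t q\<close> the equation is \<open>Y' = (1 + t r) (Y / t)\<^bsup>2a\<^esup>\<close>, so \<open>(Y\<^sup>b)' = b (t\<^bsup>b-1\<^esup> + t\<^sup>b r)\<close>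
  for \<open>b = 1 - 2 a \<noteq> 0\<close>; the solution is \<open>Y\<^sup>b = t\<^sup>b + b W\<close> with the antiderivative \<open>W\<close> of
  \<open>small_antiderivative\<close>, which is what makes \<open>q\<close> tend to 1.  For \<open>b = 0\<close> the equation is linear and
  \<open>q\<close> is the exponential of the integral of \<open>r\<close>.\<close>
lemma linearising_profile:
  fixes r :: "real \<Rightarrow> real"
  assumes \<delta>: "0 < \<delta>" and r: "continuous_on {0..\<delta>} r" and ab: "b = 1 - 2 * a"
  shows "\<exists>d q. 0 < d \<and> d \<le> \<delta> \<and> (q \<longlongrightarrow> 1) (at_right 0) \<and>
     (\<forall>t\<in>{0<..<d}. 0 < q t \<and>
        ((\<lambda>t. t * q t) has_real_derivative (1 + t * r t) * q t powr (2 * a)) (at t))"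
proof (cases "b = 0")
  case True
  define R where "R t = integral {0..t} r" for t
  have R: "(R has_real_derivative r t) (at t)" if t: "t \<in> {0<..<\<delta>}" for t
  proof -
    have "(R has_vector_derivative r t) (at t within {0..\<delta>})"
      unfolding R_def by (rule integral_has_vector_derivative[OF r]) (use t in auto)
    moreover have "at t within {0..\<delta>} = at t" by (rule at_within_interior) (use t in auto)
    ultimately show ?thesis by (simp add: has_real_derivative_iff_has_vector_derivative)
  qed
  have "continuous_on {0..\<delta>} R"
    unfolding R_def using r by (intro indefinite_integral_continuous_1 integrable_continuous_real)
  then have "(R \<longlongrightarrow> R 0) (at 0 within {0..\<delta>})" using \<delta> by (simp add: continuous_on_def)
  then have "(R \<longlongrightarrow> 0) (at_right 0)" using \<delta> by (simp add: at_within_Icc_at_right R_def)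
  then have lim: "((\<lambda>t. exp (R t)) \<longlongrightarrow> exp 0) (at_right 0)" by (intro tendsto_intros)
  have "((\<lambda>t. t * exp (R t)) has_real_derivative (1 + t * r t) * exp (R t) powr (2 * a)) (at t)"
    if "t \<in> {0<..<\<delta>}" for t
  proof -
    have "2 * a = 1" using True ab by simp
    then show ?thesis
      by (auto intro!: derivative_eq_intros R[OF that] simp: algebra_simps)
  qed
  then show ?thesis
    using lim \<delta> by (intro exI[of _ \<delta>] exI[of _ "\<lambda>t. exp (R t)"]) auto
next
  case False
  obtain W where W: "\<And>t. t \<in> {0<..<\<delta>} \<Longrightarrow> (W has_real_derivative t powr b * r t) (at t)"
    and W0: "((\<lambda>t. W t / t powr b) \<longlongrightarrow> 0) (at_right 0)"
    using small_antiderivative[OF \<delta> r False] by blast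
  \<comment> \<open>\<open>I\<close> is \<open>Y\<^sup>b\<close>, and \<open>Q\<close> is \<open>q\<^sup>b\<close>\<close>
  define Q where "Q t = 1 + b * (W t / t powr b)" for t
  have Q: "(Q \<longlongrightarrow> 1) (at_right 0)"
    unfolding Q_def using tendsto_add[OF tendsto_const tendsto_mult[OF tendsto_const W0], of 1 b] by simp
  then have "\<forall>\<^sub>F t in at_right 0. 0 < Q t" by (rule order_tendstoD) simp
  then obtain d0 where d0: "0 < d0" "\<And>t. 0 < t \<Longrightarrow> t < d0 \<Longrightarrow> 0 < Q t"
    by (auto simp: eventually_at_right_field)
  define d where "d = min d0 \<delta>"
  define I where "I t = t powr b + b * W t" for t
  have I: "I t = t powr b * Q t" if "0 < t" for t
    using that by (simp add: I_def Q_def field_simps)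
  have Y: "t * Q t powr (1 / b) = I t powr (1 / b)" if "t \<in> {0<..<d}" for t
  proof -
    have "0 < t" "0 < Q t" using that d0 by (auto simp: d_def)
    then show ?thesis using False by (simp add: I powr_mult powr_powr)
  qed
  have D: "((\<lambda>t. t * Q t powr (1 / b)) has_real_derivative (1 + t * r t) * (Q t powr (1 / b)) powr (2 * a)) (at t)"
    if t: "t \<in> {0<..<d}" for t
  proof -
    have tp: "0 < t" "0 < Q t" "t \<in> {0<..<\<delta>}" using t d0 by (auto simp: d_def)
    have Ip: "0 < I t" using tp by (simp add: I)
    have "(I has_real_derivative b * t powr (b - 1) + b * (t powr b * r t)) (at t)"
      unfolding I_def[abs_def] using tp(1)
      by (intro DERIV_add DERIV_cmult W tp(3) has_real_derivative_powr)
    then have "((\<lambda>t. I t powr (1 / b)) has_real_derivative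
        1 / b * I t powr (1 / b - 1) * (b * t powr (b - 1) + b * (t powr b * r t))) (at t)"
      using DERIV_chain2[where f = "\<lambda>z. z powr (1 / b)" and g = I, OF has_real_derivative_powr[OF Ip, of "1 / b"]] by blast
    moreover have "1 / b * I t powr (1 / b - 1) * (b * t powr (b - 1) + b * (t powr b * r t))
        = (1 + t * r t) * (Q t powr (1 / b)) powr (2 * a)"
    proof -
      have h1: "I t powr (1 / b - 1) = t powr (1 - b) * Q t powr (1 / b - 1)"
        using tp False by (simp add: I powr_mult powr_powr algebra_simps)
      have h2: "t powr b = t * t powr (b - 1)" and h3: "t powr (1 - b) * t powr (b - 1) = 1"
        using tp by (simp_all add: powr_diff powr_add[symmetric])
      have "1 / b * (2 * a) = 1 / b - 1" using False ab by (simp add: field_simps)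
      then have h4: "(Q t powr (1 / b)) powr (2 * a) = Q t powr (1 / b - 1)" by (simp only: powr_powr)
      have "1 / b * (A * B) * (b * P + b * (t * P * r t)) = (A * P) * ((1 + t * r t) * B)" for A B P
        using False by (simp add: field_simps)
      from this[of "t powr (1 - b)" "Q t powr (1 / b - 1)" "t powr (b - 1)"]
      show ?thesis unfolding h1 h2 h3 h4 by simp
    qed
    ultimately have "((\<lambda>t. I t powr (1 / b)) has_real_derivative
        (1 + t * r t) * (Q t powr (1 / b)) powr (2 * a)) (at t)" by simp
    then show ?thesis
      by (rule has_field_derivative_transform_within_open[where S = "{0<..<d}"]) (use t Y in auto)
  qed
  have "((\<lambda>t. Q t powr (1 / b)) \<longlongrightarrow> 1 powr (1 / b)) (at_right 0)"
    by (intro tendsto_intros Q) auto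
  then show ?thesis
  proof (intro exI[of _ d] exI[of _ "\<lambda>t. Q t powr (1 / b)"] conjI ballI)
    show "0 < Q t powr (1 / b)" if "t \<in> {0<..<d}" for t
      using d0(2)[of t] that by (simp add: d_def)
  qed (use D d0(1) \<delta> in \<open>simp_all add: d_def\<close>)
qed

text \<open>On the negative side the equation is that of \<open>- r (- t)\<close>.  Differentiability at 0
  is not claimed; the axis \<open>y = 0\<close> will be treated separately.\<close>
lemma linearising_coordinate:
  fixes r :: "real \<Rightarrow> real"
  assumes \<delta>: "0 < \<delta>" and r: "continuous_on {-\<delta>..\<delta>} r"
  shows "\<exists>d q. 0 < d \<and> d \<le> \<delta> \<and> continuous_on {-d<..<d} q \<and> q 0 = 1 \<and>
     (\<forall>y\<in>{-d<..<d}. 0 < q y) \<and>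
     (\<forall>y\<in>{-d<..<d} - {0}. ((\<lambda>y. y * q y) has_real_derivative (1 + y * r y) * q y powr (2 * a)) (at y))"
proof -
  obtain d1 q1 where q1: "0 < d1" "d1 \<le> \<delta>" "(q1 \<longlongrightarrow> 1) (at_right 0)"
    "\<And>t. t \<in> {0<..<d1} \<Longrightarrow> 0 < q1 t"
    "\<And>t. t \<in> {0<..<d1} \<Longrightarrow> ((\<lambda>t. t * q1 t) has_real_derivative (1 + t * r t) * q1 t powr (2 * a)) (at t)"
    using linearising_profile[OF \<delta> continuous_on_subset[OF r] refl, of a] by auto
  have "continuous_on {0..\<delta>} (\<lambda>t. - r (- t))"
    by (intro continuous_intros continuous_on_compose2[OF r]) auto
  then obtain d2 q2 where q2: "0 < d2" "d2 \<le> \<delta>" "(q2 \<longlongrightarrow> 1) (at_right 0)"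
    "\<And>t. t \<in> {0<..<d2} \<Longrightarrow> 0 < q2 t"
    "\<And>t. t \<in> {0<..<d2} \<Longrightarrow> ((\<lambda>t. t * q2 t) has_real_derivative (1 + t * - r (- t)) * q2 t powr (2 * a)) (at t)"
    using linearising_profile[OF \<delta> _ refl, of "\<lambda>t. - r (- t)" a] by auto
  define d where "d = min d1 d2"
  define q where "q y = (if 0 < y then q1 y else if y = 0 then 1 else q2 (- y))" for y
  have pos: "0 < q y" if "y \<in> {-d<..<d}" for y
    using that q1(4) q2(4) by (auto simp: q_def d_def)
  have D: "((\<lambda>y. y * q y) has_real_derivative (1 + y * r y) * q y powr (2 * a)) (at y)"
    if y: "y \<in> {-d<..<d} - {0}" for y
  proof (cases "0 < y")
    case True
    then have "((\<lambda>t. t * q1 t) has_real_derivative (1 + y * r y) * q y powr (2 * a)) (at y)"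
      using q1(5)[of y] y by (simp add: q_def d_def)
    then show ?thesis
      by (rule has_field_derivative_transform_within_open[where S = "{0<..}"]) (use True in \<open>auto simp: q_def\<close>)
  next
    case False
    then have yn: "y < 0" "- y \<in> {0<..<d2}" using y by (auto simp: d_def)
    have "((\<lambda>y. - (- y * q2 (- y))) has_real_derivative
        - ((1 + - y * - r (- (- y))) * q2 (- y) powr (2 * a) * - 1)) (at y)"
      by (rule DERIV_minus, rule DERIV_chain2[where g = uminus, OF q2(5)[OF yn(2)]]) (auto intro!: derivative_eq_intros)
    then have "((\<lambda>y. y * q2 (- y)) has_real_derivative (1 + y * r y) * q y powr (2 * a)) (at y)"
      using yn by (simp add: q_def)
    then show ?thesis
      by (rule has_field_derivative_transform_within_open[where S = "{..<0}"]) (use yn in \<open>auto simp: q_def\<close>)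
  qed
  have "isCont q y" if y: "y \<in> {-d<..<d}" for y
  proof (cases "y = 0")
    case True
    have "(q \<longlongrightarrow> 1) (at_right 0)"
      by (rule tendsto_cong[THEN iffD1, OF _ q1(3)]) (auto simp: q_def eventually_at_filter)
    moreover have "((\<lambda>y. q2 (- y)) \<longlongrightarrow> 1) (at_left 0)"
      using q2(3) by (simp add: filterlim_at_left_to_right)
    then have "(q \<longlongrightarrow> 1) (at_left 0)"
      by (rule tendsto_cong[THEN iffD1, rotated]) (auto simp: q_def eventually_at_filter)
    ultimately show ?thesis using True by (simp add: isCont_def filterlim_at_split q_def)
  next
    case False
    have "isCont (\<lambda>z. z * q z) y" using DERIV_isCont[OF D] y False by blast
    then have "isCont (\<lambda>z. (z * q z) / z) y"
      by (rule isCont_divide) (use False in auto)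
    moreover have "\<forall>\<^sub>F z in nhds y. (z * q z) / z = q z"
    proof -
      have "\<forall>\<^sub>F z in nhds y. z \<in> - {0}" by (rule eventually_nhds_in_open) (use False in auto)
      then show ?thesis by eventually_elim simp
    qed
    ultimately show ?thesis by (simp add: isCont_cong)
  qed
  then have "continuous_on {-d<..<d} q" by (auto intro: continuous_at_imp_continuous_on)
  then show ?thesis
    using pos D q1(1,2) q2(1,2) by (intro exI[of _ d] exI[of _ q]) (auto simp: d_def q_def)
qed

lemma analytic_remainder:
  assumes "real_analytic_at \<psi> 0" "\<psi> 0 = 0" "deriv \<psi> 0 \<noteq> 0"
  shows "\<exists>\<delta> r. 0 < \<delta> \<and> continuous_on {-\<delta>..\<delta>} r \<and>
     (\<forall>y\<in>{-\<delta>..\<delta>}. \<psi> y = deriv \<psi> 0 * y * (1 + y * r y))"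
proof -
  obtain c R where R: "0 < R" "\<And>h. \<bar>h\<bar> < R \<Longrightarrow> (\<lambda>n. c n * h ^ n) sums \<psi> h"
    using assms(1) unfolding real_analytic_at_def by auto
  have sm: "summable (\<lambda>n. c n * h ^ n)" if "\<bar>h\<bar> < R" for h using R(2)[OF that] sums_summable by blast
  have c0: "c 0 = 0" using powser_sums_zero_iff[of c "\<psi> 0"] R(2)[of 0] R(1) assms(2) by simp
  have der: "(\<psi> has_real_derivative c 1) (at 0)"
  proof -
    have "((\<lambda>x. \<Sum>n. c n * x ^ n) has_real_derivative (\<Sum>n. diffs c n * 0 ^ n)) (at 0)"
      by (rule termdiffs_strong[of _ "R / 2"]) (use R(1) sm[of "R / 2"] in auto)
    moreover have "(\<Sum>n. diffs c n * 0 ^ n) = c 1" by (simp add: diffs_def)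
    ultimately have "((\<lambda>x. \<Sum>n. c n * x ^ n) has_real_derivative c 1) (at 0)" by simp
    then show ?thesis
      by (rule has_field_derivative_transform_within_open[where S = "{-R<..<R}"])
        (use R in \<open>auto simp: sums_iff abs_less_iff\<close>)
  qed
  then have k: "deriv \<psi> 0 = c 1" by (rule DERIV_imp_deriv)
  define r where "r y = (\<Sum>n. c (n + 2) / c 1 * y ^ n)" for y
  have sum2: "(\<lambda>n. c (n + 2) * y ^ n * y\<^sup>2) sums (\<psi> y - c 1 * y)" if "\<bar>y\<bar> < R" for y
    using sums_split_initial_segment[OF R(2)[OF that], of 2] c0
    by (simp add: numeral_2_eq_2 power_add mult_ac)
  have smr: "summable (\<lambda>n. c (n + 2) / c 1 * y ^ n)" if "\<bar>y\<bar> < R" "y \<noteq> 0" for y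
  proof -
    have "summable (\<lambda>n. c (n + 2) * y ^ n * y\<^sup>2 * (1 / (c 1 * y\<^sup>2)))"
      using sums_summable[OF sum2[OF that(1)]] by (rule summable_mult2)
    then show ?thesis using that by (simp add: field_simps)
  qed
  have eq: "\<psi> y = c 1 * y * (1 + y * r y)" if "\<bar>y\<bar> < R" for y
  proof (cases "y = 0")
    case False
    have "(\<lambda>n. c (n + 2) / c 1 * y ^ n) sums r y"
      using smr[OF that False] by (simp add: r_def summable_sums)
    from sums_mult[OF this, of "c 1 * y\<^sup>2"]
    have "(\<lambda>n. c (n + 2) * y ^ n * y\<^sup>2) sums (c 1 * y\<^sup>2 * r y)"
      using assms(3) k by (simp add: mult_ac)
    then have "\<psi> y - c 1 * y = c 1 * y\<^sup>2 * r y" using sum2[OF that] sums_unique2 by blast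
    then show ?thesis by (simp add: algebra_simps power2_eq_square)
  qed (use assms(2) in simp)
  have "isCont r y" if "\<bar>y\<bar> < R / 2" for y
    unfolding r_def by (rule isCont_powser[OF smr[of "R / 2"]]) (use R(1) that in auto)
  then have "continuous_on {- (R / 4)..R / 4} r"
    using R(1) by (intro continuous_at_imp_continuous_on ballI) (auto simp: abs_if)
  then show ?thesis
    unfolding k using R(1) eq by (intro exI[of _ "R / 4"] exI[of _ r]) (auto simp: abs_if)
qed

text \<open>With \<open>\<psi>(y) = k y (1 + y r(y))\<close> and \<open>q\<close> from \<open>linearising_coordinate\<close>, the map
  \<open>(x, y) \<mapsto> (x q(y)\<^sup>a, y q(y))\<close> carries the field to a positive multiple of \<open>qh_field a k\<close>.  The power \<open>a\<close> of \<open>q\<close> makes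
  the terms in \<open>x\<^sup>2\<close> and \<open>x y\<close> scale by the same factor, and the equation for \<open>q\<close> gives the term \<open>k y\<close> this factor too.  The map is smooth off the axis
  and the identity on it, where the two fields agree, so gluing gives the orbits.\<close>
lemma vfield_portrait:
  assumes m: "1 < m" and \<psi>: "real_analytic_at \<psi> 0" "\<psi> 0 = 0" "deriv \<psi> 0 \<noteq> 0"
  shows "local_phase_portrait (vfield m \<psi>) (0, 0) 1 1"
proof -
  define a where "a = (m - 1) / 2"
  define k where "k = deriv \<psi> 0"
  have a: "0 < a" "(1 - m) / 2 = - a" using m by (auto simp: a_def field_simps)
  obtain \<delta> r where \<delta>: "0 < \<delta>" "continuous_on {-\<delta>..\<delta>} r"
    and r: "\<And>y. y \<in> {-\<delta>..\<delta>} \<Longrightarrow> \<psi> y = k * y * (1 + y * r y)"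
    using analytic_remainder[OF \<psi>] by (auto simp: k_def)
  obtain d0 q where d0: "0 < d0" "d0 \<le> \<delta>" and q0: "q 0 = 1"
    and cq0: "continuous_on {-d0<..<d0} q"
    and qp0: "\<And>y. y \<in> {-d0<..<d0} \<Longrightarrow> 0 < q y"
    and Dq0: "\<And>y. y \<in> {-d0<..<d0} - {0} \<Longrightarrow>
      ((\<lambda>y. y * q y) has_real_derivative (1 + y * r y) * q y powr (2 * a)) (at y)"
    using linearising_coordinate[OF \<delta>, of a] by blast
  have "isCont (\<lambda>y. 1 + y * r y) 0"
  proof -
    have "isCont r 0"
      using continuous_on_interior[OF \<delta>(2), of 0] \<delta>(1) by simp
    then show ?thesis by (intro continuous_intros)
  qed
  then have "\<forall>\<^sub>F y in at 0. 0 < 1 + y * r y"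
    unfolding isCont_def by (rule order_tendstoD) simp
  then obtain d1 where d1: "0 < d1" "\<And>y. y \<noteq> 0 \<Longrightarrow> \<bar>y\<bar> < d1 \<Longrightarrow> 0 < 1 + y * r y"
    by (auto simp: eventually_at dist_real_def)
  define d where "d = min d0 d1"
  have d: "0 < d" using d0 d1 by (simp add: d_def)
  have cq: "continuous_on {-d<..<d} q"
    by (rule continuous_on_subset[OF cq0]) (auto simp: d_def)
  have qp: "0 < q y" if "y \<in> {-d<..<d}" for y using qp0[of y] that by (auto simp: d_def)
  \<comment> \<open>\<open>Y'\<close> is the derivative of \<open>y q(y)\<close>\<close>
  define u where "u y = 1 + y * r y" for y
  define Y' where "Y' y = u y * q y powr (2 * a)" for y
  have u: "0 < u y" "\<psi> y = k * y * u y" if "y \<in> {-d<..<d} - {0}" for y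
    using d1(2)[of y] r[of y] that d0 by (auto simp: u_def d_def)
  have DY: "((\<lambda>y. y * q y) has_real_derivative Y' y) (at y)" and Y'p: "0 < Y' y"
    if "y \<in> {-d<..<d} - {0}" for y
    using Dq0[of y] u(1)[OF that] qp[of y] that by (auto simp: u_def Y'_def d_def)
  let ?U = "{p::real \<times> real. snd p \<in> {-d<..<d}}"
  let ?\<Psi> = "\<lambda>p::real \<times> real. (fst p * q (snd p) powr a, snd p * q (snd p))"
  have Ueq: "?U = snd -` {-d<..<d}" by auto
  have opU: "open ?U"
    unfolding Ueq by (rule open_vimage) (auto intro!: continuous_intros)
  have cqs: "continuous_on ?U (\<lambda>p. q (snd p))"
    by (rule continuous_on_compose2[OF cq]) (auto intro!: continuous_intros)
  have cont: "continuous_on ?U ?\<Psi>"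
    by (intro continuous_on_Pair continuous_on_mult continuous_on_powr cqs continuous_on_fst continuous_on_snd
        continuous_on_id continuous_on_const) (use qp in force)
  have less: "y * q y < z * q z" if "y \<in> {-d<..<d}" "z \<in> {-d<..<d}" "y < z" "0 < y \<or> z < 0" for y z
  proof (rule DERIV_pos_imp_increasing[OF that(3)])
    fix v assume "y \<le> v" "v \<le> z"
    then have "v \<in> {-d<..<d} - {0}" using that by auto
    then show "\<exists>D. ((\<lambda>y. y * q y) has_real_derivative D) (at v) \<and> 0 < D" using DY Y'p by blast
  qed
  have sgnY: "0 < y * q y \<longleftrightarrow> 0 < y" "y * q y < 0 \<longleftrightarrow> y < 0" if "y \<in> {-d<..<d}" for y
    using qp[OF that] by (auto simp: zero_less_mult_iff mult_less_0_iff)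
  have injY: "y = z" if y: "y \<in> {-d<..<d}" and z: "z \<in> {-d<..<d}" and e: "y * q y = z * q z" for y z
  proof (rule ccontr)
    assume "y \<noteq> z"
    moreover have s: "0 < y \<longleftrightarrow> 0 < z" "y < 0 \<longleftrightarrow> z < 0" using sgnY[OF y] sgnY[OF z] e by auto
    ultimately show False
      using less[OF y z] less[OF z y] e by (cases "y < z"; cases "0 < y"; cases "y < 0") auto
  qed
  have inj: "inj_on ?\<Psi> ?U"
  proof (rule inj_onI)
    fix p p' assume p: "p \<in> ?U" "p' \<in> ?U" and e: "?\<Psi> p = ?\<Psi> p'"
    then have s: "snd p = snd p'" using injY[of "snd p" "snd p'"] by simp
    moreover have "q (snd p) powr a \<noteq> 0" using qp[of "snd p"] p by simp
    ultimately have "fst p = fst p'" using e by simp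
    then show "p = p'" using s by (simp add: prod_eq_iff)
  qed
  obtain \<Psi>' where \<Psi>': "homeomorphism ?U (?\<Psi> ` ?U) ?\<Psi> \<Psi>'"
    using invariance_of_domain_homeomorphism[OF opU cont order_refl inj] by blast
  have opW: "open (?\<Psi> ` ?U)" by (rule invariance_of_domain[OF cont opU inj])
  have U0: "?U \<inter> {p. snd p \<noteq> 0} = snd -` ({-d<..<d} - {0})" by auto
  have opU0: "open (?U \<inter> {p. snd p \<noteq> 0})"
    unfolding U0 by (rule open_vimage) (auto intro!: continuous_intros)
  have fl: "flows_to (vfield m \<psi>) S v w \<longleftrightarrow> flows_to (qh_field a k) (?\<Psi> ` S) (?\<Psi> v) (?\<Psi> w)"
    if S: "S \<subseteq> ?U" and vw: "v \<in> S" "w \<in> S" for S v w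
  proof (rule flows_to_glue[where f = snd and f' = snd])
    show "invariant_zero_set (vfield m \<psi>) S snd" "invariant_zero_set (qh_field a k) (?\<Psi> ` S) snd"
      by (rule invariant_axis; simp add: vfield_def qh_field_def case_prod_beta)+
    show "snd (?\<Psi> p) = 0 \<longleftrightarrow> snd p = 0" if "p \<in> S" for p
      using qp[of "snd p"] S that by auto
    show "flows_to (vfield m \<psi>) {p \<in> S. snd p = 0} v w \<longleftrightarrow>
        flows_to (qh_field a k) (?\<Psi> ` {p \<in> S. snd p = 0}) (?\<Psi> v) (?\<Psi> w)"
      if "v \<in> {p \<in> S. snd p = 0}" "w \<in> {p \<in> S. snd p = 0}" for v w
    proof -
      have id: "?\<Psi> p = p" if "p \<in> {p \<in> S. snd p = 0}" for p
        using that by (simp add: q0 prod_eq_iff)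
      then have im: "?\<Psi> ` {p \<in> S. snd p = 0} = {p \<in> S. snd p = 0}" by force
      have eq: "vfield m \<psi> p = qh_field a k p" if "p \<in> {p \<in> S. snd p = 0}" for p
        using that a \<psi>(2) by (simp add: vfield_def Phi_def qh_field_def case_prod_beta)
      show ?thesis
        unfolding im id[OF that(1)] id[OF that(2)] by (rule flows_to_cong) (rule eq)
    qed
    show "flows_to (vfield m \<psi>) {p \<in> S. snd p \<noteq> 0} v w \<longleftrightarrow>
        flows_to (qh_field a k) (?\<Psi> ` {p \<in> S. snd p \<noteq> 0}) (?\<Psi> v) (?\<Psi> w)"
      if "v \<in> {p \<in> S. snd p \<noteq> 0}" "w \<in> {p \<in> S. snd p \<noteq> 0}" for v w
    proof (rule flows_to_chart[where h = ?\<Psi> and U = "?U \<inter> {p. snd p \<noteq> 0}" and \<Psi> = ?\<Psi>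
          and D = "\<lambda>p h. (fst h * q (snd p) powr a
             + fst p * (a * q (snd p) powr (a - 1) * ((Y' (snd p) - q (snd p)) / snd p)) * snd h, Y' (snd p) * snd h)"
          and \<mu> = "\<lambda>p. Y' (snd p) * q (snd p) powr (- 1 - a)"])
      show "continuous_on (?U \<inter> {p. snd p \<noteq> 0}) ?\<Psi>" by (rule continuous_on_subset[OF cont]) auto
      show "inj_on ?\<Psi> (?U \<inter> {p. snd p \<noteq> 0})" by (rule inj_on_subset[OF inj]) auto
      show "{p \<in> S. snd p \<noteq> 0} \<subseteq> ?U \<inter> {p. snd p \<noteq> 0}" using S by auto
      fix p assume "p \<in> {p \<in> S. snd p \<noteq> 0}"
      then obtain x y where p: "p = (x, y)" and y: "y \<in> {-d<..<d} - {0}"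
        using S by (cases p) auto
      have qy: "0 < q y" using qp y by blast
      have Dq: "(q has_real_derivative (Y' y - q y) / y) (at y)"
      proof -
        have "((\<lambda>z. (z * q z) / z) has_real_derivative (Y' y * y - (y * q y) * 1) / (y * y)) (at y)"
          by (rule DERIV_divide[OF DY[OF y] DERIV_ident]) (use y in auto)
        moreover have "(Y' y * y - (y * q y) * 1) / (y * y) = (Y' y - q y) / y"
          using y by (simp add: field_simps)
        ultimately have "((\<lambda>z. (z * q z) / z) has_real_derivative (Y' y - q y) / y) (at y)" by simp
        then show ?thesis
          by (rule has_field_derivative_transform_within_open[where S = "- {0}"]) (use y in auto)
      qed
      have Dqa: "((\<lambda>z. q z powr a) has_real_derivative a * q y powr (a - 1) * ((Y' y - q y) / y)) (at y)"
        by (rule DERIV_chain2[where f = "\<lambda>z. z powr a" and g = q, OF has_real_derivative_powr[OF qy] Dq])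
      have sn: "(snd has_derivative snd) (at (x, y))" by (intro has_derivative_snd has_derivative_ident)
      have D1: "((\<lambda>p. q (snd p) powr a) has_derivative
          (\<lambda>h. a * q y powr (a - 1) * ((Y' y - q y) / y) * snd h)) (at (x, y))"
        by (rule has_derivative_compose[OF sn, where g = "\<lambda>y. q y powr a"])
          (use Dqa in \<open>simp only: has_field_derivative_def snd_conv\<close>)
      have D2: "((\<lambda>p. snd p * q (snd p)) has_derivative (\<lambda>h. Y' y * snd h)) (at (x, y))"
        by (rule has_derivative_compose[OF sn, where g = "\<lambda>y. y * q y"])
          (use DY[OF y] in \<open>simp only: has_field_derivative_def snd_conv\<close>)
      have D3: "((\<lambda>p. fst p * q (snd p) powr a) has_derivative
          (\<lambda>h. x * (a * q y powr (a - 1) * ((Y' y - q y) / y) * snd h) + fst h * q y powr a)) (at (x, y))"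
        using has_derivative_mult[OF has_derivative_fst[OF has_derivative_ident] D1] by simp
      show "(?\<Psi> has_derivative (\<lambda>h. (fst h * q (snd p) powr a
             + fst p * (a * q (snd p) powr (a - 1) * ((Y' (snd p) - q (snd p)) / snd p)) * snd h,
             Y' (snd p) * snd h))) (at p)"
        using has_derivative_Pair[OF D3 D2] by (simp add: p algebra_simps)
      show "h = 0" if "(fst h * q (snd p) powr a
             + fst p * (a * q (snd p) powr (a - 1) * ((Y' (snd p) - q (snd p)) / snd p)) * snd h,
             Y' (snd p) * snd h) = 0" for h :: "real \<times> real"
        using that Y'p[OF y] qy by (auto simp: p prod_eq_iff)
      show "0 < Y' (snd p) * q (snd p) powr (- 1 - a)" using Y'p[OF y] qy by (simp add: p)
      let ?Q = "q y powr a"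
      have Q: "0 < ?Q" using qy by simp
      have pw: "q y powr (a - 1) = ?Q / q y" "q y powr (- 1 - a) = 1 / (q y * ?Q)" "q y powr (2 * a) = ?Q * ?Q"
        using qy by (simp_all add: powr_diff powr_minus powr_add[symmetric] field_simps)
      have Y'e: "Y' y = u y * (?Q * ?Q)" by (simp add: Y'_def pw)
      have ps: "\<psi> y = k * y * u y" by (rule u(2)[OF y])
      have e1: "(- a * x\<^sup>2 + \<psi> y) * ?Q + x * (a * (?Q / q y) * ((Y' y - q y) / y)) * (- x * y)
          = Y' y * (1 / (q y * ?Q)) * (- a * (x * ?Q)\<^sup>2 + k * (y * q y))"
        using y qy Q unfolding Y'e ps by (simp add: field_simps power2_eq_square)
      have e2: "Y' y * (- x * y) = Y' y * (1 / (q y * ?Q)) * (- (x * ?Q) * (y * q y))"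
        using qy Q by (simp add: field_simps)
      show "(fst (vfield m \<psi> p) * q (snd p) powr a
             + fst p * (a * q (snd p) powr (a - 1) * ((Y' (snd p) - q (snd p)) / snd p)) * snd (vfield m \<psi> p),
             Y' (snd p) * snd (vfield m \<psi> p))
           = (Y' (snd p) * q (snd p) powr (- 1 - a)) *\<^sub>R qh_field a k (?\<Psi> p)"
        using e1 e2 a(2) by (simp add: p pw vfield_def Phi_def qh_field_def)
    next
      have S0: "{p \<in> S. snd p \<noteq> 0} \<subseteq> ?U" using S by auto
      have "continuous_on {-d<..<d} r"
        by (rule continuous_on_subset[OF \<delta>(2)]) (use d0 in \<open>auto simp: d_def\<close>)
      then have "continuous_on ?U (\<lambda>p. r (snd p))"
        by (rule continuous_on_compose2) (auto intro!: continuous_intros)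
      then have "continuous_on ?U (\<lambda>p. Y' (snd p) * q (snd p) powr (- 1 - a))"
        unfolding Y'_def u_def
        by (intro continuous_on_mult continuous_on_powr continuous_on_add cqs continuous_on_snd
            continuous_on_id continuous_on_const) (use qp in force)+
      then show "continuous_on {p \<in> S. snd p \<noteq> 0} (\<lambda>p. Y' (snd p) * q (snd p) powr (- 1 - a))"
        by (rule continuous_on_subset) (rule S0)
    qed (use that opU0 in simp_all)
  qed (use vw in auto)
  have zero: "vfield m \<psi> p = 0 \<longleftrightarrow> qh_field a k (?\<Psi> p) = 0" if p: "p \<in> ?U" for p
  proof -
    obtain x y where xy: "p = (x, y)" by fastforce
    have qy: "0 < q y" using qp p xy by auto
    show ?thesis
    proof (cases "y = 0")
      case True
      then show ?thesis using \<psi>(2) a qy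
        by (simp add: xy vfield_def Phi_def qh_field_def prod_eq_iff)
    next
      case False
      then have "\<psi> y = k * y * u y" "u y \<noteq> 0" "k \<noteq> 0" using u[of y] p xy \<psi>(3) by (auto simp: k_def)
      then show ?thesis using False qy a by (auto simp: xy vfield_def Phi_def qh_field_def prod_eq_iff)
    qed
  qed
  have eq: "orbit_equivalence (vfield m \<psi>) ?U (qh_field a k) (?\<Psi> ` ?U) ?\<Psi> \<Psi>'"
    unfolding orbit_equivalence_def using opU opW \<Psi>' zero fl by blast
  have "?\<Psi> (0, 0) = (0, 0)" by simp
  then show ?thesis
    using local_phase_portrait_pullback[OF eq, of "(0, 0)" 1 1] qh_field_portrait[OF a(1), of k] d \<psi>(3)
    by (simp add: k_def)
qed

section \<open>Double power series\<close>

text \<open>Expanding the powers by the binomial theorem twice gives an absolutely summable family, since the sum of the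
  absolute values is the absolute series at \<open>\<bar>v\<bar> + \<bar>\<beta> u\<bar> + \<bar>\<alpha> u\<^sup>2\<bar>\<close>.\<close>
lemma has_sum_composed_monomials:
  fixes c :: "nat \<Rightarrow> real"
  assumes conv: "\<And>h. \<bar>h\<bar> < R \<Longrightarrow> (\<lambda>n. c n * h ^ n) sums f h"
    and small: "\<bar>v\<bar> + \<bar>\<beta> * u\<bar> + \<bar>\<alpha> * u\<^sup>2\<bar> < R"
  shows "((\<lambda>(n, l, j). c n * real (n choose l) * real (n - l choose j) *
            (v ^ l * (\<alpha> * u\<^sup>2) ^ j * (\<beta> * u) ^ (n - l - j)))
          has_sum f (v + \<beta> * u + \<alpha> * u\<^sup>2))
         (Sigma UNIV (\<lambda>n. Sigma {..n} (\<lambda>l. {..n - l})))" (is "(?t has_sum _) _")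
proof -
  have binom: "(\<Sum>(l, j)\<in>Sigma {..n} (\<lambda>l. {..n - l}). real (n choose l) * real (n - l choose j) *
      (V ^ l * A ^ j * B ^ (n - l - j))) = (V + B + A) ^ n" for n and V A B :: real
  proof -
    have "(V + (A + B)) ^ n = (\<Sum>l\<le>n. real (n choose l) * V ^ l * (A + B) ^ (n - l))"
      by (rule binomial_ring)
    also have "\<dots> = (\<Sum>l\<le>n. \<Sum>j\<le>n - l. real (n choose l) * real (n - l choose j) *
      (V ^ l * A ^ j * B ^ (n - l - j)))"
      by (simp add: binomial_ring[of A B] sum_distrib_left mult_ac)
    also have "\<dots> = (\<Sum>(l, j)\<in>Sigma {..n} (\<lambda>l. {..n - l}). real (n choose l) * real (n - l choose j) *
      (V ^ l * A ^ j * B ^ (n - l - j)))"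
      by (rule sum.Sigma) auto
    finally show ?thesis by (simp add: add_ac)
  qed
  let ?S = "\<lambda>n. Sigma {..n} (\<lambda>l. {..n - l})"
  have fib: "((\<lambda>y. ?t (n, y)) has_sum c n * (v + \<beta> * u + \<alpha> * u\<^sup>2) ^ n) (?S n)" for n
    by (rule has_sum_finiteI)
      (auto simp: binom[symmetric] sum_distrib_left case_prod_beta mult_ac intro!: sum.cong)
  have fib_abs: "((\<lambda>y. norm (?t (n, y))) has_sum \<bar>c n\<bar> * (\<bar>v\<bar> + \<bar>\<beta> * u\<bar> + \<bar>\<alpha> * u\<^sup>2\<bar>) ^ n) (?S n)" for n
    by (rule has_sum_finiteI)
      (auto simp: binom[symmetric] sum_distrib_left case_prod_beta mult_ac abs_mult power_abs intro!: sum.cong)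
  have abs_c: "summable (\<lambda>n. \<bar>c n * h ^ n\<bar>)" if h: "\<bar>h\<bar> < R" for h
  proof -
    obtain h' where h': "\<bar>h\<bar> < h'" "h' < R" using dense h by blast
    have "summable (\<lambda>n. c n * h' ^ n)" using conv[of h'] h' sums_summable by fastforce
    then have "summable (\<lambda>n. norm (c n * h ^ n))"
      by (rule powser_insidea) (use h' in simp)
    then show ?thesis by simp
  qed
  have "summable (\<lambda>n. \<bar>c n\<bar> * (\<bar>v\<bar> + \<bar>\<beta> * u\<bar> + \<bar>\<alpha> * u\<^sup>2\<bar>) ^ n)"
    using abs_c[of "\<bar>v\<bar> + \<bar>\<beta> * u\<bar> + \<bar>\<alpha> * u\<^sup>2\<bar>"] small by (simp add: abs_mult power_abs)
  then have "(\<lambda>n. \<bar>c n\<bar> * (\<bar>v\<bar> + \<bar>\<beta> * u\<bar> + \<bar>\<alpha> * u\<^sup>2\<bar>) ^ n) summable_on UNIV"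
    by (rule summable_nonneg_imp_summable_on_strong) (auto intro!: always_eventually)
  then have "(\<lambda>y. norm (?t y)) summable_on Sigma UNIV ?S"
    by (intro summable_on_SigmaI[OF fib_abs]) auto
  then have summ: "?t summable_on Sigma UNIV ?S" by (rule abs_summable_summable)
  let ?h = "v + \<beta> * u + \<alpha> * u\<^sup>2"
  have h: "\<bar>?h\<bar> < R" using small by linarith
  have "((\<lambda>n. c n * ?h ^ n) has_sum f ?h) UNIV"
    by (rule norm_summable_imp_has_sum[OF _ conv[OF h]]) (use abs_c[OF h] in simp)
  then show ?thesis by (rule has_sum_SigmaI[OF fib _ summ])
qed

text \<open>The coefficient of \<open>u\<^sup>i v\<^sup>l\<close> in \<open>\<Sum>n. c n (v + \<beta> u + \<alpha> u\<^sup>2)\<^sup>n\<close>.  If \<open>j\<close> factors contribute \<open>\<alpha> u\<^sup>2\<close>, then \<open>i - 2 j\<close>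
  contribute \<open>\<beta> u\<close>, and \<open>n = l + (i - j)\<close>.\<close>
definition composed_coeff :: "(nat \<Rightarrow> real) \<Rightarrow> real \<Rightarrow> real \<Rightarrow> nat \<Rightarrow> nat \<Rightarrow> real" where
  "composed_coeff c \<alpha> \<beta> i l = (\<Sum>j\<in>{j. 2 * j \<le> i}. c (l + (i - j)) * real (l + (i - j) choose l)
     * real (i - j choose j) * \<alpha> ^ j * \<beta> ^ (i - 2 * j))"

lemma has_power_series2_composed:
  fixes c :: "nat \<Rightarrow> real"
  assumes "0 < R" and conv: "\<And>h. \<bar>h\<bar> < R \<Longrightarrow> (\<lambda>n. c n * h ^ n) sums f h"
  shows "has_power_series2 (\<lambda>(u, v). f (v + \<beta> * u + \<alpha> * u\<^sup>2)) (composed_coeff c \<alpha> \<beta>)"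
proof -
  have "((\<lambda>u. u + \<bar>\<beta>\<bar> * u + \<bar>\<alpha>\<bar> * u\<^sup>2) \<longlongrightarrow> 0 + \<bar>\<beta>\<bar> * 0 + \<bar>\<alpha>\<bar> * 0\<^sup>2) (at_right 0)"
    by (intro tendsto_intros)
  then have "\<forall>\<^sub>F u in at_right 0. u + \<bar>\<beta>\<bar> * u + \<bar>\<alpha>\<bar> * u\<^sup>2 < R"
    using assms(1) by (auto dest: order_tendstoD)
  then have "\<forall>\<^sub>F u in at_right 0. u + \<bar>\<beta>\<bar> * u + \<bar>\<alpha>\<bar> * u\<^sup>2 < R \<and> 0 < u"
    using eventually_at_right_less[of "0::real"] by (rule eventually_conj)
  then obtain r where r: "0 < r" "r + \<bar>\<beta>\<bar> * r + \<bar>\<alpha>\<bar> * r\<^sup>2 < R"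
    using eventually_happens'[OF trivial_limit_at_right_real] by blast
  have "((\<lambda>(i, l). composed_coeff c \<alpha> \<beta> i l * u ^ i * v ^ l) has_sum f (v + \<beta> * u + \<alpha> * u\<^sup>2)) UNIV"
    if uv: "\<bar>u\<bar> < r" "\<bar>v\<bar> < r" for u v
  proof -
    have "\<bar>\<beta> * u\<bar> \<le> \<bar>\<beta>\<bar> * r" using uv by (simp add: abs_mult mult_left_mono)
    moreover have "u\<^sup>2 \<le> r\<^sup>2" using uv(1) r(1) by (intro abs_le_square_iff[THEN iffD1]) auto
    then have "\<bar>\<alpha> * u\<^sup>2\<bar> \<le> \<bar>\<alpha>\<bar> * r\<^sup>2" by (simp add: abs_mult mult_left_mono)
    ultimately have small: "\<bar>v\<bar> + \<bar>\<beta> * u\<bar> + \<bar>\<alpha> * u\<^sup>2\<bar> < R" using uv r by linarith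
    note S = has_sum_composed_monomials[OF conv small]
    let ?s = "\<lambda>((i, l), j). c (l + (i - j)) * real (l + (i - j) choose l) * real (i - j choose j)
        * \<alpha> ^ j * \<beta> ^ (i - 2 * j) * u ^ i * v ^ l"
    let ?t = "\<lambda>(n, l, j). c n * real (n choose l) * real (n - l choose j) *
            (v ^ l * (\<alpha> * u\<^sup>2) ^ j * (\<beta> * u) ^ (n - l - j))"
    \<comment> \<open>\<open>(n, l, j)\<close> contributes to the monomial \<open>u\<^sup>i v\<^sup>l\<close> with \<open>i = (n - l) + j\<close>\<close>
    define J where "J = (\<lambda>(n :: nat, l :: nat, j :: nat). ((n - l + j, l), j))"
    define I where "I = (\<lambda>((i :: nat, l :: nat), j :: nat). (l + (i - j), l, j))"
    let ?A = "Sigma UNIV (\<lambda>n :: nat. Sigma {..n} (\<lambda>l. {..n - l}))"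
    let ?B = "Sigma UNIV (\<lambda>(i :: nat, l :: nat). {j. 2 * j \<le> i})"
    have J: "I (J x) = x" "J x \<in> ?B" "?s (J x) = ?t x" if x: "x \<in> ?A" for x
    proof -
      obtain n l j where x: "x = (n, l, j)" "l \<le> n" "j \<le> n - l" using x by auto
      define k where "k = n - l"
      define k' where "k' = k - j"
      have n: "n = l + k" and k: "k = j + k'" using x(2,3) by (auto simp: k_def k'_def)
      have "(u\<^sup>2) ^ j = u ^ j * u ^ j" by (simp add: power2_eq_square power_mult_distrib)
      then have e: "(\<alpha> * u\<^sup>2) ^ j * (\<beta> * u) ^ k' = \<alpha> ^ j * \<beta> ^ k' * u ^ (k + j)"
        unfolding k power_mult_distrib power_add by (simp only: mult_ac)
      have "k + j - j = k" "k + j - 2 * j = k'" "n - l = k" "n - l - j = k'" using n k by simp_all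
      then have "?s (J x) = c (l + k) * real (l + k choose l) * real (k choose j)
            * v ^ l * (\<alpha> ^ j * \<beta> ^ k' * u ^ (k + j))"
        by (simp add: J_def x(1) mult_ac)
      also have "\<dots> = ?t x"
        unfolding e[symmetric] using n k by (simp add: x(1) mult_ac)
      finally show "?s (J x) = ?t x" .
      show "I (J x) = x" "J x \<in> ?B" using x by (simp_all add: J_def I_def)
    qed
    have I: "J (I y) = y" "I y \<in> ?A" if y: "y \<in> ?B" for y
    proof -
      obtain i l j where "y = ((i, l), j)" "2 * j \<le> i" using y by auto
      then show "J (I y) = y" by (simp add: J_def I_def)
      have "l \<le> l + (i - j)" "j \<le> l + (i - j) - l" using \<open>2 * j \<le> i\<close> by arith+
      then show "I y \<in> ?A" using \<open>y = ((i, l), j)\<close> by (simp add: I_def)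
    qed
    have "(?t has_sum f (v + \<beta> * u + \<alpha> * u\<^sup>2)) ?A \<longleftrightarrow> (?s has_sum f (v + \<beta> * u + \<alpha> * u\<^sup>2)) ?B"
      by (rule has_sum_reindex_bij_witness[where i = I and j = J]) (fact J I refl)+
    with S have "(?s has_sum f (v + \<beta> * u + \<alpha> * u\<^sup>2)) (Sigma UNIV (\<lambda>(i, l). {j. 2 * j \<le> i}))"
      by blast
    moreover have "((\<lambda>j. ?s (il, j)) has_sum (\<lambda>(i, l). composed_coeff c \<alpha> \<beta> i l * u ^ i * v ^ l) il)
        ((\<lambda>(i, l). {j. 2 * j \<le> i}) il)" for il
    proof (cases il)
      case (Pair i l)
      have "finite {j. 2 * j \<le> i}" by (rule finite_subset[of _ "{..i}"]) auto
      then show ?thesis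
        by (intro has_sum_finiteI) (simp_all add: Pair composed_coeff_def sum_distrib_right)
    qed
    ultimately show ?thesis by (rule has_sum_SigmaD)
  qed
  then show ?thesis unfolding has_power_series2_def using r(1) by auto
qed

text \<open>For \<open>\<beta> = 0\<close> the inner polynomial \<open>v + \<alpha> u\<^sup>2\<close> is homogeneous of weight 2, so its powers from \<open>N\<close> on have
  weight at least \<open>2 N\<close>.\<close>
lemma composed_coeff_weight:
  assumes "\<And>n. n < N \<Longrightarrow> c n = 0" "i + 2 * l < 2 * N"
  shows "composed_coeff c \<alpha> 0 i l = 0"
  unfolding composed_coeff_def
proof (rule sum.neutral, rule ballI)
  fix j assume j: "j \<in> {j. 2 * j \<le> i}"
  show "c (l + (i - j)) * real (l + (i - j) choose l) * real (i - j choose j) * \<alpha> ^ j * 0 ^ (i - 2 * j) = 0"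
  proof (cases "i = 2 * j")
    case True
    then have "l + (i - j) < N" using assms(2) by simp
    then show ?thesis using assms(1) by simp
  qed (use j in auto)
qed

lemma has_power_series2_cong:
  assumes "has_power_series2 f c" "\<forall>\<^sub>F q in nhds (0, 0). f q = g q"
  shows "has_power_series2 g c"
proof -
  obtain r where r: "0 < r" "\<And>u v. \<bar>u\<bar> < r \<Longrightarrow> \<bar>v\<bar> < r \<Longrightarrow>
      ((\<lambda>(i, j). c i j * u ^ i * v ^ j) has_sum f (u, v)) UNIV"
    using assms(1) unfolding has_power_series2_def by blast
  obtain s where s: "0 < s" "\<And>q. dist q (0, 0) < s \<Longrightarrow> f q = g q"
    using assms(2) unfolding eventually_nhds_metric by blast
  have "f (u, v) = g (u, v)" if "\<bar>u\<bar> < s / 2" "\<bar>v\<bar> < s / 2" for u v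
  proof (rule s(2))
    have "dist (u, v) (0, 0) \<le> \<bar>u\<bar> + \<bar>v\<bar>"
      using norm_Pair_le[of u v] by (simp add: dist_norm)
    then show "dist (u, v) (0, 0) < s" using that by linarith
  qed
  then have "((\<lambda>(i, j). c i j * u ^ i * v ^ j) has_sum g (u, v)) UNIV"
    if "\<bar>u\<bar> < min r (s / 2)" "\<bar>v\<bar> < min r (s / 2)" for u v
    using r(2)[of u v] that by simp
  moreover have "0 < min r (s / 2)" using r(1) s(1) by simp
  ultimately show ?thesis unfolding has_power_series2_def by blast
qed

lemma has_power_series2_add:
  assumes "has_power_series2 f c" "has_power_series2 g d"
  shows "has_power_series2 (\<lambda>q. f q + g q) (\<lambda>i j. c i j + d i j)"
proof -
  obtain r where r: "0 < r" "\<And>u v. \<bar>u\<bar> < r \<Longrightarrow> \<bar>v\<bar> < r \<Longrightarrow>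
      ((\<lambda>(i, j). c i j * u ^ i * v ^ j) has_sum f (u, v)) UNIV"
    using assms(1) unfolding has_power_series2_def by blast
  obtain s where s: "0 < s" "\<And>u v. \<bar>u\<bar> < s \<Longrightarrow> \<bar>v\<bar> < s \<Longrightarrow>
      ((\<lambda>(i, j). d i j * u ^ i * v ^ j) has_sum g (u, v)) UNIV"
    using assms(2) unfolding has_power_series2_def by blast
  have "((\<lambda>(i, j). (c i j + d i j) * u ^ i * v ^ j) has_sum f (u, v) + g (u, v)) UNIV"
    if "\<bar>u\<bar> < min r s" "\<bar>v\<bar> < min r s" for u v
    using has_sum_add[OF r(2)[of u v] s(2)[of u v]] that by (simp add: case_prod_beta' distrib_right)
  then show ?thesis
    unfolding has_power_series2_def using r(1) s(1) by (intro exI[of _ "min r s"]) auto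
qed

lemma has_power_series2_mult_fst:
  assumes "has_power_series2 f c"
  shows "has_power_series2 (\<lambda>q. k * fst q * f q) (\<lambda>i j. case i of 0 \<Rightarrow> 0 | Suc i' \<Rightarrow> k * c i' j)"
proof -
  obtain r where r: "0 < r" "\<And>u v. \<bar>u\<bar> < r \<Longrightarrow> \<bar>v\<bar> < r \<Longrightarrow>
      ((\<lambda>(i, j). c i j * u ^ i * v ^ j) has_sum f (u, v)) UNIV"
    using assms unfolding has_power_series2_def by blast
  have "((\<lambda>(i, j). (case i of 0 \<Rightarrow> 0 | Suc i' \<Rightarrow> k * c i' j) * u ^ i * v ^ j) has_sum k * u * f (u, v)) UNIV"
    if uv: "\<bar>u\<bar> < r" "\<bar>v\<bar> < r" for u v
  proof -
    let ?h = "\<lambda>(i, j). (Suc i, j :: nat)"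
    let ?t = "\<lambda>(i, j). (case i of 0 \<Rightarrow> 0 | Suc i' \<Rightarrow> k * c i' j) * u ^ i * v ^ j"
    have "((\<lambda>p. k * u * (case p of (i, j) \<Rightarrow> c i j * u ^ i * v ^ j)) has_sum k * u * f (u, v)) UNIV"
      by (rule has_sum_cmult_right[OF r(2)[OF uv]])
    moreover have "(\<lambda>p. k * u * (case p of (i, j) \<Rightarrow> c i j * u ^ i * v ^ j)) = ?t \<circ> ?h"
      by (auto simp: fun_eq_iff)
    ultimately have "(?t \<circ> ?h has_sum k * u * f (u, v)) UNIV" by simp
    then have "(?t has_sum k * u * f (u, v)) (range ?h)"
      by (subst has_sum_reindex) (auto simp: inj_on_def)
    also have "(?t has_sum k * u * f (u, v)) (range ?h) \<longleftrightarrow> (?t has_sum k * u * f (u, v)) UNIV"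
    proof (rule has_sum_cong_neutral)
      fix x :: "nat \<times> nat" assume "x \<in> UNIV - range ?h"
      then have "fst x = 0" by (cases x; cases "fst x") force+
      then show "?t x = 0" by (simp add: case_prod_beta)
    qed auto
    finally show ?thesis .
  qed
  then show ?thesis unfolding has_power_series2_def using r(1) by auto
qed

lemma has_power_series2_fst_poly:
  "\<exists>c. has_power_series2 (\<lambda>q. A + B * fst q + C * (fst q)\<^sup>2) c"
proof -
  define c where "c i j = (if j = 0 then if i = 0 then A else if i = 1 then B else if i = 2 then C else 0 else 0)"
    for i j :: nat
  have "((\<lambda>(i, j). c i j * u ^ i * v ^ j) has_sum A + B * u + C * u\<^sup>2) UNIV" for u v
    by (rule has_sum_finite_neutralI[where B = "{(0, 0), (1, 0), (2, 0)}"]) (auto simp: c_def split: if_splits)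
  then show ?thesis
    unfolding has_power_series2_def by (intro exI[of _ c] exI[of _ 1]) auto
qed

lemma real_analytic2_fst: "real_analytic2_at (\<lambda>q. A + B * fst q + C * (fst q)\<^sup>2) p"
proof -
  have "(\<lambda>q. A + B * fst (p + q) + C * (fst (p + q))\<^sup>2) =
      (\<lambda>q. (A + B * fst p + C * (fst p)\<^sup>2) + (B + 2 * C * fst p) * fst q + C * (fst q)\<^sup>2)"
    by (simp add: fun_eq_iff algebra_simps power2_eq_square)
  then show ?thesis
    unfolding real_analytic2_at_def
    using has_power_series2_fst_poly[of "A + B * fst p + C * (fst p)\<^sup>2" "B + 2 * C * fst p" C] by simp
qed

text \<open>Recentred at \<open>p\<close>, the polynomial \<open>y + s x\<^sup>2\<close> acquires the linear term \<open>2 s x\<^sub>0 u\<close>.\<close>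
lemma real_analytic2_composed:
  assumes "real_analytic_at f (snd p + s * (fst p)\<^sup>2)"
  shows "real_analytic2_at (\<lambda>q. f (snd q + s * (fst q)\<^sup>2)) p"
proof -
  let ?t = "snd p + s * (fst p)\<^sup>2"
  obtain c R where R: "0 < R" "\<And>h. \<bar>h\<bar> < R \<Longrightarrow> (\<lambda>n. c n * h ^ n) sums f (?t + h)"
    using assms unfolding real_analytic_at_def by blast
  have "has_power_series2 (\<lambda>(u, v). f (?t + (v + (2 * s * fst p) * u + s * u\<^sup>2)))
      (composed_coeff c s (2 * s * fst p))"
    by (rule has_power_series2_composed[OF R(1), where f = "\<lambda>h. f (?t + h)"]) (rule R(2))
  moreover have "(\<lambda>(u, v). f (?t + (v + (2 * s * fst p) * u + s * u\<^sup>2))) =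
      (\<lambda>q. f (snd (p + q) + s * (fst (p + q))\<^sup>2))"
    by (auto simp: fun_eq_iff algebra_simps power2_eq_square intro!: arg_cong[of _ _ f])
  ultimately show ?thesis unfolding real_analytic2_at_def by auto
qed

lemma real_analytic2_add:
  assumes "real_analytic2_at f p" "real_analytic2_at g p"
  shows "real_analytic2_at (\<lambda>q. f q + g q) p"
proof -
  obtain c d where "has_power_series2 (\<lambda>q. f (p + q)) c" "has_power_series2 (\<lambda>q. g (p + q)) d"
    using assms unfolding real_analytic2_at_def by blast
  from has_power_series2_add[OF this] show ?thesis unfolding real_analytic2_at_def by blast
qed

section \<open>Inverting a real analytic profile\<close>

lemma real_analytic_imp_holomorphic:
  assumes "real_analytic_at f a"
  shows "\<exists>R F. 0 < R \<and> F holomorphic_on ball (of_real a) R \<and>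
     (\<forall>x. \<bar>x - a\<bar> < R \<longrightarrow> F (of_real x) = complex_of_real (f x))"
proof -
  obtain c R where R: "0 < R" "\<And>h. \<bar>h\<bar> < R \<Longrightarrow> (\<lambda>n. c n * h ^ n) sums f (a + h)"
    using assms unfolding real_analytic_at_def by blast
  define F where "F z = (\<Sum>n. complex_of_real (c n) * (z - of_real a) ^ n)" for z
  have sums: "(\<lambda>n. complex_of_real (c n) * (z - of_real a) ^ n) sums F z"
    if z: "z \<in> ball (of_real a) R" for z
  proof -
    obtain h where h: "norm (z - of_real a) < h" "h < R"
      using dense z by (metis dist_commute dist_norm mem_ball)
    have "\<bar>h\<bar> < R" using h norm_ge_zero[of "z - of_real a"] by linarith
    from sums_of_real[OF R(2)[OF this]]
    have "summable (\<lambda>n. complex_of_real (c n) * of_real h ^ n)" by (auto simp: sums_iff)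
    then have "summable (\<lambda>n. complex_of_real (c n) * (z - of_real a) ^ n)"
      by (rule powser_inside) (use h in auto)
    then show ?thesis unfolding F_def by (rule summable_sums)
  qed
  have "F holomorphic_on ball (of_real a) R"
    by (rule power_series_holomorphic) (rule sums)
  moreover have "F (of_real x) = of_real (f x)" if x: "\<bar>x - a\<bar> < R" for x
  proof -
    have "complex_of_real x \<in> ball (of_real a) R"
      using x by (simp add: dist_of_real dist_real_def abs_minus_commute)
    from sums[OF this] have "(\<lambda>n. complex_of_real (c n * (x - a) ^ n)) sums F (of_real x)" by simp
    moreover have "(\<lambda>n. complex_of_real (c n * (x - a) ^ n)) sums of_real (f x)"
      using sums_of_real[OF R(2)[OF x]] by simp
    ultimately show ?thesis by (rule sums_unique2)
  qed
  ultimately show ?thesis using R(1) by blast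
qed

lemma holomorphic_imp_real_power_series:
  assumes "F holomorphic_on ball (of_real b) R"
    and "\<And>x. \<bar>x - b\<bar> < R \<Longrightarrow> F (of_real x) = complex_of_real (f x)" and "\<bar>h\<bar> < R"
  shows "(\<lambda>n. Re ((deriv ^^ n) F (of_real b) / fact n) * h ^ n) sums f (b + h)"
proof -
  have "complex_of_real (b + h) \<in> ball (of_real b) R"
    using assms(3) by (simp only: mem_ball dist_of_real) (simp add: dist_real_def)
  from sums_Re[OF holomorphic_power_series[OF assms(1) this]]
  have "(\<lambda>n. Re ((deriv ^^ n) F (of_real b) / fact n * of_real (h ^ n))) sums f (b + h)"
    using assms(2)[of "b + h"] assms(3) by simp
  moreover have "Re (w * of_real t) = Re w * t" for w t by simp
  ultimately show ?thesis by (simp only:)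
qed

lemma holomorphic_imp_real_analytic:
  assumes "F holomorphic_on ball (of_real b) R" "0 < R"
    and "\<And>x. \<bar>x - b\<bar> < R \<Longrightarrow> F (of_real x) = complex_of_real (f x)"
  shows "real_analytic_at f b"
  unfolding real_analytic_at_def
proof (intro exI conjI allI impI)
  show "0 < R" by (rule assms(2))
  show "(\<lambda>n. Re ((deriv ^^ n) F (of_real b) / fact n) * h ^ n) sums f (b + h)" if "\<bar>h\<bar> < R" for h
    by (rule holomorphic_imp_real_power_series[OF assms(1,3) that])
qed

text \<open>The inverse of the holomorphic extension of \<open>\<psi>\<close> is holomorphic, which gives the analytic inverse \<open>\<kappa>\<close>.  The
  function \<open>\<theta>(t) = \<kappa>(t) \<psi>'(\<kappa>(t))\<close> is analytic too; it is the coefficient with which \<open>\<psi>(y)\<close> moves when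
  \<open>y' = - x y\<close>, and its derivative at 0 is \<open>\<kappa>'(0) \<psi>'(0) = 1\<close>.\<close>
lemma analytic_inverse:
  assumes an: "real_analytic_at \<psi> 0" and \<psi>0: "\<psi> 0 = 0" "deriv \<psi> 0 \<noteq> 0"
  shows "\<exists>r \<kappa> \<theta> c R. 0 < r \<and> 0 < R
    \<and> (\<forall>y. \<bar>y\<bar> < r \<longrightarrow> real_analytic_at \<psi> y \<and> (\<psi> has_real_derivative deriv \<psi> y) (at y)
        \<and> \<kappa> (\<psi> y) = y \<and> real_analytic_at \<kappa> (\<psi> y) \<and> \<theta> (\<psi> y) = y * deriv \<psi> y)
    \<and> (\<forall>h. \<bar>h\<bar> < R \<longrightarrow> (\<lambda>n. c n * h ^ n) sums \<theta> h) \<and> c 0 = 0 \<and> c 1 = (1 :: real)"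
proof -
  obtain R0 F where R0: "0 < R0" and holF: "F holomorphic_on ball 0 R0"
    and F: "\<And>x. \<bar>x\<bar> < R0 \<Longrightarrow> F (of_real x) = complex_of_real (\<psi> x)"
    using real_analytic_imp_holomorphic[OF an] by auto
  have inball: "complex_of_real x \<in> ball 0 s" if "\<bar>x\<bar> < s" for x s using that by simp
  have der: "(\<psi> has_real_derivative deriv \<psi> x) (at x) \<and> deriv F (of_real x) = of_real (deriv \<psi> x)"
    if x: "\<bar>x\<bar> < R0" for x
  proof -
    let ?d = "deriv F (of_real x)"
    have "(F has_field_derivative ?d) (at (of_real x))"
      by (rule holomorphic_derivI[OF holF open_ball inball[OF x]])
    then have "((\<lambda>x. F (of_real x)) has_vector_derivative ?d) (at x)"
      by (rule has_vector_derivative_real_field)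
    then have 1: "((\<lambda>x. complex_of_real (\<psi> x)) has_vector_derivative ?d) (at x)"
      by (rule has_vector_derivative_transform_within_open[where S = "{-R0<..<R0}"])
        (use x F in \<open>auto simp: abs_less_iff\<close>)
    from bounded_linear.has_vector_derivative[OF bounded_linear_Re this]
    have 2: "(\<psi> has_real_derivative Re ?d) (at x)"
      by (simp add: has_real_derivative_iff_has_vector_derivative)
    then have 3: "deriv \<psi> x = Re ?d" by (rule DERIV_imp_deriv)
    have "((\<lambda>x. complex_of_real (\<psi> x)) has_vector_derivative of_real (Re ?d)) (at x)"
      using bounded_linear.has_vector_derivative[OF bounded_linear_of_real] 2
      by (simp add: has_real_derivative_iff_has_vector_derivative)
    then have "?d = of_real (Re ?d)" using 1 vector_derivative_unique_at by blast
    then show ?thesis using 2 3 by simp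
  qed
  have F0: "F 0 = 0" using F[of 0] R0 \<psi>0 by simp
  have dF0: "deriv F 0 = of_real (deriv \<psi> 0)" using der[of 0] R0 by simp
  then have dF: "deriv F 0 \<noteq> 0" using \<psi>0 by simp
  have inR: "0 \<in> ball (0 :: complex) R0" using R0 by simp
  obtain r where r: "0 < r" "ball (0 :: complex) r \<subseteq> ball 0 R0" "inj_on F (ball 0 r)"
    by (rule has_complex_derivative_locally_injective[OF holF inR open_ball dF])
  have rR: "r \<le> R0" using r(1,2) by (simp add: ball_subset_ball_iff)
  have holFr: "F holomorphic_on ball 0 r" using holF r(2) holomorphic_on_subset by blast
  obtain g where g: "g holomorphic_on F ` ball 0 r"
      "\<And>z. z \<in> ball 0 r \<Longrightarrow> deriv F z * deriv g (F z) = 1"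
      "\<And>z. z \<in> ball 0 r \<Longrightarrow> g (F z) = z"
    using holomorphic_has_inverse[OF holFr open_ball r(3)] by blast
  have opF: "open (F ` ball 0 r)" by (rule open_mapping_thm3[OF holFr open_ball r(3)])
  have g\<psi>: "g (of_real (\<psi> y)) = of_real y" "complex_of_real (\<psi> y) \<in> F ` ball 0 r" if "\<bar>y\<bar> < r" for y
  proof -
    have "F (of_real y) = of_real (\<psi> y)" using that rR by (intro F) simp
    then show "g (of_real (\<psi> y)) = of_real y" "complex_of_real (\<psi> y) \<in> F ` ball 0 r"
      using g(3)[OF inball[OF that]] imageI[OF inball[OF that], of F] by simp_all
  qed
  have inj\<psi>: "inj_on \<psi> {-r<..<r}"
  proof (rule inj_onI)
    fix y z assume yz: "y \<in> {-r<..<r}" "z \<in> {-r<..<r}" and e: "\<psi> y = \<psi> z"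
    then have b: "\<bar>y\<bar> < r" "\<bar>z\<bar> < r" by (simp_all add: abs_less_iff)
    have "complex_of_real y = of_real z"
      using g\<psi>(1)[OF b(1)] g\<psi>(1)[OF b(2)] unfolding e by (rule trans[OF sym])
    then show "y = z" by simp
  qed
  have cont\<psi>: "continuous_on {-r<..<r} \<psi>"
  proof (intro continuous_at_imp_continuous_on ballI)
    fix y assume "y \<in> {-r<..<r}"
    then have "\<bar>y\<bar> < R0" using rR by auto
    then show "isCont \<psi> y" using der DERIV_isCont by blast
  qed
  have op\<psi>: "open (\<psi> ` {-r<..<r})" by (rule invariance_of_domain[OF cont\<psi> _ inj\<psi>]) simp
  define \<kappa> where "\<kappa> t = Re (g (of_real t))" for t
  define H where "H z = g z * deriv F (g z)" for z
  define \<theta> where "\<theta> t = Re (H (of_real t))" for t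
  have \<kappa>: "\<kappa> (\<psi> y) = y" if "\<bar>y\<bar> < r" for y using g\<psi>(1)[OF that] by (simp add: \<kappa>_def)
  have H\<psi>: "H (of_real (\<psi> y)) = of_real (y * deriv \<psi> y)" if "\<bar>y\<bar> < r" for y
    using g\<psi>(1)[OF that] der[of y] that rR by (simp add: H_def)
  have nbhd: "\<exists>e>0. ball (of_real (\<psi> y)) e \<subseteq> F ` ball 0 r \<and> (\<forall>x. \<bar>x - \<psi> y\<bar> < e \<longrightarrow> (\<exists>y'. \<bar>y'\<bar> < r \<and> x = \<psi> y'))"
    if y: "\<bar>y\<bar> < r" for y
  proof -
    obtain e1 where e1: "e1 > 0" "ball (complex_of_real (\<psi> y)) e1 \<subseteq> F ` ball 0 r"
      using opF g\<psi>(2)[OF y] open_contains_ball by blast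
    have "\<psi> y \<in> \<psi> ` {-r<..<r}" using y by (auto simp: abs_less_iff)
    then obtain e2 where e2: "e2 > 0" "ball (\<psi> y) e2 \<subseteq> \<psi> ` {-r<..<r}"
      using op\<psi> open_contains_ball by blast
    have "\<exists>y'. \<bar>y'\<bar> < r \<and> x = \<psi> y'" if "\<bar>x - \<psi> y\<bar> < min e1 e2" for x
    proof -
      have "x \<in> ball (\<psi> y) e2" using that by (simp add: dist_real_def abs_minus_commute)
      then obtain y' where "y' \<in> {-r<..<r}" "x = \<psi> y'" using e2(2) by blast
      then show ?thesis by (intro exI[of _ y']) (auto simp: abs_less_iff)
    qed
    moreover have "ball (complex_of_real (\<psi> y)) (min e1 e2) \<subseteq> F ` ball 0 r" using e1(2) by auto
    ultimately show ?thesis using e1(1) e2(1) by (intro exI[of _ "min e1 e2"]) simp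
  qed
  have an\<psi>: "real_analytic_at \<psi> y" if y: "\<bar>y\<bar> < r" for y
  proof (rule holomorphic_imp_real_analytic)
    have "ball (complex_of_real y) (R0 - \<bar>y\<bar>) \<subseteq> ball 0 R0"
    proof
      fix z assume "z \<in> ball (complex_of_real y) (R0 - \<bar>y\<bar>)"
      then have "norm (z - of_real y) < R0 - \<bar>y\<bar>" by (simp add: dist_norm norm_minus_commute)
      then show "z \<in> ball 0 R0" using norm_triangle_sub[of z "of_real y"] by simp
    qed
    then show "F holomorphic_on ball (of_real y) (R0 - \<bar>y\<bar>)" using holF holomorphic_on_subset by blast
    show "0 < R0 - \<bar>y\<bar>" using y rR by simp
    show "F (of_real x) = of_real (\<psi> x)" if "\<bar>x - y\<bar> < R0 - \<bar>y\<bar>" for x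
      using that by (intro F) linarith
  qed
  have an\<kappa>: "real_analytic_at \<kappa> (\<psi> y)" if y: "\<bar>y\<bar> < r" for y
  proof -
    obtain e where e: "e > 0" "ball (of_real (\<psi> y)) e \<subseteq> F ` ball 0 r"
      "\<And>x. \<bar>x - \<psi> y\<bar> < e \<Longrightarrow> \<exists>y'. \<bar>y'\<bar> < r \<and> x = \<psi> y'" using nbhd[OF y] by blast
    show ?thesis
    proof (rule holomorphic_imp_real_analytic[OF holomorphic_on_subset[OF g(1) e(2)] e(1)])
      fix x assume "\<bar>x - \<psi> y\<bar> < e"
      then obtain y' where "\<bar>y'\<bar> < r" "x = \<psi> y'" using e(3) by blast
      then show "g (of_real x) = of_real (\<kappa> x)" using g\<psi>(1) \<kappa> by simp
    qed
  qed
  have holH: "H holomorphic_on F ` ball 0 r"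
  proof -
    have "deriv F holomorphic_on ball 0 r" by (rule holomorphic_deriv[OF holFr open_ball])
    then have "(deriv F \<circ> g) holomorphic_on F ` ball 0 r"
      by (rule holomorphic_on_compose_gen[OF g(1)]) (use g(3) in auto)
    then show ?thesis unfolding H_def using g(1) by (auto intro!: holomorphic_intros simp: o_def)
  qed
  obtain e where e: "e > 0" "ball 0 e \<subseteq> F ` ball 0 r"
    "\<And>x. \<bar>x\<bar> < e \<Longrightarrow> \<exists>y'. \<bar>y'\<bar> < r \<and> x = \<psi> y'" using nbhd[of 0] r(1) \<psi>0 by auto
  have H\<theta>: "H (of_real x) = of_real (\<theta> x)" if x: "\<bar>x - 0\<bar> < e" for x
  proof -
    obtain y' where "\<bar>y'\<bar> < r" "x = \<psi> y'" using e(3)[of x] x by auto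
    then show ?thesis using H\<psi> by (simp add: \<theta>_def)
  qed
  define c where "c n = Re ((deriv ^^ n) H 0 / fact n)" for n
  have ser: "(\<lambda>n. c n * h ^ n) sums \<theta> h" if "\<bar>h\<bar> < e" for h
    using holomorphic_imp_real_power_series[of H 0 e \<theta> h] holomorphic_on_subset[OF holH e(2)] H\<theta> that
    by (simp add: c_def)
  have g0: "g 0 = 0" using g(3)[of 0] r(1) F0 by simp
  have c0: "c 0 = 0" by (simp add: c_def H_def g0)
  have in0: "0 \<in> F ` ball 0 r" using F0 r(1) by force
  have "(H has_field_derivative (deriv g 0 * deriv F (g 0) + deriv (\<lambda>z. deriv F (g z)) 0 * g 0)) (at 0)"
    unfolding H_def[abs_def]
  proof (rule DERIV_mult)
    show "(g has_field_derivative deriv g 0) (at 0)" by (rule holomorphic_derivI[OF g(1) opF in0])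
    have "deriv F holomorphic_on ball 0 r" by (rule holomorphic_deriv[OF holFr open_ball])
    then have "(deriv F \<circ> g) holomorphic_on F ` ball 0 r"
      by (rule holomorphic_on_compose_gen[OF g(1)]) (use g(3) in auto)
    from holomorphic_derivI[OF this opF in0]
    show "((\<lambda>z. deriv F (g z)) has_field_derivative deriv (\<lambda>z. deriv F (g z)) 0) (at 0)" by (simp add: o_def)
  qed
  then have "deriv H 0 = deriv g 0 * deriv F 0" using g0 by (simp add: DERIV_imp_deriv)
  also have "\<dots> = 1" using g(2)[of 0] r(1) F0 by (simp add: mult.commute)
  finally have c1: "c 1 = 1" by (simp add: c_def)
  have th: "\<theta> (\<psi> y) = y * deriv \<psi> y" if "\<bar>y\<bar> < r" for y
    using H\<psi>[OF that] by (simp add: \<theta>_def)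
  have d: "(\<psi> has_real_derivative deriv \<psi> y) (at y)" if "\<bar>y\<bar> < r" for y using der[of y] that rR by simp
  show ?thesis
    using r(1) e(1) an\<psi> d \<kappa> an\<kappa> th ser c0 c1
    by (intro exI[of _ r] exI[of _ \<kappa>] exI[of _ \<theta>] exI[of _ c] exI[of _ e]) simp
qed

section \<open>The quasi-homogeneous form of the field\<close>

lemma coords_eq: "coords m \<psi> = (\<lambda>q. (fst q, (1 - m) / 2 * (fst q)\<^sup>2 + \<psi> (snd q)))"
  by (simp add: coords_def Phi_def fun_eq_iff)

lemma coords_has_derivative:
  assumes "(\<psi> has_real_derivative k) (at (snd p))"
  shows "(coords m \<psi> has_derivative (\<lambda>h. (fst h, (1 - m) * fst p * fst h + k * snd h))) (at p)"
proof -
  have "(snd has_derivative snd) (at p)" by (intro has_derivative_snd has_derivative_ident)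
  then have 1: "((\<lambda>q. \<psi> (snd q)) has_derivative (\<lambda>h. k * snd h)) (at p)"
    by (rule has_derivative_compose) (use assms in \<open>simp only: has_field_derivative_def\<close>)
  have 2: "((\<lambda>q. (1 - m) / 2 * (fst q)\<^sup>2) has_derivative (\<lambda>h. (1 - m) * fst p * fst h)) (at p)"
    by (auto intro!: derivative_eq_intros)
  show ?thesis
    unfolding coords_eq
    by (intro has_derivative_Pair has_derivative_add 1 2 has_derivative_fst has_derivative_ident)
qed

lemma det_jacobian_coords:
  assumes "(\<psi> has_real_derivative k) (at 0)"
  shows "det (jacobian_matrix (coords m \<psi>) (0, 0)) = k"
proof -
  have "(coords m \<psi> has_derivative (\<lambda>h. (fst h, k * snd h))) (at (0, 0))"
    using coords_has_derivative[of \<psi> k "(0, 0)" m] assms by simp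
  from frechet_derivative_at[OF this, symmetric] show ?thesis
    by (simp add: jacobian_matrix_def Let_def det_2)
qed

text \<open>With \<open>s = (m - 1) / 2\<close> the field becomes \<open>\<eta>' = - 2 s \<xi> \<eta> - \<xi> \<theta>(\<eta> + s \<xi>\<^sup>2)\<close>, and \<open>\<theta>(t) = t\<close> would give exactly
  \<open>- s \<xi>\<^sup>3 - (2 s + 1) \<xi> \<eta>\<close>.  The error \<open>- \<xi> (\<theta>(t) - t)\<close> at \<open>t = \<eta> + s \<xi>\<^sup>2\<close> starts with weight \<open>1 + 2 \<sqdot> 2\<close>.\<close>
lemma qh_coordinates:
  assumes \<psi>: "real_analytic_at \<psi> 0" "\<psi> 0 = 0" "deriv \<psi> 0 \<noteq> 0"
  shows "\<exists>U W G. (0, 0) \<in> U \<and> coords m \<psi> (0, 0) = (0, 0) \<and> analytic_diffeo (coords m \<psi>) U W G \<and>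
      qh_form ((1 - m) / 2) (- m) (push_field (coords m \<psi>) G (vfield m \<psi>))"
proof -
  obtain r \<kappa> \<theta> c R where r: "0 < r" "0 < R"
    and near: "\<forall>y. \<bar>y\<bar> < r \<longrightarrow> real_analytic_at \<psi> y \<and> (\<psi> has_real_derivative deriv \<psi> y) (at y)
        \<and> \<kappa> (\<psi> y) = y \<and> real_analytic_at \<kappa> (\<psi> y) \<and> \<theta> (\<psi> y) = y * deriv \<psi> y"
    and ser: "\<forall>h. \<bar>h\<bar> < R \<longrightarrow> (\<lambda>n. c n * h ^ n) sums \<theta> h"
    and c: "c 0 = 0" "c 1 = (1 :: real)"
    using analytic_inverse[OF \<psi>] by (elim exE conjE)
  have an\<psi>: "real_analytic_at \<psi> y" and d\<psi>: "(\<psi> has_real_derivative deriv \<psi> y) (at y)"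
    and \<kappa>: "\<kappa> (\<psi> y) = y" and an\<kappa>: "real_analytic_at \<kappa> (\<psi> y)"
    and \<theta>: "\<theta> (\<psi> y) = y * deriv \<psi> y" if "\<bar>y\<bar> < r" for y
    using near that by simp_all
  define s where "s = (m - 1) / 2"
  have s: "(1 - m) / 2 = - s" by (simp add: s_def field_simps)
  let ?F = "coords m \<psi>"
  define G where "G q = (fst q, \<kappa> (snd q + s * (fst q)\<^sup>2))" for q
  define U where "U = {p :: real \<times> real. \<bar>snd p\<bar> < r}"
  define W where "W = ?F ` U"
  have opU: "open U" unfolding U_def by (intro open_Collect_less continuous_intros)
  have F: "?F p = (fst p, \<psi> (snd p) - s * (fst p)\<^sup>2)" for p by (simp add: coords_eq s)
  have GF: "G (?F p) = p" if "p \<in> U" for p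
    using that \<kappa>[of "snd p"] by (simp add: G_def F U_def)
  have contF: "continuous_on U ?F"
  proof (intro continuous_at_imp_continuous_on ballI)
    fix p assume "p \<in> U"
    then have "\<bar>snd p\<bar> < r" by (simp add: U_def)
    from has_derivative_continuous[OF coords_has_derivative[OF d\<psi>[OF this]]] show "isCont ?F p" .
  qed
  have injF: "inj_on ?F U" by (rule inj_on_inverseI[where g = G]) (rule GF)
  have opW: "open W" unfolding W_def by (rule invariance_of_domain[OF contF opU injF])
  have hom: "homeomorphism U W ?F G"
  proof (rule homeomorphismI)
    show "continuous_on W G"
      unfolding W_def by (rule continuous_on_inverse_open[OF opU contF order_refl GF])
  qed (use contF GF in \<open>auto simp: W_def\<close>)
  have an1: "real_analytic2_at (fst \<circ> ?F) p" "real_analytic2_at (snd \<circ> ?F) p" if p: "p \<in> U" for p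
  proof -
    have "fst \<circ> ?F = (\<lambda>q. 0 + 1 * fst q + 0 * (fst q)\<^sup>2)" by (simp add: F fun_eq_iff)
    then show "real_analytic2_at (fst \<circ> ?F) p" by (simp only: real_analytic2_fst)
    have "real_analytic2_at (\<lambda>q. (0 + 0 * fst q + (- s) * (fst q)\<^sup>2) + \<psi> (snd q + 0 * (fst q)\<^sup>2)) p"
      by (rule real_analytic2_add[OF real_analytic2_fst real_analytic2_composed])
        (use an\<psi> p in \<open>simp add: U_def\<close>)
    moreover have "snd \<circ> ?F = (\<lambda>q. (0 + 0 * fst q + (- s) * (fst q)\<^sup>2) + \<psi> (snd q + 0 * (fst q)\<^sup>2))"
      by (simp add: F fun_eq_iff)
    ultimately show "real_analytic2_at (snd \<circ> ?F) p" by simp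
  qed
  have an2: "real_analytic2_at (fst \<circ> G) q" "real_analytic2_at (snd \<circ> G) q" if q: "q \<in> W" for q
  proof -
    have "fst \<circ> G = (\<lambda>q. 0 + 1 * fst q + 0 * (fst q)\<^sup>2)" by (simp add: G_def fun_eq_iff)
    then show "real_analytic2_at (fst \<circ> G) q" by (simp only: real_analytic2_fst)
    obtain p where p: "p \<in> U" "q = ?F p" using q W_def by auto
    have "real_analytic_at \<kappa> (snd q + s * (fst q)\<^sup>2)"
      using an\<kappa>[of "snd p"] p by (simp add: F U_def)
    then have "real_analytic2_at (\<lambda>q. \<kappa> (snd q + s * (fst q)\<^sup>2)) q" by (rule real_analytic2_composed)
    moreover have "snd \<circ> G = (\<lambda>q. \<kappa> (snd q + s * (fst q)\<^sup>2))" by (simp add: G_def fun_eq_iff)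
    ultimately show "real_analytic2_at (snd \<circ> G) q" by simp
  qed
  have diffeo: "analytic_diffeo ?F U W G"
    unfolding analytic_diffeo_def using opU opW hom an1 an2 by blast
  have F0: "?F (0, 0) = (0, 0)" by (simp add: F \<psi>(2))
  have U0: "(0, 0) \<in> U" using r by (simp add: U_def)
  then have W0: "(0, 0) \<in> W" unfolding W_def using F0 by (metis imageI)
  let ?V = "push_field ?F G (vfield m \<psi>)"
  have V: "?V q = (snd q, (1 - m) * fst q * snd q - fst q * \<theta> (snd q + s * (fst q)\<^sup>2))" if q: "q \<in> W" for q
  proof -
    obtain p where p: "p \<in> U" "q = ?F p" using q W_def by auto
    have y: "\<bar>snd p\<bar> < r" using p by (simp add: U_def)
    have "?V q = (fst (vfield m \<psi> p), (1 - m) * fst p * fst (vfield m \<psi> p) + deriv \<psi> (snd p) * snd (vfield m \<psi> p))"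
      unfolding push_field_def p(2) GF[OF p(1)]
      by (simp flip: frechet_derivative_at[OF coords_has_derivative[OF d\<psi>[OF y]]])
    moreover have "vfield m \<psi> p = (snd q, - fst p * snd p)" "fst q = fst p"
      "\<psi> (snd p) = snd q + s * (fst q)\<^sup>2"
      using p(2) by (simp_all add: F vfield_def Phi_def s case_prod_beta)
    ultimately show ?thesis using \<theta>[OF y] by (simp add: algebra_simps)
  qed
  have evW: "\<forall>\<^sub>F q in nhds (0, 0). q \<in> W" using opW W0 by (rule eventually_nhds_in_open)
  \<comment> \<open>the power series of \<open>\<theta>(h) - h\<close>\<close>
  define c' where "c' n = c n - (if n = 1 then 1 else 0)" for n
  have ser': "(\<lambda>n. c' n * h ^ n) sums (\<theta> h - h)" if "\<bar>h\<bar> < R" for h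
  proof -
    have "(\<lambda>n. if n = 1 then h ^ n else 0) sums (h ^ 1)" by (rule sums_single)
    from sums_diff[OF ser[rule_format, OF that] this] have "(\<lambda>n. c n * h ^ n - (if n = 1 then h ^ n else 0)) sums (\<theta> h - h)"
      by simp
    moreover have "(\<lambda>n. c n * h ^ n - (if n = 1 then h ^ n else 0)) = (\<lambda>n. c' n * h ^ n)"
      by (auto simp: c'_def fun_eq_iff algebra_simps)
    ultimately show ?thesis by simp
  qed
  have c'0: "c' n = 0" if "n < 2" for n using that c by (auto simp: c'_def less_2_cases_iff)
  let ?C = "\<lambda>i j. case i of 0 \<Rightarrow> 0 | Suc i' \<Rightarrow> - 1 * composed_coeff c' s 0 i' j"
  have "has_power_series2 (\<lambda>q. - 1 * fst q *
      (case q of (u, v) \<Rightarrow> \<theta> (v + 0 * u + s * u\<^sup>2) - (v + 0 * u + s * u\<^sup>2))) ?C"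
    by (rule has_power_series2_mult_fst,
        rule has_power_series2_composed[OF r(2), where f = "\<lambda>h. \<theta> h - h"]) (rule ser')
  then have "has_power_series2 (\<lambda>(\<xi>, \<eta>). snd (?V (\<xi>, \<eta>)) - ((1 - m) / 2 * \<xi> ^ 3 + - m * \<xi> * \<eta>)) ?C"
  proof (rule has_power_series2_cong)
    show "\<forall>\<^sub>F q in nhds (0, 0). - 1 * fst q *
      (case q of (u, v) \<Rightarrow> \<theta> (v + 0 * u + s * u\<^sup>2) - (v + 0 * u + s * u\<^sup>2)) =
      (case q of (\<xi>, \<eta>) \<Rightarrow> snd (?V (\<xi>, \<eta>)) - ((1 - m) / 2 * \<xi> ^ 3 + - m * \<xi> * \<eta>))"
      using evW
    proof eventually_elim
      case (elim q)
      obtain x y where q: "q = (x, y)" by fastforce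
      have "snd (?V (x, y)) = (1 - m) * x * y - x * \<theta> (y + s * x\<^sup>2)" using V[OF elim] by (simp add: q)
      then show ?case unfolding q prod.case s by (simp add: algebra_simps power2_eq_square power3_eq_cube)
    qed
  qed
  moreover have "?C i j = 0" if "qh_weight i j < 5" for i j
  proof (cases i)
    case (Suc i')
    then have "i' + 2 * j < 2 * 2" using that by (simp add: qh_weight_def)
    then have "composed_coeff c' s 0 i' j = 0" using c'0 composed_coeff_weight by blast
    then show ?thesis using Suc by simp
  qed simp
  moreover have "\<forall>\<^sub>F q in nhds (0, 0). fst (?V q) = snd q"
    using evW by eventually_elim (simp add: V)
  ultimately have "qh_form ((1 - m) / 2) (- m) ?V" unfolding qh_form_def by blast
  then show ?thesis using U0 F0 diffeo by blast
qed

section \<open>Scalings of the quasi-homogeneous form\<close>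

lemma has_power_series2_rescale:
  assumes "has_power_series2 f c" "\<alpha> \<noteq> 0" "\<beta> \<noteq> 0"
  shows "has_power_series2 (\<lambda>(u, v). k * f (u / \<alpha>, v / \<beta>)) (\<lambda>i j. k * c i j / (\<alpha> ^ i * \<beta> ^ j))"
proof -
  obtain r where r: "0 < r" "\<And>u v. \<bar>u\<bar> < r \<Longrightarrow> \<bar>v\<bar> < r \<Longrightarrow>
      ((\<lambda>(i, j). c i j * u ^ i * v ^ j) has_sum f (u, v)) UNIV"
    using assms unfolding has_power_series2_def by blast
  have "((\<lambda>(i, j). k * c i j / (\<alpha> ^ i * \<beta> ^ j) * u ^ i * v ^ j) has_sum k * f (u / \<alpha>, v / \<beta>)) UNIV"
    if "\<bar>u\<bar> < min (r * \<bar>\<alpha>\<bar>) (r * \<bar>\<beta>\<bar>)" "\<bar>v\<bar> < min (r * \<bar>\<alpha>\<bar>) (r * \<bar>\<beta>\<bar>)" for u v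
  proof -
    have "\<bar>u / \<alpha>\<bar> < r" "\<bar>v / \<beta>\<bar> < r" using that assms by (simp_all add: field_simps)
    from has_sum_cmult_right[OF r(2)[OF this], of k]
    moreover have "k * (case x of (i, j) \<Rightarrow> c i j * (u / \<alpha>) ^ i * (v / \<beta>) ^ j)
        = (case x of (i, j) \<Rightarrow> k * c i j / (\<alpha> ^ i * \<beta> ^ j) * u ^ i * v ^ j)" for x
      by (simp add: power_divide split: prod.split)
    ultimately show ?thesis by (simp only:)
  qed
  moreover have "0 < min (r * \<bar>\<alpha>\<bar>) (r * \<bar>\<beta>\<bar>)" using r assms by simp
  ultimately show ?thesis
    unfolding has_power_series2_def prod.case
    by (intro exI[of _ "min (r * \<bar>\<alpha>\<bar>) (r * \<bar>\<beta>\<bar>)"] conjI allI impI)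
qed

lemma qh_form_rescale:
  assumes V: "qh_form a b V" and nz: "\<alpha> \<noteq> 0" "\<beta> \<noteq> 0" "\<gamma> \<noteq> 0" and e: "\<beta> * \<gamma> = \<alpha>"
  shows "qh_form (a / (\<gamma> * \<alpha>)\<^sup>2) (b / (\<gamma> * \<alpha>)) (rescale \<alpha> \<beta> \<gamma> V)"
proof -
  obtain c where fst: "\<forall>\<^sub>F q in nhds (0, 0). fst (V q) = snd q"
    and c: "has_power_series2 (\<lambda>(\<xi>, \<eta>). snd (V (\<xi>, \<eta>)) - (a * \<xi> ^ 3 + b * \<xi> * \<eta>)) c"
      "\<And>i j. qh_weight i j < 5 \<Longrightarrow> c i j = 0"
    using V unfolding qh_form_def by blast
  have \<beta>: "\<beta> = \<alpha> / \<gamma>" using e nz by (simp add: field_simps)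
  have ft: "((\<lambda>q. fst q) \<longlongrightarrow> fst (0::real, 0::real)) (nhds (0::real, 0::real))" by (rule tendsto_fst[where f = "\<lambda>x. x", OF filterlim_ident])
  have st: "((\<lambda>q. snd q) \<longlongrightarrow> snd (0::real, 0::real)) (nhds (0::real, 0::real))" by (rule tendsto_snd[where f = "\<lambda>x. x", OF filterlim_ident])
  have "((\<lambda>q. (fst q / \<alpha>, snd q / \<beta>)) \<longlongrightarrow> (fst (0::real, 0::real) / \<alpha>, snd (0::real, 0::real) / \<beta>)) (nhds (0::real, 0::real))"
    by (intro tendsto_Pair tendsto_divide tendsto_const ft st nz)
  then have "filterlim (\<lambda>q. (fst q / \<alpha>, snd q / \<beta>)) (nhds (0, 0)) (nhds (0::real, 0::real))" by simp
  from eventually_compose_filterlim[OF fst this]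
  have "\<forall>\<^sub>F q in nhds (0, 0). fst (rescale \<alpha> \<beta> \<gamma> V q) = snd q"
  proof eventually_elim
    case (elim q)
    have "\<alpha> / \<gamma> = \<beta>" using e nz by (simp add: field_simps)
    then show ?case using elim nz by (simp add: rescale_def case_prod_beta)
  qed
  moreover have "has_power_series2 (\<lambda>(\<xi>, \<eta>). snd (rescale \<alpha> \<beta> \<gamma> V (\<xi>, \<eta>))
      - (a / (\<gamma> * \<alpha>)\<^sup>2 * \<xi> ^ 3 + b / (\<gamma> * \<alpha>) * \<xi> * \<eta>)) (\<lambda>i j. \<beta> / \<gamma> * c i j / (\<alpha> ^ i * \<beta> ^ j))"
  proof -
    have "(\<lambda>(u, v). \<beta> / \<gamma> * (case (u / \<alpha>, v / \<beta>) of (\<xi>, \<eta>) \<Rightarrow> snd (V (\<xi>, \<eta>)) - (a * \<xi> ^ 3 + b * \<xi> * \<eta>)))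
      = (\<lambda>(\<xi>, \<eta>). snd (rescale \<alpha> \<beta> \<gamma> V (\<xi>, \<eta>)) - (a / (\<gamma> * \<alpha>)\<^sup>2 * \<xi> ^ 3 + b / (\<gamma> * \<alpha>) * \<xi> * \<eta>))"
    proof -
      have "\<beta> / \<gamma> * (w - (a * (u / \<alpha>) ^ 3 + b * (u / \<alpha>) * (v / \<beta>)))
          = \<beta> / \<gamma> * w - (a / (\<gamma> * \<alpha>)\<^sup>2 * u ^ 3 + b / (\<gamma> * \<alpha>) * u * v)" for u v w
        unfolding \<beta> using nz by (simp add: field_simps power2_eq_square power3_eq_cube)
      note eq = this
      show ?thesis
      proof (rule ext)
        fix x :: "real \<times> real"
        obtain u v where x: "x = (u, v)" by fastforce
        show "(case x of (u, v) \<Rightarrow> \<beta> / \<gamma> * (case (u / \<alpha>, v / \<beta>) of (\<xi>, \<eta>) \<Rightarrow> snd (V (\<xi>, \<eta>)) - (a * \<xi> ^ 3 + b * \<xi> * \<eta>)))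
          = (case x of (\<xi>, \<eta>) \<Rightarrow> snd (rescale \<alpha> \<beta> \<gamma> V (\<xi>, \<eta>)) - (a / (\<gamma> * \<alpha>)\<^sup>2 * \<xi> ^ 3 + b / (\<gamma> * \<alpha>) * \<xi> * \<eta>))"
          unfolding x rescale_def prod.case snd_conv by (rule eq)
      qed
    qed
    then show ?thesis using has_power_series2_rescale[OF c(1) nz(1,2), of "\<beta> / \<gamma>"] by simp
  qed
  moreover have "\<beta> / \<gamma> * c i j / (\<alpha> ^ i * \<beta> ^ j) = 0" if "qh_weight i j < 5" for i j
    using c(2)[OF that] by simp
  ultimately show ?thesis
    unfolding qh_form_def
    by (intro conjI exI[of _ "\<lambda>i j. \<beta> / \<gamma> * c i j / (\<alpha> ^ i * \<beta> ^ j)"] allI impI)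
qed

text \<open>On the parabola \<open>\<eta> = l t\<^sup>2\<close>, \<open>\<xi> = t\<close>, a monomial of weight \<open>w\<close> is of order \<open>t\<^sup>w\<close>, so the remainder is \<open>O(t\<^sup>5)\<close>.
  For \<open>\<bar>l\<bar> \<le> 1\<close> the constant is the absolute sum of the remainder at \<open>(r\<^sub>0, r\<^sub>0\<^sup>2)\<close>.\<close>
lemma qh_form_limit:
  assumes V: "qh_form a b V" and l: "\<bar>l\<bar> \<le> 1"
  shows "((\<lambda>t. snd (V (t, l * t\<^sup>2)) / t ^ 3) \<longlongrightarrow> a + b * l) (at_right 0)"
proof -
  let ?R = "\<lambda>u v. snd (V (u, v)) - (a * u ^ 3 + b * u * v)"
  obtain c where c: "\<And>i j. qh_weight i j < 5 \<Longrightarrow> c i j = 0"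
    and ps: "has_power_series2 (\<lambda>(\<xi>, \<eta>). snd (V (\<xi>, \<eta>)) - (a * \<xi> ^ 3 + b * \<xi> * \<eta>)) c"
    using V unfolding qh_form_def by blast
  obtain r where r1: "0 < r" and r2: "\<forall>u v. \<bar>u\<bar> < r \<longrightarrow> \<bar>v\<bar> < r \<longrightarrow>
      ((\<lambda>(i, j). c i j * u ^ i * v ^ j) has_sum (case (u, v) of (\<xi>, \<eta>) \<Rightarrow> ?R \<xi> \<eta>)) UNIV"
    using ps unfolding has_power_series2_def by blast
  have r: "0 < r" "\<And>u v. \<bar>u\<bar> < r \<Longrightarrow> \<bar>v\<bar> < r \<Longrightarrow>
      ((\<lambda>(i, j). c i j * u ^ i * v ^ j) has_sum ?R u v) UNIV"
    using r1 r2 by simp_all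
  define r0 where "r0 = min (r / 2) 1"
  have r0: "0 < r0" "r0 < r" "r0\<^sup>2 < r"
  proof -
    show "0 < r0" "r0 < r" using r(1) by (auto simp: r0_def)
    have "r0 * r0 \<le> r0 * 1" using r(1) by (intro mult_left_mono) (auto simp: r0_def)
    then show "r0\<^sup>2 < r" using \<open>r0 < r\<close> by (simp add: power2_eq_square)
  qed
  let ?g = "\<lambda>(i, j). \<bar>c i j\<bar> * r0 ^ i * (r0\<^sup>2) ^ j"
  have "(\<lambda>(i, j). c i j * r0 ^ i * (r0\<^sup>2) ^ j) summable_on UNIV"
    using r(2)[of r0 "r0\<^sup>2"] r0 has_sum_imp_summable by fastforce
  then have "(\<lambda>x. norm (case x of (i, j) \<Rightarrow> c i j * r0 ^ i * (r0\<^sup>2) ^ j)) summable_on UNIV"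
    using summable_on_iff_abs_summable_on_real by blast
  moreover have "(\<lambda>x. norm (case x of (i, j) \<Rightarrow> c i j * r0 ^ i * (r0\<^sup>2) ^ j)) = ?g"
    using r0 by (auto simp: fun_eq_iff abs_mult)
  ultimately obtain M where M: "(?g has_sum M) UNIV" unfolding summable_on_def by auto
  have bound: "\<bar>?R t (l * t\<^sup>2)\<bar> \<le> (t / r0) ^ 5 * M" if t: "0 < t" "t < r0" for t
  proof -
    \<comment> \<open>homogeneity: passing from \<open>r0\<close> to \<open>t = q r0\<close> multiplies a monomial of weight \<open>w\<close> by \<open>q\<^sup>w \<le> q\<^sup>5\<close>\<close>
    define q where "q = t / r0"
    have q: "0 < q" "q < 1" "t = q * r0" using t r0 by (auto simp: q_def)
    have "\<bar>l * t\<^sup>2\<bar> = \<bar>l\<bar> * t\<^sup>2" by (simp add: abs_mult)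
    also have "\<dots> \<le> 1 * t\<^sup>2" by (intro mult_right_mono l) simp
    also have "\<dots> \<le> r0\<^sup>2" using t by (simp add: power_mono)
    finally have S: "((\<lambda>(i, j). c i j * t ^ i * (l * t\<^sup>2) ^ j) has_sum ?R t (l * t\<^sup>2)) UNIV"
      using t r0 by (intro r(2)) auto
    have B: "((\<lambda>x. q ^ 5 * ?g x) has_sum q ^ 5 * M) UNIV" by (rule has_sum_cmult_right[OF M])
    have le: "\<bar>c i j * t ^ i * (l * t\<^sup>2) ^ j\<bar> \<le> q ^ 5 * ?g (i, j)" for i j
    proof (cases "qh_weight i j < 5")
      case False
      have "\<bar>c i j * t ^ i * (l * t\<^sup>2) ^ j\<bar> = \<bar>c i j\<bar> * t ^ i * (\<bar>l\<bar> ^ j * (t\<^sup>2) ^ j)"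
        using t by (simp add: abs_mult power_abs power_mult_distrib)
      also have "\<dots> \<le> \<bar>c i j\<bar> * t ^ i * (1 * (t\<^sup>2) ^ j)"
        using l t by (intro mult_left_mono mult_right_mono power_le_one) auto
      also have "\<dots> = q ^ (i + 2 * j) * ?g (i, j)"
        unfolding q(3) by (simp add: power_mult_distrib power_mult[symmetric] power_add mult_ac)
      also have "\<dots> \<le> q ^ 5 * ?g (i, j)"
        using q r0 False by (intro mult_right_mono power_decreasing) (auto simp: qh_weight_def)
      finally show ?thesis .
    qed (use c in simp)
    have "?R t (l * t\<^sup>2) \<le> q ^ 5 * M"
      by (rule has_sum_mono[OF S B]) (use le abs_le_D1 in fastforce)
    moreover have S': "((\<lambda>x. - (case x of (i, j) \<Rightarrow> c i j * t ^ i * (l * t\<^sup>2) ^ j)) has_sum - ?R t (l * t\<^sup>2)) UNIV"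
      using S by (simp only: has_sum_uminus minus_minus)
    have "- ?R t (l * t\<^sup>2) \<le> q ^ 5 * M"
      by (rule has_sum_mono[OF S' B]) (use le abs_le_D2 in fastforce)
    ultimately show ?thesis by (simp add: q_def abs_le_iff)
  qed
  have "((\<lambda>t. ?R t (l * t\<^sup>2) / t ^ 3) \<longlongrightarrow> 0) (at_right 0)"
  proof (rule Lim_null_comparison)
    show "\<forall>\<^sub>F t in at_right 0. norm (?R t (l * t\<^sup>2) / t ^ 3) \<le> M / r0 ^ 5 * t\<^sup>2"
      using eventually_at_right_real[OF r0(1)]
    proof eventually_elim
      case (elim t)
      then have t: "0 < t" "t < r0" by auto
      have "norm (?R t (l * t\<^sup>2) / t ^ 3) = \<bar>?R t (l * t\<^sup>2)\<bar> / t ^ 3" using t by (simp add: abs_divide)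
      also have "\<dots> \<le> (t / r0) ^ 5 * M / t ^ 3"
        using bound[OF t] t by (intro divide_right_mono) auto
      also have "\<dots> = M / r0 ^ 5 * t\<^sup>2" using t r0 by (simp add: power_divide power_numeral_reduce)
      finally show ?case .
    qed
    have "((\<lambda>t. M / r0 ^ 5 * t\<^sup>2) \<longlongrightarrow> M / r0 ^ 5 * 0\<^sup>2) (at_right 0)" by (intro tendsto_intros)
    then show "((\<lambda>t. M / r0 ^ 5 * t\<^sup>2) \<longlongrightarrow> 0) (at_right 0)" by simp
  qed
  then have "((\<lambda>t. ?R t (l * t\<^sup>2) / t ^ 3 + (a + b * l)) \<longlongrightarrow> 0 + (a + b * l)) (at_right 0)"
    by (intro tendsto_intros)
  moreover have "\<forall>\<^sub>F t in at_right 0. ?R t (l * t\<^sup>2) / t ^ 3 + (a + b * l) = snd (V (t, l * t\<^sup>2)) / t ^ 3"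
    using eventually_at_right_less[of "0::real"]
    by eventually_elim (simp add: field_simps power2_eq_square power3_eq_cube)
  ultimately show ?thesis using Lim_transform_eventually by fastforce
qed

lemma qh_form_unique:
  assumes "qh_form a b V" "qh_form a' b' V"
  shows "a = a' \<and> b = b'"
proof -
  have "a + b * l = a' + b' * l" if "\<bar>l\<bar> \<le> 1" for l
    using tendsto_unique[OF trivial_limit_at_right_real qh_form_limit[OF assms(1) that] qh_form_limit[OF assms(2) that]] .
  from this[of 0] this[of 1] show ?thesis by simp
qed

section \<open>The germ at the origin\<close>

text \<open>The sign is invariant because \<open>b\<^sup>2 + 8 a\<close> is multiplied by \<open>1 / (\<gamma> \<alpha>)\<^sup>2 > 0\<close>.\<close>
theorem theorem8p1:
  fixes m a\<^sub>3 b\<^sub>1 :: real and \<psi> :: "real \<Rightarrow> real"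
  assumes "m > 1"
    and "real_analytic_at \<psi> 0" and "\<psi> 0 = 0" and "deriv \<psi> 0 \<noteq> 0"
    and "a\<^sub>3 = (1 - m) / 2" and "b\<^sub>1 = - m"
  shows "det (jacobian_matrix (coords m \<psi>) (0, 0)) = deriv (\<lambda>y. Phi m \<psi> (0, y)) 0
       \<and> deriv (\<lambda>y. Phi m \<psi> (0, y)) 0 = deriv \<psi> 0
       \<and> det (jacobian_matrix (coords m \<psi>) (0, 0)) \<noteq> 0
       \<and> (\<exists>U W G. (0, 0) \<in> U \<and> coords m \<psi> (0, 0) = (0, 0) \<and>
            analytic_diffeo (coords m \<psi>) U W G \<and>
            qh_form a\<^sub>3 b\<^sub>1 (push_field (coords m \<psi>) G (vfield m \<psi>)))
       \<and> (\<forall>V a b \<alpha> \<beta> \<gamma>. qh_form a b V \<longrightarrow>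
            \<alpha> \<noteq> 0 \<longrightarrow> \<beta> \<noteq> 0 \<longrightarrow> \<gamma> \<noteq> 0 \<longrightarrow> \<beta> * \<gamma> = \<alpha> \<longrightarrow>
            (\<exists>a' b'. qh_form a' b' (rescale \<alpha> \<beta> \<gamma> V)) \<and>
            (\<forall>a' b'. qh_form a' b' (rescale \<alpha> \<beta> \<gamma> V) \<longrightarrow>
               sgn (b'\<^sup>2 + 8 * a') = sgn (b\<^sup>2 + 8 * a)))
       \<and> b\<^sub>1\<^sup>2 + 8 * a\<^sub>3 = m\<^sup>2 + 4 * (1 - m)
       \<and> m\<^sup>2 + 4 * (1 - m) = (m - 2)\<^sup>2 \<and> (m - 2)\<^sup>2 \<ge> 0
       \<and> a\<^sub>3 < 0
       \<and> local_phase_portrait (vfield m \<psi>) (0, 0) 1 1"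
proof (intro conjI allI impI)
  note \<psi> = assms(2-4)
  have d: "(\<psi> has_real_derivative deriv \<psi> 0) (at 0)"
    using analytic_inverse[OF \<psi>] abs_zero by metis
  have det: "det (jacobian_matrix (coords m \<psi>) (0, 0)) = deriv \<psi> 0" by (rule det_jacobian_coords[OF d])
  show \<Phi>: "deriv (\<lambda>y. Phi m \<psi> (0, y)) 0 = deriv \<psi> 0" by (simp add: Phi_def)
  show "det (jacobian_matrix (coords m \<psi>) (0, 0)) = deriv (\<lambda>y. Phi m \<psi> (0, y)) 0"
    using det \<Phi> by simp
  show "det (jacobian_matrix (coords m \<psi>) (0, 0)) \<noteq> 0" using det \<psi>(3) by simp
  show "\<exists>U W G. (0, 0) \<in> U \<and> coords m \<psi> (0, 0) = (0, 0) \<and> analytic_diffeo (coords m \<psi>) U W G \<and>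
      qh_form a\<^sub>3 b\<^sub>1 (push_field (coords m \<psi>) G (vfield m \<psi>))"
    unfolding assms(5,6) by (rule qh_coordinates[OF \<psi>])
  show "local_phase_portrait (vfield m \<psi>) (0, 0) 1 1" by (rule vfield_portrait[OF assms(1) \<psi>])
  show "b\<^sub>1\<^sup>2 + 8 * a\<^sub>3 = m\<^sup>2 + 4 * (1 - m)" "a\<^sub>3 < 0" using assms by auto
  show "m\<^sup>2 + 4 * (1 - m) = (m - 2)\<^sup>2" by (simp add: power2_eq_square algebra_simps)
next
  fix V and a b \<alpha> \<beta> \<gamma> :: real
  assume V: "qh_form a b V" and nz: "\<alpha> \<noteq> 0" "\<beta> \<noteq> 0" "\<gamma> \<noteq> 0" "\<beta> * \<gamma> = \<alpha>"
  note q = qh_form_rescale[OF V nz]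
  then show "\<exists>a' b'. qh_form a' b' (rescale \<alpha> \<beta> \<gamma> V)" by blast
  fix a' b' assume "qh_form a' b' (rescale \<alpha> \<beta> \<gamma> V)"
  then have "a' = a / (\<gamma> * \<alpha>)\<^sup>2" "b' = b / (\<gamma> * \<alpha>)" using qh_form_unique q by blast+
  then have "b'\<^sup>2 + 8 * a' = (b\<^sup>2 + 8 * a) * (1 / (\<gamma> * \<alpha>)\<^sup>2)"
    by (simp add: power_divide add_divide_distrib)
  moreover have "0 < 1 / (\<gamma> * \<alpha>)\<^sup>2" using nz by simp
  ultimately show "sgn (b'\<^sup>2 + 8 * a') = sgn (b\<^sup>2 + 8 * a)"
    by (simp only: sgn_mult sgn_pos mult.right_neutral)
qed simp

end
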